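(* Let $0\le c_1<c_2$ be the fixed constants in the definition of the parabolic mean value inequality. For a weighted graph $(\Gamma,\mu)$ satisfying $(p_0)$, $(VD)$ and $(TC)$, the following statements are equivalent. 1. (Local diagonal upper estimate) There is $C>0$ such that for all $x\in\Gamma$, $n>0$, $$p_n(x,x)\le\frac{C}{V(x,e(x,n))}.$$ 2. (Upper estimate) There are $C>0,\beta>1,c>0$ such that for all $x,y\in\Gamma$, $n>0$, $$p_n(x,y)\le\frac{C}{V(x,e(x,n))}\exp\left[-c\left(\frac{E(x,d(x,y))}{n}\right)^{\frac1{\beta-1}}\right].$$ 3. (Parabolic mean value inequality) There is $C>1$ such that for all $x\in\Gamma$ and $R>0$, writing $E=E(x,R)$, $B=B(x,R)$, $n=c_2E$, every nonnegative Dirichlet solution of $P^Bu_i=u_{i+1}$ on $[0,n]\times B$ satisfies $$u_n(x)\le\frac{C}{V(x,R)E(x,R)}\sum_{i=c_1E}^{n}\ \sum_{y\in B(x,R)}u_i(y)\mu(y).$$ 4. (Mean value inequality) There is $C>0$ such that for all $x\in\Gamma$, $R>0$ and all $u\ge0$ harmonic on $B=B(x,R)$, $$u(x)\le\frac{C}{V(x,R)}\sum_{y\in B}u(y)\mu(y).$$ 5. (Mean value property for Green kernels) There is $C>1$ such that for all $R>0$, $x\in\Gamma$, $B=B(x,R)$ and $y\in\Gamma$ with $d=d(x,y)>0$, $$g^B(y,x)\le\frac{C}{V(x,d)}\sum_{z\in B(x,d)}g^B(y,z)\mu(z).$$ 6. There is $C>1$ such that for all $R>0$, $x\in\Gamma$,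 $B=B(x,R)$ and $y\in\Gamma$ with $d=d(x,y)>0$, $$g^B(y,x)\le C\,\frac{E(x,R)}{V(x,d)}.$$
   Context: Setting. $\Gamma$ is a countable infinite connected graph; $x\sim y$ means that $x,y$ are joined by an edge. Each edge carries a weight $\mu_{x,y}=\mu_{y,x}>0$; $\mu(x)=\sum_{y\sim x}\mu_{x,y}$ and $\mu(A)=\sum_{y\in A}\mu(y)$. The random walk $(X_n)$ on $(\Gamma,\mu)$ is the Markov chain with transition probabilities $P(x,y)=\mu_{x,y}/\mu(x)$; $P_n(x,y)=\mathbb P(X_n=y\mid X_0=x)$ and $p_n(x,y)=P_n(x,y)/\mu(y)$. The time $n$ is an integer. $d(x,y)$ is the graph distance, $B(x,R)=\{y:d(x,y)<R\}$, $V(x,R)=\mu(B(x,R))$. $T_{B(x,R)}=\min\{k: X_k\notin B(x,R)\}$, and $E(x,R)=\mathbb E(T_{B(x,R)}\mid X_0=x)$ is the mean exit time. $e(x,n)=\min\{R\in\mathbb N: E(x,R)\ge n\}$ is the inverse of $E(x,\cdot)$. Conditions. $(p_0)$: there is $p_0>0$ with $\mu_{x,y}/\mu(x)\ge p_0$ for all $x\sim y$. $(VD)$: there is $D_V>0$ with $V(x,2R)\le D_V V(x,R)$ for all $x\in\Gamma,R>0$. $(TC)$: there is $C_T>1$ with $E(x,2R)/E(y,R)\le C_T$ for all $x\in\Gamma$, $R>0$, $y\in B(x,R)$. For $A\subset\Gamma$, $\overline A$ is $A$ together with all vertices adjacent to a vertex of $A$. A function $h$ is harmonic on $A$ if it is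 defined on $\overline A$ and $\sum_y P(x,y)h(y)=h(x)$ for all $x\in A$. $P^A$ is the transition operator restricted to functions supported in $A$ (walk killed on leaving $A$): $P^Af(x)=\sum_{y\in A}P(x,y)f(y)$ for $x\in A$, $0$ for $x\notin A$; $P^A_k(y,z)$ are the kernels of its iterates. The Green kernel is $g^A(y,z)=\frac1{\mu(z)}\sum_{k=0}^\infty P^A_k(y,z)$. A nonnegative Dirichlet solution of $P^Bu_i=u_{i+1}$ on $[0,n]\times B$ is a sequence of functions $u_i\ge0$ supported in $B$ satisfying the equation on this time range. Non-integer times and summation limits ($c_1E$, $c_2E$) are replaced by their integer parts. *)

theory Defs
  imports "HOL-Probability.Probability"
begin

text \<open>
  The vertex set is the whole type \<^typ>\<open>'a\<close>.  The weight \<^term>\<open>w\<close> is only meaningful on edges.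
  Summability of the weights at a vertex is implicit in the use of \<open>\<mu>(x)\<close> as a finite
  normalising constant; loops are not excluded.
\<close>

locale weighted_graph =
  fixes adj :: "'a \<Rightarrow> 'a \<Rightarrow> bool"
    and w :: "'a \<Rightarrow> 'a \<Rightarrow> real"
  assumes countable_vertices: "countable (UNIV :: 'a set)"
    and infinite_vertices: "infinite (UNIV :: 'a set)"
    and adj_sym: "adj x y \<Longrightarrow> adj y x"
    and connected_graph: "adj\<^sup>*\<^sup>* x y"
    and weight_pos: "adj x y \<Longrightarrow> 0 < w x y"
    and weight_sym: "adj x y \<Longrightarrow> w x y = w y x"
    and weight_summable: "w x summable_on {y. adj x y}"
begin

definition mu :: "'a \<Rightarrow> real" where
  "mu x = (\<Sum>\<^sub>\<infinity>y\<in>{y. adj x y}. w x y)"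

definition trans_prob :: "'a \<Rightarrow> 'a \<Rightarrow> real" where
  "trans_prob x y = (if adj x y then w x y / mu x else 0)"

definition gdist :: "'a \<Rightarrow> 'a \<Rightarrow> nat" where
  "gdist x y = (LEAST n. (adj ^^ n) x y)"

definition gball :: "'a \<Rightarrow> real \<Rightarrow> 'a set" where
  "gball x R = {y. real (gdist x y) < R}"

definition vol :: "'a \<Rightarrow> real \<Rightarrow> real" where
  "vol x R = (\<Sum>\<^sub>\<infinity>y\<in>gball x R. mu y)"


text \<open>
  The law of the random walk \<open>(X\<^sub>n)\<close> started at \<open>x\<close> is the Ionescu-Tulcea measure on the space
  of trajectories \<open>\<omega>\<close>, with \<open>X\<^sub>n(\<omega>) = \<omega> n\<close>: given \<open>\<omega> 0, \<dots>, \<omega> (n - 1)\<close>, the point \<open>\<omega> n\<close> is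
  distributed according to \<open>walk_kernel x n \<omega>\<close>.
\<close>

definition step :: "'a \<Rightarrow> 'a pmf" where
  "step x = embed_pmf (trans_prob x)"

definition walk_kernel :: "'a \<Rightarrow> nat \<Rightarrow> (nat \<Rightarrow> 'a) \<Rightarrow> 'a measure" where
  "walk_kernel x n \<omega> =
     (case n of 0 \<Rightarrow> return (count_space UNIV) x | Suc m \<Rightarrow> measure_pmf (step (\<omega> m)))"

definition walk :: "'a \<Rightarrow> (nat \<Rightarrow> 'a) measure" where
  "walk x = projective_family.lim UNIV
     (Ionescu_Tulcea.CI (walk_kernel x) (\<lambda>_. count_space UNIV)) (\<lambda>_. count_space UNIV)"

definition walk_prob :: "nat \<Rightarrow> 'a \<Rightarrow> 'a \<Rightarrow> real" where
  "walk_prob n x y = measure (walk x) {\<omega>. \<omega> n = y}"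

definition heat_kernel :: "nat \<Rightarrow> 'a \<Rightarrow> 'a \<Rightarrow> real" where
  "heat_kernel n x y = walk_prob n x y / mu y"

definition exit_time :: "'a set \<Rightarrow> (nat \<Rightarrow> 'a) \<Rightarrow> enat" where
  "exit_time A \<omega> = (INF k\<in>{k. \<omega> k \<notin> A}. enat k)"

text \<open>
  Under \<open>(p\<^sub>0)\<close> balls are finite and the expectation below is finite, so that passing to a
  real number loses nothing.
\<close>

definition mean_exit :: "'a \<Rightarrow> real \<Rightarrow> real" where
  "mean_exit x R = enn2real (\<integral>\<^sup>+\<omega>. ennreal_of_enat (exit_time (gball x R) \<omega>) \<partial>walk x)"

definition inv_exit :: "'a \<Rightarrow> nat \<Rightarrow> nat" where
  "inv_exit x n = (LEAST R. mean_exit x (real R) \<ge> real n)"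


definition p0_condition :: bool where
  "p0_condition \<longleftrightarrow> (\<exists>p0>0. \<forall>x y. adj x y \<longrightarrow> w x y / mu x \<ge> p0)"

definition VD :: bool where
  "VD \<longleftrightarrow> (\<exists>D>0. \<forall>x. \<forall>R>0. vol x (2 * R) \<le> D * vol x R)"

definition TC :: bool where
  "TC \<longleftrightarrow> (\<exists>C>1. \<forall>x. \<forall>R>0. \<forall>y\<in>gball x R. mean_exit x (2 * R) / mean_exit y R \<le> C)"


definition gclosure :: "'a set \<Rightarrow> 'a set" where
  "gclosure A = A \<union> {y. \<exists>x\<in>A. adj x y}"

text \<open>
  Functions on \<open>gclosure A\<close> are represented by total functions; the values outside
  \<open>gclosure A\<close> do not enter.
\<close>

definition harmonic_on :: "'a set \<Rightarrow> ('a \<Rightarrow> real) \<Rightarrow> bool" where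
  "harmonic_on A h \<longleftrightarrow> (\<forall>x\<in>A. (\<Sum>\<^sub>\<infinity>y\<in>{y. adj x y}. trans_prob x y * h y) = h x)"

definition killed_op :: "'a set \<Rightarrow> ('a \<Rightarrow> real) \<Rightarrow> 'a \<Rightarrow> real" where
  "killed_op A f x = (if x \<in> A then \<Sum>\<^sub>\<infinity>y\<in>A. trans_prob x y * f y else 0)"

text \<open>
  The operator acts on functions supported in \<open>A\<close>, hence \<open>P\<^sup>A\<^sub>0(y,z)\<close> is \<open>1\<close> for
  \<open>y = z \<in> A\<close> and \<open>0\<close> otherwise.
\<close>

definition killed_prob :: "'a set \<Rightarrow> nat \<Rightarrow> 'a \<Rightarrow> 'a \<Rightarrow> real" where
  "killed_prob A k y z = (killed_op A ^^ k) (indicator ({z} \<inter> A)) y"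

definition green :: "'a set \<Rightarrow> 'a \<Rightarrow> 'a \<Rightarrow> real" where
  "green A y z = 1 / mu z * (\<Sum>k. killed_prob A k y z)"

definition nonneg_dirichlet_solution :: "'a set \<Rightarrow> nat \<Rightarrow> (nat \<Rightarrow> 'a \<Rightarrow> real) \<Rightarrow> bool" where
  "nonneg_dirichlet_solution B n u \<longleftrightarrow>
     (\<forall>i\<le>n. \<forall>y. 0 \<le> u i y) \<and>
     (\<forall>i\<le>n. \<forall>y. y \<notin> B \<longrightarrow> u i y = 0) \<and>
     (\<forall>i<n. killed_op B (u i) = u (Suc i))"


definition local_diagonal_upper_estimate :: bool where
  "local_diagonal_upper_estimate \<longleftrightarrow>
     (\<exists>C>0. \<forall>x. \<forall>n>0. heat_kernel n x x \<le> C / vol x (real (inv_exit x n)))"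

definition upper_estimate :: bool where
  "upper_estimate \<longleftrightarrow>
     (\<exists>C>0. \<exists>\<beta>>1. \<exists>c>0. \<forall>x y. \<forall>n>0.
        heat_kernel n x y \<le> C / vol x (real (inv_exit x n)) *
          exp (- c * (mean_exit x (real (gdist x y)) / real n) powr (1 / (\<beta> - 1))))"

definition parabolic_mean_value_inequality :: "real \<Rightarrow> real \<Rightarrow> bool" where
  "parabolic_mean_value_inequality c1 c2 \<longleftrightarrow>
     (\<exists>C>1. \<forall>x. \<forall>R>0.
        let E = mean_exit x R; B = gball x R; m = nat \<lfloor>c1 * E\<rfloor>; n = nat \<lfloor>c2 * E\<rfloor> in
        \<forall>u. nonneg_dirichlet_solution B n u \<longrightarrow>
          u n x \<le> C / (vol x R * E) * (\<Sum>i=m..n. \<Sum>\<^sub>\<infinity>y\<in>B. u i y * mu y))"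

definition mean_value_inequality :: bool where
  "mean_value_inequality \<longleftrightarrow>
     (\<exists>C>0. \<forall>x. \<forall>R>0. \<forall>u.
        (\<forall>y\<in>gclosure (gball x R). 0 \<le> u y) \<longrightarrow> harmonic_on (gball x R) u \<longrightarrow>
          u x \<le> C / vol x R * (\<Sum>\<^sub>\<infinity>y\<in>gball x R. u y * mu y))"

definition green_mean_value_property :: bool where
  "green_mean_value_property \<longleftrightarrow>
     (\<exists>C>1. \<forall>R>0. \<forall>x y. 0 < gdist x y \<longrightarrow>
        (let B = gball x R; d = real (gdist x y) in
          green B y x \<le> C / vol x d * (\<Sum>\<^sub>\<infinity>z\<in>gball x d. green B y z * mu z)))"

definition green_upper_bound :: bool where
  "green_upper_bound \<longleftrightarrow>
     (\<exists>C>1. \<forall>R>0. \<forall>x y. 0 < gdist x y \<longrightarrow>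
        green (gball x R) y x \<le> C * (mean_exit x R / vol x (real (gdist x y))))"


text \<open>The definition of the walk is meaningful and gives the expected finite-dimensional laws.\<close>

lemma mu_pos: "0 < mu x"
proof -
  obtain z where "z \<noteq> x" using infinite_vertices
    by (metis UNIV_I ex_new_if_finite finite.emptyI finite_insert insertI1)
  then obtain y where y: "adj x y"
    using connected_graph[of x z] by (metis converse_rtranclpE)
  have "sum (w x) {y} \<le> mu x" unfolding mu_def
    by (rule finite_sum_le_infsum[OF weight_summable]) (auto simp: y intro: less_imp_le weight_pos)
  then show ?thesis using weight_pos[OF y] by simp
qed

lemma pmf_step: "pmf (step x) y = trans_prob x y"
proof -
  have nn: "0 \<le> trans_prob x z" for z
    using mu_pos[of x] weight_pos[of x z] by (auto simp: trans_prob_def)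
  have "(w x has_sum mu x) {y. adj x y}"
    unfolding mu_def by (rule has_sum_infsum[OF weight_summable])
  from has_sum_cmult_left[OF this, of "inverse (mu x)"]
  have "((\<lambda>y. w x y / mu x) has_sum 1) {y. adj x y}"
    using mu_pos[of x] by (simp add: divide_inverse)
  then have sum1: "((\<lambda>y. trans_prob x y) has_sum 1) UNIV"
    by (rule has_sum_cong_neutral[THEN iffD1, rotated -1]) (auto simp: trans_prob_def)
  have "(\<lambda>y. norm (trans_prob x y)) summable_on UNIV"
    using has_sum_imp_summable[OF sum1] nn by simp
  note abs = this[unfolded abs_summable_equivalent]
  from abs have "(\<integral>\<^sup>+y. ennreal (trans_prob x y) \<partial>count_space UNIV) = ennreal (infsetsum (trans_prob x) UNIV)"
    by (rule nn_integral_conv_infsetsum) (auto intro: nn)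
  also have "infsetsum (trans_prob x) UNIV = 1"
    using infsumI[OF sum1] by (simp add: infsetsum_infsum[OF abs])
  finally have "(\<integral>\<^sup>+y. ennreal (trans_prob x y) \<partial>count_space UNIV) = 1"
    by simp
  then show ?thesis unfolding step_def by (rule pmf_embed_pmf[OF nn])
qed

lemma Ionescu_Tulcea_walk: "Ionescu_Tulcea (walk_kernel x) (\<lambda>_. count_space UNIV)"
  unfolding Ionescu_Tulcea_def
proof (intro conjI allI impI)
  fix i :: nat
  show "walk_kernel x i \<in> measurable (PiM {0..<i} (\<lambda>_. count_space UNIV)) (subprob_algebra (count_space UNIV))"
  proof (cases i)
    case 0
    have "return (count_space UNIV) x \<in> space (subprob_algebra (count_space UNIV))"
      by (auto simp: space_subprob_algebra intro!: prob_space_imp_subprob_space prob_space_return)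
    then show ?thesis
      using 0 by (simp add: walk_kernel_def[abs_def] measurable_const)
  next
    case (Suc m)
    have 1: "(\<lambda>a. measure_pmf (step a)) \<in> count_space UNIV \<rightarrow>\<^sub>M subprob_algebra (count_space UNIV)"
      by (auto simp: measurable_def space_subprob_algebra intro!: measure_pmf.subprob_space_axioms)
    have 2: "(\<lambda>\<omega>. \<omega> m) \<in> measurable (PiM {0..<i} (\<lambda>_. count_space UNIV)) (count_space UNIV)"
      using Suc by (intro measurable_component_singleton) auto
    show ?thesis using measurable_compose[OF 2 1] by (simp add: walk_kernel_def[abs_def] Suc)
  qed
next
  fix i :: nat and \<omega> :: "nat \<Rightarrow> 'a"
  show "prob_space (walk_kernel x i \<omega>)"
    by (cases i) (auto simp: walk_kernel_def prob_space_return measure_pmf.prob_space_axioms)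
qed

lemma emeasure_walk_cylinder:
  "emeasure (walk x) {\<omega>. \<forall>i\<le>n. \<omega> i = a i} =
     ennreal (if a 0 = x then \<Prod>i<n. trans_prob (a i) (a (Suc i)) else 0)"
proof -
  let ?M = "\<lambda>_::nat. count_space (UNIV :: 'a set)"
  interpret IT: Ionescu_Tulcea "walk_kernel x" ?M by (rule Ionescu_Tulcea_walk)
  define S where "S m = {restrict a {0..<m}}" for m
  have S_PiE: "S m = PiE {0..<m} (\<lambda>i. {a i})" for m
    by (auto simp: S_def PiE_def Pi_def extensional_def fun_eq_iff)
  have S_sets [measurable]: "S m \<in> sets (PiM {0..<m} ?M)" for m
    unfolding S_PiE by (intro sets_PiM_I_finite) auto
  have und [simp]: "(\<lambda>_. undefined) \<in> space (PiM {0..<0} ?M)" by (simp add: space_PiM)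
  have step_C: "emeasure (IT.C 0 (Suc m) (\<lambda>_. undefined)) (S (Suc m)) =
      emeasure (IT.C 0 m (\<lambda>_. undefined)) (S m) * emeasure (walk_kernel x m a) {a m}" for m
  proof -
    have sp: "space (IT.C 0 m (\<lambda>_. undefined)) = space (PiM {0..<m} ?M)"
      using IT.space_C[OF und] by simp
    have se: "sets (IT.C 0 m (\<lambda>_. undefined)) = sets (PiM {0..<m} ?M)"
      using IT.sets_C[OF und] by simp
    have eP: "IT.eP m \<in> IT.C 0 m (\<lambda>_. undefined) \<rightarrow>\<^sub>M subprob_algebra (PiM {0..<Suc m} ?M)"
      using IT.measurable_eP[of m] measurable_cong_sets[OF se refl] by blast
    have val: "emeasure (IT.eP m \<omega>) (S (Suc m)) = emeasure (walk_kernel x m a) {a m} * indicator (S m) \<omega>"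
      if \<omega>: "\<omega> \<in> space (PiM {0..<m} ?M)" for \<omega>
    proof -
      have ext: "\<omega> i = undefined" if "i \<ge> m" for i
        using \<omega> that by (auto simp: space_PiM PiE_def extensional_def)
      have "(fun_upd \<omega> m) -` S (Suc m) = (if \<omega> \<in> S m then {a m} else {})"
      proof -
        have "fun_upd \<omega> m y \<in> S (Suc m) \<longleftrightarrow> \<omega> \<in> S m \<and> y = a m" for y
        proof
          assume "fun_upd \<omega> m y \<in> S (Suc m)"
          then have e: "fun_upd \<omega> m y i = restrict a {0..<Suc m} i" for i by (simp add: S_def)
          have "\<omega> i = restrict a {0..<m} i" for i
            using e[of i] ext[of i] by (cases "i < m") auto
          then show "\<omega> \<in> S m \<and> y = a m" using e[of m] by (auto simp: S_def)
        next
          assume "\<omega> \<in> S m \<and> y = a m"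
          then show "fun_upd \<omega> m y \<in> S (Suc m)" by (auto simp: S_def fun_eq_iff)
        qed
        then show ?thesis by auto
      qed
      moreover have "walk_kernel x m \<omega> = walk_kernel x m a" if "\<omega> \<in> S m"
        using that by (auto simp: S_def walk_kernel_def split: nat.split)
      ultimately show ?thesis
        using IT.emeasure_eP[OF \<omega> S_sets] by (auto split: split_indicator)
    qed
    have "emeasure (IT.C 0 (Suc m) (\<lambda>_. undefined)) (S (Suc m)) =
        (\<integral>\<^sup>+\<omega>. emeasure (IT.eP m \<omega>) (S (Suc m)) \<partial>IT.C 0 m (\<lambda>_. undefined))"
      using emeasure_bind[OF _ eP S_sets] IT.prob_space_C[OF und, of m]
      by (simp add: prob_space.not_empty)
    also have "\<dots> = (\<integral>\<^sup>+\<omega>. emeasure (walk_kernel x m a) {a m} * indicator (S m) \<omega> \<partial>IT.C 0 m (\<lambda>_. undefined))"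
      by (intro nn_integral_cong) (auto simp: sp val)
    also have "\<dots> = emeasure (walk_kernel x m a) {a m} * emeasure (IT.C 0 m (\<lambda>_. undefined)) (S m)"
      by (intro nn_integral_cmult_indicator) (simp add: se)
    finally show ?thesis by (simp add: mult.commute)
  qed
  have C0: "emeasure (IT.C 0 0 (\<lambda>_. undefined)) (S 0) = 1"
    using S_sets[of 0] by (simp add: S_def restrict_def)
  have tp: "0 \<le> trans_prob b c" for b c
    by (simp flip: pmf_step)
  have main: "emeasure (IT.C 0 (Suc m) (\<lambda>_. undefined)) (S (Suc m)) =
      ennreal (if a 0 = x then \<Prod>i<m. trans_prob (a i) (a (Suc i)) else 0)" for m
  proof (induction m)
    case 0
    show ?case unfolding step_C C0
      by (auto simp: walk_kernel_def split: split_indicator)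
  next
    case (Suc m)
    show ?case unfolding step_C[of "Suc m"] Suc
      by (auto simp: walk_kernel_def emeasure_pmf_single pmf_step ennreal_mult prod_nonneg tp)
  qed
  have "{\<omega>. \<forall>i\<le>n. \<omega> i = a i} = IT.PF.emb UNIV {0..<Suc n} (S (Suc n))"
  proof (intro set_eqI)
    fix \<omega>
    have "restrict \<omega> {0..<Suc n} = restrict a {0..<Suc n} \<longleftrightarrow> (\<forall>i\<in>{0..<Suc n}. \<omega> i = a i)"
      by (metis restrict_apply' restrict_ext)
    then show "\<omega> \<in> {\<omega>. \<forall>i\<le>n. \<omega> i = a i} \<longleftrightarrow> \<omega> \<in> IT.PF.emb UNIV {0..<Suc n} (S (Suc n))"
      by (simp add: prod_emb_def S_def space_PiM Ball_def less_Suc_eq_le)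
  qed
  then have "emeasure (walk x) {\<omega>. \<forall>i\<le>n. \<omega> i = a i} = emeasure (IT.CI {0..<Suc n}) (S (Suc n))"
    unfolding walk_def by (simp add: IT.lim)
  also have "\<dots> = emeasure (IT.C 0 (Suc n) (\<lambda>_. undefined)) (IT.PF.emb {0..<Suc n} {0..<Suc n} (S (Suc n)))"
    by (rule IT.emeasure_CI) auto
  also have "IT.PF.emb {0..<Suc n} {0..<Suc n} (S (Suc n)) = S (Suc n)"
    by (rule prod_emb_id) (auto simp: S_def)
  finally show ?thesis unfolding main .
qed

end

end

theory Submission
  imports Defs
begin

text \<open>
  Besides connectedness and infinity of the graph, only volume doubling, the time comparison (which gives
  doubling of mean exit times) and the lower bound on transition probabilities enter: balls are finite, volume and
  exit time at one radius control them at any other up to powers of the ratio, exit times grow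
  at least polynomially (\<open>mean_exit_reverse\<close>), and volumes at a time scale can be compared at different
  centres (\<open>vol_le_vol_inv_exit\<close>, \<open>tvol_compare\<close>). Everything is formulated with powers of the transition operator
  killed outside a set; the law of the walk enters only through \<open>walk_prob_eq\<close> and \<open>mean_exit_eq\<close>.

  The second tool is the exit time tail \<open>exit_tail\<close>: the walk leaves \<open>B(x, R)\<close> before time \<open>n\<close> with
  probability at most \<open>C exp (- c (E(x, R) / n) powr (1 / (\<beta> - 1)))\<close>. It follows by chaining from the fact that an
  exit takes half of its mean time with a probability bounded below.

  The equivalences are arranged in two circles through the diagonal estimate.

  \<^item> \<open>diagonal_imp_upper\<close>: a path between points at distance \<open>d\<close> leaves one of the balls of radius \<open>d/2\<close> about
    its ends before half time; stop it there, use the diagonal estimate for the rest, and absorb the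
    polynomial loss in the exponential tail.

  \<^item> \<open>diagonal_imp_parabolic\<close>: a Dirichlet solution is an integral against the killed heat kernel.

  \<^item> \<open>upper_imp_green_bound\<close>: sum the upper estimate over time.

  \<^item> \<open>green_bound_imp_mean_value\<close>: by balayage a harmonic function is, in the half ball, a Green
    potential of a charge near the boundary of the half ball. The mean value inequality applied to Green
    kernels leads back to the Green bound, through their mean value property.

  What remains is to return to the diagonal estimate from the parabolic inequality and from the Green bound.
  Both follow from one principle, \<open>bootstrap\<close>. In a strong induction on time the paths that leave a
  large ball \<open>B\<close> are negligible by the exit time tail, so that it is enough to improve the constant for the
  kernel killed outside \<open>B\<close>. The parabolic inequality bounds this kernel at a late time, and logarithmic
  convexity in time (\<open>diag_interpolation\<close>) carries a part of the gain back to the time in question. The Green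
  bound controls the sum of the killed \<open>p\<^sub>k(x, x)\<close> over \<open>m \<le> k \<le> 2m\<close>, except for the contribution of the
  time spent near \<open>x\<close>, which is a small part of the exit time (\<open>near_occupation_small\<close>).
\<close>

section \<open>Locally finite weighted graphs\<close>

locale p0_graph = weighted_graph adj w
  for adj :: "'a \<Rightarrow> 'a \<Rightarrow> bool" and w :: "'a \<Rightarrow> 'a \<Rightarrow> real" +
  fixes p0 :: real
  assumes p0_pos: "0 < p0"
    and p0_le: "adj x y \<Longrightarrow> p0 \<le> w x y / mu x"
begin

definition nb :: "'a \<Rightarrow> 'a set" where
  "nb x = {y. adj x y}"

lemma trans_prob_nonneg [simp]: "0 \<le> trans_prob x y"
  using mu_pos[of x] weight_pos[of x y] by (auto simp: trans_prob_def)

lemma trans_prob_pos: "adj x y \<Longrightarrow> 0 < trans_prob x y"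
  using mu_pos[of x] weight_pos[of x y] by (auto simp: trans_prob_def)

lemma trans_prob_ge_p0: "adj x y \<Longrightarrow> p0 \<le> trans_prob x y"
  using p0_le by (auto simp: trans_prob_def)

lemma trans_prob_zero: "y \<notin> nb x \<Longrightarrow> trans_prob x y = 0"
  by (auto simp: trans_prob_def nb_def)

lemma mu_nonneg [simp]: "0 \<le> mu x"
  using mu_pos[of x] by simp

lemma mu_neq0 [simp]: "mu x \<noteq> 0"
  using mu_pos[of x] by simp

lemma reversible: "mu x * trans_prob x y = mu y * trans_prob y x"
  using adj_sym[of x y] adj_sym[of y x] weight_sym[of x y]
  by (auto simp: trans_prob_def)

lemma sum_trans_prob_le_1: "finite F \<Longrightarrow> sum (trans_prob x) F \<le> 1"
  using measure_measure_pmf_finite[of F "step x"] measure_pmf.prob_le_1[of "step x" F]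
  by (simp add: pmf_step)

lemma finite_nb [simp, intro]: "finite (nb x)"
proof -
  have "card G \<le> nat \<lceil>1 / p0\<rceil>" if "G \<subseteq> nb x" "finite G" for G
  proof -
    have "real (card G) * p0 = (\<Sum>y\<in>G. p0)" by simp
    also have "\<dots> \<le> sum (trans_prob x) G"
      by (rule sum_mono) (use that trans_prob_ge_p0 in \<open>auto simp: nb_def\<close>)
    also have "\<dots> \<le> 1" using that by (intro sum_trans_prob_le_1)
    finally have "real (card G) \<le> 1 / p0" using p0_pos by (simp add: field_simps)
    then show ?thesis by linarith
  qed
  then show ?thesis using finite_if_finite_subsets_card_bdd[of "nb x"] by blast
qed

lemma sum_trans_prob: "(\<Sum>y\<in>nb x. trans_prob x y) = 1"
proof -
  have "set_pmf (step x) \<subseteq> nb x"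
    by (auto simp: set_pmf_iff pmf_step trans_prob_def nb_def split: if_splits)
  from sum_pmf_eq_1[OF finite_nb this] show ?thesis by (simp add: pmf_step)
qed

lemma nb_sym: "y \<in> nb x \<longleftrightarrow> x \<in> nb y"
  using adj_sym by (auto simp: nb_def)

subsection \<open>The graph metric\<close>

lemma relpowp_gdist: "(adj ^^ gdist x y) x y"
proof -
  have "\<exists>n. (adj ^^ n) x y" using connected_graph[of x y] by (simp add: rtranclp_power)
  then show ?thesis unfolding gdist_def by (rule LeastI_ex)
qed

lemma gdist_le: "(adj ^^ n) x y \<Longrightarrow> gdist x y \<le> n"
  unfolding gdist_def by (rule Least_le)

lemma relpowp_adj_sym: "(adj ^^ n) x y \<Longrightarrow> (adj ^^ n) y x"
proof (induction n arbitrary: y)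
  case (Suc n)
  then obtain z where "(adj ^^ n) x z" "adj z y" by (meson relpowp_Suc_E)
  then show ?case using Suc.IH adj_sym by (meson relpowp_Suc_I2)
qed auto

lemma gdist_sym: "gdist x y = gdist y x"
  by (rule antisym; rule gdist_le, rule relpowp_adj_sym, rule relpowp_gdist)

lemma gdist_triangle: "gdist x z \<le> gdist x y + gdist y z"
  by (rule gdist_le) (meson relpowp_gdist relpowp_trans)

lemma gdist_self [simp]: "gdist x x = 0"
  using gdist_le[of 0 x x] by simp

lemma gdist_eq_0 [simp]: "gdist x y = 0 \<longleftrightarrow> x = y"
proof
  assume "gdist x y = 0"
  then show "x = y" using relpowp_gdist[of x y] by simp
qed simp

lemma gdist_adj: "y \<in> nb x \<Longrightarrow> gdist x y \<le> 1"
  using gdist_le[of 1 x y] by (auto simp: nb_def)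

lemma gdist_nb_le: "z \<in> nb y \<Longrightarrow> gdist x z \<le> gdist x y + 1"
  using gdist_triangle[of x z y] gdist_adj[of z y] by linarith

lemma gdist_predecessor:
  assumes "gdist x y = Suc n"
  obtains z where "y \<in> nb z" "gdist x z = n"
proof -
  from relpowp_gdist[of x y] assms obtain z where z: "(adj ^^ n) x z" "adj z y"
    by (metis relpowp_Suc_E)
  have "gdist x z \<le> n" using z by (intro gdist_le)
  moreover have "gdist x y \<le> gdist x z + 1" using z by (intro gdist_nb_le) (simp add: nb_def)
  ultimately show ?thesis using that[of z] z assms by (auto simp: nb_def)
qed

lemma finite_cball: "finite {y. gdist x y \<le> n}"
proof (induction n)
  case (Suc n)
  have "{y. gdist x y \<le> Suc n} \<subseteq> {y. gdist x y \<le> n} \<union> (\<Union>z\<in>{y. gdist x y \<le> n}. nb z)"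
  proof
    fix y assume "y \<in> {y. gdist x y \<le> Suc n}"
    then consider "gdist x y \<le> n" | "gdist x y = Suc n" by fastforce
    then show "y \<in> {y. gdist x y \<le> n} \<union> (\<Union>z\<in>{y. gdist x y \<le> n}. nb z)"
      by cases (auto elim!: gdist_predecessor)
  qed
  then show ?case using Suc by (elim finite_subset) auto
next
  case 0
  have "{y. gdist x y \<le> 0} = {x}" by auto
  then show ?case by simp
qed

lemma finite_gball [simp, intro]: "finite (gball x R)"
proof -
  have "gball x R \<subseteq> {y. gdist x y \<le> nat \<lceil>R\<rceil>}"
  proof
    fix y assume "y \<in> gball x R"
    then have "real (gdist x y) < R" by (simp add: gball_def)
    also have "R \<le> real (nat \<lceil>R\<rceil>)" by (rule real_nat_ceiling_ge)
    finally show "y \<in> {y. gdist x y \<le> nat \<lceil>R\<rceil>}" by simp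
  qed
  then show ?thesis by (rule finite_subset) (rule finite_cball)
qed

lemma gball_refl [simp]: "0 < R \<Longrightarrow> x \<in> gball x R"
  by (simp add: gball_def)

lemma gball_sym: "y \<in> gball x R \<longleftrightarrow> x \<in> gball y R"
  by (simp add: gball_def gdist_sym)

lemma gball_mono: "r \<le> R \<Longrightarrow> gball x r \<subseteq> gball x R"
  by (auto simp: gball_def)

lemma gball_subset_triangle:
  assumes "real (gdist x y) + r \<le> R" shows "gball y r \<subseteq> gball x R"
proof (rule subsetI)
  fix z assume z: "z \<in> gball y r"
  have "real (gdist x z) \<le> real (gdist x y) + real (gdist y z)"
    using gdist_triangle[of x z y] by (metis of_nat_add of_nat_mono)
  then show "z \<in> gball x R" using assms z by (simp add: gball_def)
qed

lemma sphere_nonempty: "\<exists>y. gdist x y = n"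
proof -
  have "\<exists>y. gdist x y > n"
  proof (rule ccontr)
    assume "\<nexists>y. gdist x y > n"
    then have "(UNIV :: 'a set) = {y. gdist x y \<le> n}" by (auto simp: not_less)
    then show False using finite_cball[of x n] infinite_vertices by simp
  qed
  then obtain y where "gdist x y > n" by blast
  then show ?thesis
  proof (induction "gdist x y" arbitrary: y)
    case (Suc k)
    obtain z where "gdist x z = k" by (rule gdist_predecessor[OF Suc(2)[symmetric]])
    then show ?case using Suc by (cases "k = n") auto
  qed simp
qed

lemma vol_eq: "vol x R = (\<Sum>y\<in>gball x R. mu y)"
  by (simp add: vol_def infsum_finite)

lemma vol_pos: "0 < R \<Longrightarrow> 0 < vol x R"
  unfolding vol_eq by (rule sum_pos2[of _ x]) (auto simp: mu_pos)

lemma vol_nonneg [simp]: "0 \<le> vol x R"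
  unfolding vol_eq by (simp add: sum_nonneg)

lemma vol_mono_set: "gball x r \<subseteq> gball y R \<Longrightarrow> vol x r \<le> vol y R"
  unfolding vol_eq by (rule sum_mono2) auto

lemma vol_mono: "r \<le> R \<Longrightarrow> vol x r \<le> vol x R"
  by (intro vol_mono_set gball_mono)

lemma vol_unit: "0 < R \<Longrightarrow> R \<le> 1 \<Longrightarrow> vol x R = mu x"
proof -
  assume "0 < R" "R \<le> 1"
  have "gdist x y = 0" if "real (gdist x y) < R" for y using that \<open>R \<le> 1\<close> by linarith
  then have "gball x R = {x}" using \<open>0 < R\<close> by (auto simp: gball_def)
  then show ?thesis by (simp add: vol_eq)
qed

section \<open>The killed transition operator\<close>

lemma killed_op_eq:
  "killed_op A f x = (if x \<in> A then \<Sum>y\<in>nb x \<inter> A. trans_prob x y * f y else 0)"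
proof -
  have "(\<Sum>\<^sub>\<infinity>y\<in>A. trans_prob x y * f y) = (\<Sum>\<^sub>\<infinity>y\<in>nb x \<inter> A. trans_prob x y * f y)"
    by (rule infsum_cong_neutral) (auto simp: trans_prob_zero)
  then show ?thesis by (simp add: killed_op_def infsum_finite)
qed

lemma killed_op_vanishing:
  assumes "x \<in> A" "\<And>y. y \<notin> A \<Longrightarrow> f y = 0"
  shows "killed_op A f x = (\<Sum>y\<in>nb x. trans_prob x y * f y)"
  unfolding killed_op_eq using assms by (auto intro!: sum.mono_neutral_left) metis

lemma killed_op_UNIV: "killed_op UNIV f x = (\<Sum>y\<in>nb x. trans_prob x y * f y)"
  by (simp add: killed_op_eq)

lemma killed_op_mono: "(\<And>y. y \<in> A \<Longrightarrow> f y \<le> g y) \<Longrightarrow> killed_op A f x \<le> killed_op A g x"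
  by (auto simp: killed_op_eq intro!: sum_mono mult_left_mono)

lemma killed_op_nonneg: "(\<And>y. y \<in> A \<Longrightarrow> 0 \<le> f y) \<Longrightarrow> 0 \<le> killed_op A f x"
  by (auto simp: killed_op_eq intro!: sum_nonneg)

lemma killed_op_outside: "x \<notin> A \<Longrightarrow> killed_op A f x = 0"
  by (simp add: killed_op_eq)

lemma killed_op_linear:
  "killed_op A (\<lambda>y. a * f y + b * g y) x = a * killed_op A f x + b * killed_op A g x"
  by (simp add: killed_op_eq sum.distrib sum_distrib_left algebra_simps)

lemma killed_op_sum: "killed_op A (\<lambda>y. \<Sum>i\<in>I. f i y) x = (\<Sum>i\<in>I. killed_op A (f i) x)"
  by (auto simp: killed_op_eq sum_distrib_left intro: sum.swap)

lemma killed_op_set_mono: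
  "A \<subseteq> B \<Longrightarrow> (\<And>y. y \<in> B \<Longrightarrow> 0 \<le> f y) \<Longrightarrow> killed_op A f x \<le> killed_op B f x"
  by (auto simp: killed_op_eq intro!: sum_mono2 sum_nonneg)

lemma killed_op_le_const:
  assumes "0 \<le> c" "\<And>y. y \<in> A \<Longrightarrow> f y \<le> c" shows "killed_op A f x \<le> c"
proof (cases "x \<in> A")
  case True
  have "killed_op A f x \<le> (\<Sum>y\<in>nb x \<inter> A. trans_prob x y * c)"
    using True assms by (auto simp: killed_op_eq intro!: sum_mono mult_left_mono)
  also have "\<dots> = sum (trans_prob x) (nb x \<inter> A) * c" by (simp add: sum_distrib_right)
  also have "\<dots> \<le> 1 * c" using assms by (intro mult_right_mono sum_trans_prob_le_1) auto
  finally show ?thesis by simp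
qed (use assms in \<open>simp add: killed_op_eq\<close>)

abbreviation kpow :: "'a set \<Rightarrow> nat \<Rightarrow> ('a \<Rightarrow> real) \<Rightarrow> 'a \<Rightarrow> real" where
  "kpow A n f \<equiv> (killed_op A ^^ n) f"

lemma kpow_add: "kpow A (m + n) f = kpow A m (kpow A n f)"
  by (simp add: funpow_add)

lemma kpow_Suc_right: "kpow A (Suc n) f = kpow A n (killed_op A f)"
  by (simp add: funpow_swap1)

lemma kpow_mono: "(\<And>y. y \<in> A \<Longrightarrow> f y \<le> g y) \<Longrightarrow> x \<in> A \<Longrightarrow> kpow A n f x \<le> kpow A n g x"
  by (induction n arbitrary: x) (auto intro: killed_op_mono)

lemma kpow_cong: "(\<And>y. y \<in> A \<Longrightarrow> f y = g y) \<Longrightarrow> x \<in> A \<Longrightarrow> kpow A n f x = kpow A n g x"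
  by (intro antisym kpow_mono) auto

lemma kpow_nonneg: "(\<And>y. 0 \<le> f y) \<Longrightarrow> 0 \<le> kpow A n f x"
  by (induction n arbitrary: x) (auto intro: killed_op_nonneg)

lemma kpow_outside: "x \<notin> A \<Longrightarrow> f x = 0 \<Longrightarrow> kpow A n f x = 0"
  by (cases n) (auto intro: killed_op_outside)

lemma kpow_linear:
  "kpow A n (\<lambda>y. a * f y + b * g y) x = a * kpow A n f x + b * kpow A n g x"
proof (induction n arbitrary: x)
  case (Suc n)
  have "kpow A n (\<lambda>y. a * f y + b * g y) = (\<lambda>x. a * kpow A n f x + b * kpow A n g x)"
    by (rule ext) (rule Suc)
  then show ?case by (simp add: killed_op_linear)
qed simp

lemma kpow_cmult: "kpow A n (\<lambda>y. a * f y) x = a * kpow A n f x"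
  using kpow_linear[of n A a f 0 f x] by simp

lemma kpow_add_fun: "kpow A n (\<lambda>y. f y + g y) x = kpow A n f x + kpow A n g x"
  using kpow_linear[of n A 1 f 1 g x] by simp

lemma kpow_diff: "kpow A n (\<lambda>y. f y - g y) x = kpow A n f x - kpow A n g x"
  using kpow_linear[of n A 1 f "-1" g x] by simp

lemma kpow_sum: "kpow A n (\<lambda>y. \<Sum>i\<in>I. f i y) x = (\<Sum>i\<in>I. kpow A n (f i) x)"
proof (induction n arbitrary: x)
  case (Suc n)
  have "kpow A n (\<lambda>y. \<Sum>i\<in>I. f i y) = (\<lambda>x. \<Sum>i\<in>I. kpow A n (f i) x)"
    by (rule ext) (rule Suc)
  then show ?case by (simp add: killed_op_sum)
qed simp

lemma kpow_set_mono: "A \<subseteq> B \<Longrightarrow> (\<And>y. 0 \<le> f y) \<Longrightarrow> kpow A n f x \<le> kpow B n f x"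
proof (induction n arbitrary: x)
  case (Suc n)
  have "killed_op A (kpow A n f) x \<le> killed_op A (kpow B n f) x"
    by (rule killed_op_mono) (use Suc in auto)
  also have "\<dots> \<le> killed_op B (kpow B n f) x"
    by (rule killed_op_set_mono) (use Suc in \<open>auto intro: kpow_nonneg\<close>)
  finally show ?case by simp
qed simp

lemma kpow_le_const:
  "0 \<le> c \<Longrightarrow> (\<And>y. y \<in> A \<Longrightarrow> f y \<le> c) \<Longrightarrow> x \<in> A \<Longrightarrow> kpow A n f x \<le> c"
  by (induction n arbitrary: x) (auto intro!: killed_op_le_const)

lemma kpow_kernel:
  assumes "finite S" "S \<subseteq> A" "\<And>y. y \<notin> S \<Longrightarrow> f y = 0"
  shows "kpow A n f x = (\<Sum>z\<in>S. killed_prob A n x z * f z)"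
proof -
  have "f = (\<lambda>y. \<Sum>z\<in>S. f z * indicator ({z} \<inter> A) y)"
  proof
    fix y
    have "(\<Sum>z\<in>S. f z * indicator ({z} \<inter> A) y) = (\<Sum>z\<in>S. if z = y then f z else 0)"
      using assms by (intro sum.cong) (auto simp: indicator_def)
    also have "\<dots> = f y" using assms by (simp add: sum.delta)
    finally show "f y = (\<Sum>z\<in>S. f z * indicator ({z} \<inter> A) y)" by simp
  qed
  then have "kpow A n f x = kpow A n (\<lambda>y. \<Sum>z\<in>S. f z * indicator ({z} \<inter> A) y) x" by simp
  also have "\<dots> = (\<Sum>z\<in>S. f z * killed_prob A n x z)"
    by (simp add: kpow_sum kpow_cmult killed_prob_def)
  finally show ?thesis by (simp add: mult.commute)
qed

lemma killed_prob_nonneg [simp]: "0 \<le> killed_prob A n x y"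
  unfolding killed_prob_def by (rule kpow_nonneg) simp

lemma killed_prob_outside: "x \<notin> A \<or> y \<notin> A \<Longrightarrow> killed_prob A n x y = 0"
proof (cases "x \<in> A")
  case True
  assume "x \<notin> A \<or> y \<notin> A"
  then have "indicator ({y} \<inter> A) = (\<lambda>z. 0 * (0::real))" using True by (auto simp: indicator_def)
  then show ?thesis using kpow_cmult[of n A 0 "\<lambda>_. 0" x] by (simp add: killed_prob_def)
qed (simp add: killed_prob_def kpow_outside)

lemma killed_prob_set_mono: "A \<subseteq> B \<Longrightarrow> killed_prob A n x y \<le> killed_prob B n x y"
proof (cases "x \<in> A \<and> y \<in> A")
  case True
  assume AB: "A \<subseteq> B"
  then have "{y} \<inter> A = {y} \<inter> B" using True by auto
  then show ?thesis unfolding killed_prob_def using AB by (simp add: kpow_set_mono)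
qed (auto simp: killed_prob_outside)

lemma killed_prob_0: "killed_prob A 0 x y = (if x = y \<and> x \<in> A then 1 else 0)"
  by (auto simp: killed_prob_def)

lemma killed_prob_Suc_left:
  "killed_prob A (Suc n) x y = (if x \<in> A then \<Sum>z\<in>nb x. trans_prob x z * killed_prob A n z y else 0)"
proof (cases "x \<in> A")
  case True
  then show ?thesis
    using killed_op_vanishing[of x A "\<lambda>z. killed_prob A n z y"] killed_prob_outside[of _ A y n]
    by (simp add: killed_prob_def)
qed (simp add: killed_prob_outside)

lemma killed_prob_Suc_right:
  "killed_prob A (Suc n) x y = (if y \<in> A then \<Sum>z\<in>nb y. killed_prob A n x z * trans_prob z y else 0)"
proof (cases "y \<in> A")
  case True
  have eq: "killed_op A (indicator ({y} \<inter> A)) = (\<lambda>z. if z \<in> nb y \<inter> A then trans_prob z y else 0)"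
  proof
    fix z
    have "(\<Sum>v\<in>nb z \<inter> A. trans_prob z v * indicator ({y} \<inter> A) v)
        = (\<Sum>v\<in>nb z \<inter> A. if v = y then trans_prob z v else 0)"
      using True by (intro sum.cong) (auto simp: indicator_def)
    also have "\<dots> = (if y \<in> nb z then trans_prob z y else 0)" using True by (simp add: sum.delta')
    finally show "killed_op A (indicator ({y} \<inter> A)) z = (if z \<in> nb y \<inter> A then trans_prob z y else 0)"
      by (auto simp: killed_op_eq nb_sym)
  qed
  have "killed_prob A (Suc n) x y = (\<Sum>z\<in>nb y \<inter> A. killed_prob A n x z * (if z \<in> nb y \<inter> A then trans_prob z y else 0))"
    unfolding killed_prob_def kpow_Suc_right eq
    by (subst kpow_kernel[of "nb y \<inter> A"]) (auto simp: killed_prob_def)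
  also have "\<dots> = (\<Sum>z\<in>nb y. killed_prob A n x z * trans_prob z y)"
    by (intro sum.mono_neutral_cong_left) (auto simp: killed_prob_outside)
  finally show ?thesis using True by simp
qed (simp add: killed_prob_outside)

text \<open>Reversibility of one step, propagated by comparing the first-step and the last-step recursion.\<close>

lemma killed_prob_sym: "mu x * killed_prob A n x y = mu y * killed_prob A n y x"
proof (induction n arbitrary: x y)
  case (Suc n)
  show ?case
  proof (cases "x \<in> A")
    case True
    have "mu x * killed_prob A (Suc n) x y = (\<Sum>z\<in>nb x. (mu x * trans_prob x z) * killed_prob A n z y)"
      using True by (simp add: killed_prob_Suc_left sum_distrib_left mult.assoc)
    also have "\<dots> = (\<Sum>z\<in>nb x. trans_prob z x * (mu z * killed_prob A n z y))"
      by (simp add: reversible[of x] algebra_simps)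
    also have "\<dots> = (\<Sum>z\<in>nb x. mu y * (killed_prob A n y z * trans_prob z x))"
    proof (rule sum.cong[OF refl])
      fix z
      show "trans_prob z x * (mu z * killed_prob A n z y) = mu y * (killed_prob A n y z * trans_prob z x)"
        unfolding Suc[of z y] by simp
    qed
    also have "\<dots> = mu y * killed_prob A (Suc n) y x"
      using True by (simp add: killed_prob_Suc_right sum_distrib_left)
    finally show ?thesis .
  qed (simp add: killed_prob_outside)
qed (auto simp: killed_prob_0)

lemma killed_prob_far: "n < gdist x y \<Longrightarrow> killed_prob A n x y = 0"
proof (induction n arbitrary: x)
  case (Suc n)
  have "n < gdist z y" if "z \<in> nb x" for z
    using gdist_nb_le[of x z y] that Suc.prems nb_sym[of x z] by (simp add: gdist_sym)
  then show ?case using Suc.IH by (auto simp: killed_prob_Suc_left)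
qed (auto simp: killed_prob_0)

lemma killed_prob_add:
  assumes "finite S" "\<And>z. z \<notin> S \<Longrightarrow> killed_prob A n z y = 0"
  shows "killed_prob A (m + n) x y = (\<Sum>z\<in>S. killed_prob A m x z * killed_prob A n z y)"
proof -
  have "killed_prob A (m + n) x y = kpow A m (\<lambda>z. killed_prob A n z y) x"
    by (simp add: killed_prob_def kpow_add)
  also have "\<dots> = (\<Sum>z\<in>S \<inter> A. killed_prob A m x z * killed_prob A n z y)"
    by (rule kpow_kernel) (use assms in \<open>auto simp: killed_prob_outside\<close>)
  also have "\<dots> = (\<Sum>z\<in>S. killed_prob A m x z * killed_prob A n z y)"
    by (rule sum.mono_neutral_left) (use assms in \<open>auto simp: killed_prob_outside\<close>)
  finally show ?thesis .
qed

section \<open>Survival probabilities\<close>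

definition surv :: "'a set \<Rightarrow> nat \<Rightarrow> 'a \<Rightarrow> real" where
  "surv A n x = kpow A n (indicator A) x"

lemma surv_0: "surv A 0 x = indicator A x"
  by (simp add: surv_def)

lemma surv_nonneg [simp]: "0 \<le> surv A n x"
  unfolding surv_def by (rule kpow_nonneg) simp

lemma surv_outside: "x \<notin> A \<Longrightarrow> surv A n x = 0"
  unfolding surv_def by (rule kpow_outside) auto

lemma surv_Suc: "surv A (Suc n) x = (if x \<in> A then \<Sum>y\<in>nb x. trans_prob x y * surv A n y else 0)"
proof (cases "x \<in> A")
  case True
  then show ?thesis
    using killed_op_vanishing[of x A "surv A n"] surv_outside[of _ A n]
    by (simp add: surv_def[abs_def])
qed (simp add: surv_outside)

lemma surv_le_1 [simp]: "surv A n x \<le> 1"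
  by (cases "x \<in> A") (auto simp: surv_def surv_outside kpow_outside intro!: kpow_le_const)

lemma surv_add: "surv A (m + n) x = kpow A m (surv A n) x"
  by (simp add: surv_def[abs_def] kpow_add)

lemma surv_Suc_le: "surv A (Suc n) x \<le> surv A n x"
proof (induction n arbitrary: x)
  case 0
  show ?case by (cases "x \<in> A") (simp_all add: surv_0 surv_outside)
next
  case (Suc n)
  show ?case unfolding surv_Suc[of A "Suc n"] surv_Suc[of A n x]
    using Suc by (auto intro!: sum_mono mult_left_mono)
qed

lemma surv_antimono: "m \<le> n \<Longrightarrow> surv A n x \<le> surv A m x"
  by (rule lift_Suc_antimono_le[of "\<lambda>n. surv A n x"]) (auto intro: surv_Suc_le)

lemma surv_mono: "A \<subseteq> B \<Longrightarrow> surv A n x \<le> surv B n x"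
proof (induction n arbitrary: x)
  case (Suc n)
  then show ?case using surv_nonneg[of B "Suc n" x]
    by (auto simp: surv_Suc intro!: sum_mono mult_left_mono)
qed (auto simp: surv_0 indicator_def)

lemma surv_kernel: "finite A \<Longrightarrow> surv A n x = (\<Sum>z\<in>A. killed_prob A n x z)"
  unfolding surv_def by (subst kpow_kernel[of A]) auto

lemma surv_gball_early: "real (gdist x y) + real n < R \<Longrightarrow> surv (gball x R) n y = 1"
proof (induction n arbitrary: y)
  case (Suc n)
  have "surv (gball x R) n z = 1" if "z \<in> nb y" for z
    using Suc gdist_nb_le[OF that, of x] by (intro Suc.IH) simp
  then show ?case using Suc.prems by (simp add: surv_Suc sum_trans_prob) (simp add: gball_def)
qed (simp add: surv_0 gball_def)

section \<open>The law of the walk\<close>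

lemma sets_walk: "sets (walk x) = sets (PiM UNIV (\<lambda>_. count_space UNIV))"
proof -
  interpret IT: Ionescu_Tulcea "walk_kernel x" "\<lambda>_. count_space UNIV" by (rule Ionescu_Tulcea_walk)
  show ?thesis unfolding walk_def by (rule IT.PF.sets_lim)
qed

lemma space_walk [simp]: "space (walk x) = UNIV"
  using sets_eq_imp_space_eq[OF sets_walk] by (simp add: space_PiM)

lemma sets_walk_coord: "{\<omega>. \<omega> i \<in> A} \<in> sets (walk x)"
proof -
  have "(\<lambda>\<omega>. \<omega> i) -` A \<inter> space (PiM UNIV (\<lambda>_. count_space (UNIV::'a set))) \<in> sets (PiM UNIV (\<lambda>_. count_space UNIV))"
    by (rule measurable_sets[OF measurable_component_singleton]) auto
  then show ?thesis by (simp add: sets_walk space_PiM vimage_def)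
qed

lemma sets_walk_path: "{\<omega>. \<forall>i\<le>(n::nat). \<omega> i \<in> A i} \<in> sets (walk x)"
proof -
  have "{\<omega>. \<forall>i\<le>n. \<omega> i \<in> A i} = (\<Inter>i\<in>{..n}. {\<omega>. \<omega> i \<in> A i})" by auto
  also have "\<dots> \<in> sets (walk x)" by (intro sets.finite_INT) (auto intro: sets_walk_coord)
  finally show ?thesis .
qed

text \<open>Events of this kind determine both the law of the walk at a fixed time (for \<open>A = UNIV\<close>) and that of its
  exit time from \<open>A\<close>.\<close>

definition stay :: "'a set \<Rightarrow> nat \<Rightarrow> 'a \<Rightarrow> (nat \<Rightarrow> 'a) set" where
  "stay A n y = {\<omega>. (\<forall>i\<le>n. \<omega> i \<in> A) \<and> \<omega> n = y}"

lemma sets_stay: "stay A n y \<in> sets (walk x)"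
proof -
  have "stay A n y = {\<omega>. \<forall>i\<le>n. \<omega> i \<in> A} \<inter> {\<omega>. \<omega> n \<in> {y}}" by (auto simp: stay_def)
  also have "\<dots> \<in> sets (walk x)" by (intro sets.Int sets_walk_path sets_walk_coord)
  finally show ?thesis .
qed

text \<open>The Markov property at the last step: decompose the event into the countably many cylinders over
  paths in \<open>A\<close>.\<close>

lemma emeasure_stay_step:
  "emeasure (walk x) (stay A n z \<inter> {\<omega>. \<omega> (Suc n) = y}) =
     emeasure (walk x) (stay A n z) * ennreal (trans_prob z y)"
proof -
  define I where "I = {l \<in> lists A. length l = Suc n \<and> l ! n = z}"
  define X where "X l = {\<omega>. \<forall>i\<le>n. \<omega> i = l ! i}" for l :: "'a list"
  define Y where "Y l = {\<omega>. \<forall>i\<le>Suc n. \<omega> i = (l @ [y]) ! i}" for l :: "'a list"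
  have cI: "countable I"
  proof -
    have "countable A" using countable_vertices by (rule countable_subset[rotated]) auto
    then have "countable (lists A)" by (rule countable_lists)
    then show ?thesis by (rule countable_subset[rotated]) (auto simp: I_def)
  qed
  have ex: "\<exists>l\<in>I. \<omega> \<in> X l" if "\<omega> \<in> stay A n z" for \<omega>
    using that by (intro bexI[of _ "map \<omega> [0..<Suc n]"])
      (auto simp: I_def X_def stay_def nth_append less_Suc_eq_le simp del: upt_Suc)
  have XI: "X l \<subseteq> stay A n z" if "l \<in> I" for l
    using that by (auto simp: I_def X_def stay_def in_lists_conv_set)
  have E1: "stay A n z = \<Union>(X ` I)" using ex XI by auto
  have YX: "Y l = X l \<inter> {\<omega>. \<omega> (Suc n) = y}" if "l \<in> I" for l
  proof -
    have "(l @ [y]) ! i = l ! i" if "i \<le> n" for i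
      using \<open>l \<in> I\<close> that by (auto simp: I_def nth_append)
    moreover have "(l @ [y]) ! Suc n = y" using \<open>l \<in> I\<close> by (auto simp: I_def nth_append)
    ultimately show ?thesis by (auto simp: X_def Y_def le_Suc_eq)
  qed
  have E2: "stay A n z \<inter> {\<omega>. \<omega> (Suc n) = y} = \<Union>(Y ` I)" using YX by (auto simp: E1)
  have dX: "disjoint_family_on X I"
    unfolding disjoint_family_on_def
  proof (intro ballI impI)
    fix l l' assume "l \<in> I" "l' \<in> I" "l \<noteq> l'"
    then obtain i where "i \<le> n" "l ! i \<noteq> l' ! i"
      by (auto simp: I_def list_eq_iff_nth_eq less_Suc_eq_le)
    then show "X l \<inter> X l' = {}" by (auto simp: X_def)
  qed
  then have dY: "disjoint_family_on Y I"
    using YX by (fastforce simp: disjoint_family_on_def)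
  have mX: "X l \<in> sets (walk x)" for l using sets_walk_path[of n "\<lambda>i. {l ! i}" x] by (simp add: X_def)
  have mY: "Y l \<in> sets (walk x)" for l
    using sets_walk_path[of "Suc n" "\<lambda>i. {(l @ [y]) ! i}" x] by (simp add: Y_def)
  have XY: "emeasure (walk x) (Y l) = emeasure (walk x) (X l) * ennreal (trans_prob z y)" if "l \<in> I" for l
  proof -
    have len: "length l = Suc n" "l ! n = z" using that by (auto simp: I_def)
    have "(\<Prod>i<n. trans_prob ((l @ [y]) ! i) ((l @ [y]) ! Suc i)) = (\<Prod>i<n. trans_prob (l ! i) (l ! Suc i))"
      using len by (intro prod.cong) (auto simp: nth_append)
    moreover have "(l @ [y]) ! n = z" "(l @ [y]) ! Suc n = y" "(l @ [y]) ! 0 = l ! 0"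
      using len by (auto simp: nth_append)
    ultimately show ?thesis
      unfolding X_def Y_def emeasure_walk_cylinder by (simp add: ennreal_mult prod_nonneg)
  qed
  have "emeasure (walk x) (\<Union>(Y ` I)) = (\<integral>\<^sup>+l. emeasure (walk x) (Y l) \<partial>count_space I)"
    by (rule emeasure_UN_countable[OF mY cI dY])
  also have "\<dots> = (\<integral>\<^sup>+l. emeasure (walk x) (X l) * ennreal (trans_prob z y) \<partial>count_space I)"
    by (rule nn_integral_cong) (simp add: XY)
  also have "\<dots> = (\<integral>\<^sup>+l. emeasure (walk x) (X l) \<partial>count_space I) * ennreal (trans_prob z y)"
    by (rule nn_integral_multc) auto
  also have "(\<integral>\<^sup>+l. emeasure (walk x) (X l) \<partial>count_space I) = emeasure (walk x) (\<Union>(X ` I))"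
    by (rule emeasure_UN_countable[OF mX cI dX, symmetric])
  finally show ?thesis by (simp add: E1[symmetric] E2[symmetric])
qed

lemma emeasure_walk_stay: "emeasure (walk x) (stay A n y) = ennreal (killed_prob A n x y)"
proof (induction n arbitrary: y)
  case 0
  show ?case
  proof (cases "y \<in> A")
    case True
    have "stay A 0 y = {\<omega>. \<forall>i\<le>0. \<omega> i = (\<lambda>_. y) i}" using True by (auto simp: stay_def)
    then show ?thesis using True by (simp only: emeasure_walk_cylinder) (auto simp: killed_prob_0)
  next
    case False
    then have "stay A 0 y = {}" by (auto simp: stay_def)
    then show ?thesis using False by (simp add: killed_prob_outside)
  qed
next
  case (Suc n)
  show ?case
  proof (cases "y \<in> A")
    case True
    let ?T = "\<lambda>z. stay A n z \<inter> {\<omega>. \<omega> (Suc n) = y}"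
    have T: "?T z \<in> sets (walk x)" for z
      using sets_walk_coord[of "Suc n" "{y}" x] by (intro sets.Int sets_stay) simp
    have split: "stay A (Suc n) y = \<Union>(?T ` UNIV)"
      using True by (auto simp: stay_def le_Suc_eq)
    have "emeasure (walk x) (stay A (Suc n) y) = (\<integral>\<^sup>+z. emeasure (walk x) (?T z) \<partial>count_space UNIV)"
      unfolding split by (rule emeasure_UN_countable[OF T countable_vertices])
        (auto simp: disjoint_family_on_def stay_def)
    also have "\<dots> = (\<integral>\<^sup>+z. ennreal (killed_prob A n x z * trans_prob z y) \<partial>count_space UNIV)"
      by (intro nn_integral_cong) (simp add: emeasure_stay_step Suc ennreal_mult)
    also have "\<dots> = (\<Sum>z\<in>nb y. ennreal (killed_prob A n x z * trans_prob z y))"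
      by (rule nn_integral_count_space'[of "nb y"]) (auto simp: trans_prob_zero nb_sym[of _ y])
    also have "\<dots> = ennreal (killed_prob A (Suc n) x y)"
      using True by (simp add: killed_prob_Suc_right sum_ennreal)
    finally show ?thesis .
  next
    case False
    then have "stay A (Suc n) y = {}" by (auto simp: stay_def)
    then show ?thesis using False by (simp add: killed_prob_outside)
  qed
qed

lemma walk_prob_eq: "walk_prob n x y = killed_prob UNIV n x y"
proof -
  have "{\<omega>. \<omega> n = y} = stay UNIV n y" by (auto simp: stay_def)
  then show ?thesis by (simp add: walk_prob_def measure_def emeasure_walk_stay)
qed

lemma emeasure_walk_surv:
  assumes "finite A"
  shows "emeasure (walk x) {\<omega>. \<forall>i\<le>n. \<omega> i \<in> A} = ennreal (surv A n x)"
proof -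
  have "{\<omega>. \<forall>i\<le>n. \<omega> i \<in> A} = (\<Union>y\<in>A. stay A n y)" by (auto simp: stay_def)
  moreover have "emeasure (walk x) (\<Union>y\<in>A. stay A n y) = (\<Sum>y\<in>A. emeasure (walk x) (stay A n y))"
    using assms by (intro sum_emeasure[symmetric]) (auto simp: disjoint_family_on_def stay_def intro: sets_stay[unfolded stay_def])
  ultimately show ?thesis using assms by (simp add: emeasure_walk_stay surv_kernel sum_ennreal)
qed

lemma less_exit_time_iff: "enat n < exit_time A \<omega> \<longleftrightarrow> (\<forall>i\<le>n. \<omega> i \<in> A)"
proof
  assume *: "enat n < exit_time A \<omega>"
  show "\<forall>i\<le>n. \<omega> i \<in> A"
  proof (intro allI impI, rule ccontr)
    fix i assume "i \<le> n" "\<omega> i \<notin> A"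
    then have "exit_time A \<omega> \<le> enat i" unfolding exit_time_def by (intro INF_lower) auto
    also have "\<dots> \<le> enat n" using \<open>i \<le> n\<close> by simp
    finally show False using * by simp
  qed
next
  assume "\<forall>i\<le>n. \<omega> i \<in> A"
  then have "enat (Suc n) \<le> exit_time A \<omega>"
    unfolding exit_time_def by (intro INF_greatest) (auto simp: Suc_le_eq not_le[symmetric])
  then show "enat n < exit_time A \<omega>" by (simp add: Suc_ile_eq)
qed

lemma nn_integral_exit_time:
  assumes "finite A"
  shows "(\<integral>\<^sup>+\<omega>. ennreal_of_enat (exit_time A \<omega>) \<partial>walk x) = (\<Sum>n. ennreal (surv A n x))"
proof -
  have "(\<lambda>\<omega>. exit_time A \<omega>) \<in> measurable (walk x) (count_space UNIV)"
  proof (rule measurable_count_space_eq2_countable[THEN iffD2], intro conjI ballI)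
    have *: "{\<omega>. enat n < exit_time A \<omega>} \<in> sets (walk x)" for n
      unfolding less_exit_time_iff by (rule sets_walk_path)
    fix a :: enat
    show "(\<lambda>\<omega>. exit_time A \<omega>) -` {a} \<inter> space (walk x) \<in> sets (walk x)"
    proof (cases a)
      case (enat m)
      have "(\<lambda>\<omega>. exit_time A \<omega>) -` {a} =
          (\<Inter>i\<in>{..<m}. {\<omega>. enat i < exit_time A \<omega>}) - {\<omega>. enat m < exit_time A \<omega>}"
      proof (intro set_eqI iffI)
        fix \<omega>
        assume *: "\<omega> \<in> (\<Inter>i\<in>{..<m}. {\<omega>. enat i < exit_time A \<omega>}) - {\<omega>. enat m < exit_time A \<omega>}"
        then obtain k where k: "exit_time A \<omega> = enat k" by (cases "exit_time A \<omega>") auto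
        have "\<not> k < m" using * k by auto
        moreover have "k \<le> m" using * k by auto
        ultimately show "\<omega> \<in> (\<lambda>\<omega>. exit_time A \<omega>) -` {a}" using enat k by simp
      qed (use enat in auto)
      moreover have "(\<Inter>i\<in>{..<m}. {\<omega>. enat i < exit_time A \<omega>}) \<in> sets (walk x)"
        using * sets.top[of "walk x"] by (cases "m = 0") (auto intro!: sets.finite_INT)
      ultimately show ?thesis using * by (auto intro!: sets.Diff)
    next
      case infinity
      have "(\<lambda>\<omega>. exit_time A \<omega>) -` {a} = (\<Inter>n. {\<omega>. enat n < exit_time A \<omega>})"
        unfolding infinity by auto (metis enat_iless less_irrefl not_infinity_eq)
      then show ?thesis using * by (auto intro!: sets.countable_INT')
    qed
  qed auto
  from nn_integral_enat_function[OF this] show ?thesis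
    by (simp add: less_exit_time_iff emeasure_walk_surv[OF assms])
qed

section \<open>Mean exit times and Green kernels of finite sets\<close>

definition mexit :: "'a set \<Rightarrow> 'a \<Rightarrow> real" where
  "mexit A x = (\<Sum>n. surv A n x)"

definition green_op :: "'a set \<Rightarrow> ('a \<Rightarrow> real) \<Rightarrow> 'a \<Rightarrow> real" where
  "green_op A f x = (\<Sum>n. kpow A n f x)"

lemma surv_less_1: "finite A \<Longrightarrow> \<exists>n. surv A n x < 1"
proof -
  assume "finite A"
  then obtain y where y: "y \<notin> A" using infinite_vertices by (metis ex_new_if_finite)
  from connected_graph[of x y] show ?thesis
  proof (induction rule: converse_rtranclp_induct)
    case base
    then show ?case using y by (auto simp: surv_outside)
  next
    case (step x z)
    then obtain n where n: "surv A n z < 1" by blast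
    have "(\<Sum>v\<in>nb x. trans_prob x v * surv A n v) < (\<Sum>v\<in>nb x. trans_prob x v)"
    proof (rule sum_strict_mono_ex1)
      show "\<forall>v\<in>nb x. trans_prob x v * surv A n v \<le> trans_prob x v"
        by (simp add: mult_left_le)
      show "\<exists>v\<in>nb x. trans_prob x v * surv A n v < trans_prob x v"
        using n step.hyps trans_prob_pos[of x z] by (intro bexI[of _ z]) (auto simp: nb_def)
    qed simp
    then have "surv A (Suc n) x < 1" by (simp add: surv_Suc sum_trans_prob)
    then show ?case by blast
  qed
qed

text \<open>From every vertex of a finite set there is a path out of it, so that after a fixed number of
  steps a fixed proportion of the mass has been lost, wherever the walk started.\<close>

lemma surv_contraction:
  assumes "finite A"
  obtains N \<rho> where "0 \<le> \<rho>" "\<rho> < 1" "\<And>k x. surv A (k + N) x \<le> \<rho> * surv A k x"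
proof -
  from surv_less_1[OF assms] obtain m where m: "\<And>x. surv A (m x) x < 1" by metis
  define N where "N = Max (insert 0 (m ` A))"
  define \<rho> where "\<rho> = Max (insert 0 (surv A N ` A))"
  have N: "surv A N x < 1" if "x \<in> A" for x
  proof -
    have "m x \<le> N" unfolding N_def using that assms by (intro Max_ge) auto
    then show ?thesis using surv_antimono[of "m x" N A x] m[of x] by linarith
  qed
  have "0 \<le> \<rho>" unfolding \<rho>_def using assms by (intro Max_ge) auto
  moreover have "\<rho> < 1" unfolding \<rho>_def using assms N by (subst Max_less_iff) auto
  moreover have "surv A (k + N) x \<le> \<rho> * surv A k x" for k x
  proof (cases "x \<in> A")
    case True
    have "surv A (k + N) x \<le> kpow A k (\<lambda>y. \<rho> * indicator A y) x"
      unfolding surv_add by (rule kpow_mono) (use True assms in \<open>auto simp: \<rho>_def\<close>)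
    then show ?thesis by (simp add: kpow_cmult surv_def)
  qed (simp add: surv_outside)
  ultimately show ?thesis by (rule that)
qed

lemma summable_surv: "finite A \<Longrightarrow> summable (\<lambda>n. surv A n x)"
proof -
  assume "finite A"
  then obtain N \<rho> where *: "0 \<le> \<rho>" "\<rho> < 1" "\<And>k x. surv A (k + N) x \<le> \<rho> * surv A k x"
    by (metis surv_contraction)
  show ?thesis
  proof (rule summableI_nonneg_bounded)
    fix n
    have "(\<Sum>k<n. surv A k x) \<le> (\<Sum>k<n + N. surv A k x)" by (rule sum_mono2) auto
    also have "\<dots> = (\<Sum>k<N. surv A k x) + (\<Sum>k<n. surv A (k + N) x)"
      by (induction n) auto
    also have "\<dots> \<le> (\<Sum>k<N. 1) + (\<Sum>k<n. \<rho> * surv A k x)"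
      by (intro add_mono sum_mono) (auto simp: *)
    finally have "(1 - \<rho>) * (\<Sum>k<n. surv A k x) \<le> real N"
      by (simp add: sum_distrib_left[symmetric] left_diff_distrib)
    then show "(\<Sum>k<n. surv A k x) \<le> real N / (1 - \<rho>)" using * by (simp add: field_simps)
  qed simp
qed

lemma abs_kpow_le_surv:
  assumes "\<And>y. y \<notin> A \<Longrightarrow> f y = 0" "\<And>y. y \<in> A \<Longrightarrow> \<bar>f y\<bar> \<le> c"
  shows "\<bar>kpow A n f x\<bar> \<le> c * surv A n x"
proof (cases "x \<in> A")
  case True
  have "kpow A n f x \<le> kpow A n (\<lambda>y. c * indicator A y) x"
    by (rule kpow_mono) (use True assms in \<open>auto simp: abs_le_iff\<close>)
  moreover have "kpow A n (\<lambda>y. -1 * f y) x \<le> kpow A n (\<lambda>y. c * indicator A y) x"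
    by (rule kpow_mono) (use True assms in \<open>auto simp: abs_le_iff\<close>)
  ultimately show ?thesis unfolding kpow_cmult surv_def by (simp add: abs_le_iff)
qed (use assms in \<open>simp add: kpow_outside surv_outside\<close>)

lemma summable_kpow:
  assumes "finite A" "\<And>y. y \<notin> A \<Longrightarrow> f y = 0"
  shows "summable (\<lambda>n. kpow A n f x)"
proof (rule summable_comparison_test')
  show "summable (\<lambda>n. (\<Sum>y\<in>A. \<bar>f y\<bar>) * surv A n x)"
    using assms by (intro summable_mult summable_surv)
  show "norm (kpow A n f x) \<le> (\<Sum>y\<in>A. \<bar>f y\<bar>) * surv A n x" if "n \<ge> 0" for n
    unfolding real_norm_def by (rule abs_kpow_le_surv) (use assms in \<open>auto intro: member_le_sum\<close>)
qed

lemma surv_tendsto_0: "finite A \<Longrightarrow> (\<lambda>n. surv A n x) \<longlonglongrightarrow> 0"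
  by (intro summable_LIMSEQ_zero summable_surv)

lemma mexit_green_op: "mexit A x = green_op A (indicator A) x"
  by (simp add: mexit_def green_op_def surv_def)

lemma mexit_outside: "x \<notin> A \<Longrightarrow> mexit A x = 0"
  by (simp add: mexit_def surv_outside)

lemma mexit_nonneg: "finite A \<Longrightarrow> 0 \<le> mexit A x"
  unfolding mexit_def by (intro suminf_nonneg summable_surv) auto

lemma mexit_mono: "A \<subseteq> B \<Longrightarrow> finite B \<Longrightarrow> mexit A x \<le> mexit B x"
  unfolding mexit_def by (intro suminf_le summable_surv surv_mono) (auto intro: finite_subset)

lemma green_op_step:
  assumes "finite A" "\<And>y. y \<notin> A \<Longrightarrow> f y = 0"
  shows "green_op A f x = f x + killed_op A (green_op A f) x"
proof -
  note sm = summable_kpow[of A f, OF assms]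
  have "killed_op A (green_op A f) x = (\<Sum>n. kpow A (Suc n) f x)"
  proof (cases "x \<in> A")
    case True
    have "killed_op A (green_op A f) x = (\<Sum>y\<in>nb x \<inter> A. (\<Sum>n. trans_prob x y * kpow A n f y))"
      using True by (simp add: killed_op_eq green_op_def suminf_mult sm)
    also have "\<dots> = (\<Sum>n. \<Sum>y\<in>nb x \<inter> A. trans_prob x y * kpow A n f y)"
      by (rule suminf_sum[symmetric]) (intro summable_mult sm)
    finally show ?thesis using True by (simp add: killed_op_eq)
  qed (simp add: killed_op_outside)
  then show ?thesis using suminf_split_head[OF sm, of x] by (simp add: green_op_def)
qed

lemma mexit_step:
  assumes "finite A" "x \<in> A"
  shows "mexit A x = 1 + (\<Sum>z\<in>nb x. trans_prob x z * mexit A z)"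
proof -
  have "mexit A x = 1 + killed_op A (mexit A) x"
    using green_op_step[of A "indicator A" x] assms by (simp add: mexit_green_op[abs_def])
  then show ?thesis using assms by (subst (asm) killed_op_vanishing) (auto simp: mexit_outside)
qed

lemma green_op_split:
  assumes "finite A" "\<And>y. y \<notin> A \<Longrightarrow> f y = 0"
  shows "green_op A f x = (\<Sum>k<n. kpow A k f x) + kpow A n (green_op A f) x"
proof (induction n)
  case (Suc n)
  have "green_op A f = (\<lambda>x. f x + killed_op A (green_op A f) x)"
    by (rule ext) (rule green_op_step[OF assms])
  then have "kpow A n (green_op A f) x = kpow A n (\<lambda>x. f x + killed_op A (green_op A f) x) x"
    by (rule arg_cong[of _ _ "\<lambda>g. kpow A n g x"])
  then have "kpow A n (green_op A f) x = kpow A n f x + kpow A (Suc n) (green_op A f) x"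
    unfolding kpow_Suc_right by (simp only: kpow_add_fun)
  then show ?case using Suc by simp
qed simp

lemma mexit_split: "finite A \<Longrightarrow> mexit A x = (\<Sum>k<n. surv A k x) + kpow A n (mexit A) x"
  using green_op_split[of A "indicator A" x n] by (simp add: mexit_green_op[abs_def] surv_def)

text \<open>Telescoping: the partial Green sums of \<open>v - P v\<close> are \<open>v - P\<^sup>n v\<close>, and \<open>P\<^sup>n v\<close> vanishes in the limit.\<close>

lemma green_op_unique:
  assumes "finite A" "\<And>y. y \<notin> A \<Longrightarrow> v y = 0"
  shows "v x = green_op A (\<lambda>y. v y - killed_op A v y) x"
proof -
  let ?f = "\<lambda>y. v y - killed_op A v y"
  have tele: "(\<Sum>k<n. kpow A k ?f x) = v x - kpow A n v x" for n
  proof (induction n)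
    case (Suc n)
    have "kpow A n ?f x = kpow A n v x - kpow A (Suc n) v x"
      unfolding kpow_Suc_right by (rule kpow_diff)
    then show ?case using Suc by simp
  qed simp
  have "(\<lambda>n. kpow A n v x) \<longlonglongrightarrow> 0"
    by (intro summable_LIMSEQ_zero summable_kpow assms)
  then have "(\<lambda>n. v x - kpow A n v x) \<longlonglongrightarrow> v x - 0" by (intro tendsto_intros)
  then have "(\<lambda>k. kpow A k ?f x) sums v x" unfolding sums_def tele by simp
  then show ?thesis by (simp add: green_op_def sums_iff)
qed

lemma killed_prob_summable: "finite A \<Longrightarrow> summable (\<lambda>k. killed_prob A k x y)"
  unfolding killed_prob_def by (rule summable_kpow) auto

lemma green_nonneg: "finite A \<Longrightarrow> 0 \<le> green A x y"
  unfolding green_def by (intro mult_nonneg_nonneg suminf_nonneg killed_prob_summable) auto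

lemma green_outside: "x \<notin> A \<or> y \<notin> A \<Longrightarrow> green A x y = 0"
  by (simp add: green_def killed_prob_outside)

lemma green_op_eq_green:
  assumes "finite A" "\<And>y. y \<notin> A \<Longrightarrow> f y = 0"
  shows "green_op A f x = (\<Sum>z\<in>A. green A x z * f z * mu z)"
proof -
  have "green_op A f x = (\<Sum>n. \<Sum>z\<in>A. killed_prob A n x z * f z)"
    unfolding green_op_def by (subst kpow_kernel[of A]) (use assms in auto)
  also have "\<dots> = (\<Sum>z\<in>A. \<Sum>n. killed_prob A n x z * f z)"
    using assms by (intro suminf_sum summable_mult2 killed_prob_summable)
  also have "\<dots> = (\<Sum>z\<in>A. (\<Sum>n. killed_prob A n x z) * f z)"
    using assms by (intro sum.cong refl suminf_mult2[symmetric] killed_prob_summable)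
  finally show ?thesis by (simp add: green_def)
qed

lemma mexit_eq_green: "finite A \<Longrightarrow> mexit A x = (\<Sum>z\<in>A. green A x z * mu z)"
  unfolding mexit_green_op by (subst green_op_eq_green) auto

lemma green_sym: "finite A \<Longrightarrow> green A x y = green A y x"
proof -
  assume A: "finite A"
  have "(\<Sum>k. mu x * killed_prob A k x y) = (\<Sum>k. mu y * killed_prob A k y x)"
    by (simp only: killed_prob_sym[of x])
  then have "mu x * (\<Sum>k. killed_prob A k x y) = mu y * (\<Sum>k. killed_prob A k y x)"
    by (simp only: suminf_mult killed_prob_summable[OF A])
  then show ?thesis by (simp add: green_def field_simps)
qed

lemma green_eq_green_op: "finite A \<Longrightarrow> y \<in> A \<Longrightarrow> green A x y = green_op A (indicator {y}) x / mu y"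
  by (simp add: green_def green_op_def killed_prob_def)

lemma green_mono: "A \<subseteq> B \<Longrightarrow> finite B \<Longrightarrow> green A x y \<le> green B x y"
  unfolding green_def
  by (intro mult_left_mono suminf_le killed_prob_set_mono killed_prob_summable)
    (auto intro: finite_subset)

text \<open>The maximum principle for \<open>u \<le> c + P u\<close>: run the walk until it leaves \<open>D\<close>, collecting \<open>c\<close>
  per step.\<close>

lemma exit_comparison:
  assumes "finite D"
    and sub: "\<And>x. x \<in> D \<Longrightarrow> u x \<le> c + (\<Sum>z\<in>nb x. trans_prob x z * u z)"
    and bdry: "\<And>x z. x \<in> D \<Longrightarrow> z \<in> nb x \<Longrightarrow> z \<notin> D \<Longrightarrow> u z \<le> M"
    and "x \<in> D"
  shows "u x \<le> c * mexit D x + M"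
proof -
  define K where "K = (\<Sum>y\<in>D. \<bar>u y - M\<bar>)"
  have bound: "u x - M \<le> c * (\<Sum>k<n. surv D k x) + K * surv D n x" if "x \<in> D" for x n
    using that
  proof (induction n arbitrary: x)
    case 0
    have "u x - M \<le> \<bar>u x - M\<bar>" by simp
    also have "\<dots> \<le> K" unfolding K_def using 0 assms by (intro member_le_sum) auto
    finally show ?case using 0 by (simp add: surv_0)
  next
    case (Suc n)
    let ?w = "\<lambda>z. c * (\<Sum>k<n. surv D k z) + K * surv D n z"
    have "u x - M \<le> c + (\<Sum>z\<in>nb x. trans_prob x z * u z) - (\<Sum>z\<in>nb x. trans_prob x z) * M"
      using sub[OF Suc.prems] by (simp add: sum_trans_prob)
    also have "\<dots> = c + (\<Sum>z\<in>nb x. trans_prob x z * (u z - M))"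
      by (simp add: sum_distrib_right sum_subtractf right_diff_distrib)
    also have "\<dots> \<le> c + (\<Sum>z\<in>nb x. trans_prob x z * ?w z)"
    proof (intro add_left_mono sum_mono mult_left_mono)
      fix z assume z: "z \<in> nb x"
      show "u z - M \<le> ?w z"
      proof (cases "z \<in> D")
        case False
        then show ?thesis using bdry[OF Suc.prems z] by (simp add: surv_outside)
      qed (rule Suc.IH)
    qed simp
    also have "(\<Sum>z\<in>nb x. trans_prob x z * ?w z)
        = c * (\<Sum>k<n. surv D (Suc k) x) + K * surv D (Suc n) x"
    proof -
      have "(\<Sum>z\<in>nb x. trans_prob x z * (\<Sum>k<n. surv D k z)) = (\<Sum>k<n. surv D (Suc k) x)"
        using Suc.prems by (simp add: surv_Suc sum_distrib_left) (rule sum.swap)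
      moreover have "(\<Sum>z\<in>nb x. trans_prob x z * surv D n z) = surv D (Suc n) x"
        using Suc.prems by (simp add: surv_Suc)
      moreover have "(\<Sum>z\<in>nb x. trans_prob x z * ?w z) = c * (\<Sum>z\<in>nb x. trans_prob x z * (\<Sum>k<n. surv D k z))
          + K * (\<Sum>z\<in>nb x. trans_prob x z * surv D n z)"
        by (simp only: distrib_left sum.distrib mult.left_commute[of "trans_prob _ _"] sum_distrib_left[of c, symmetric]
            sum_distrib_left[of K, symmetric])
      ultimately show ?thesis by (simp only:)
    qed
    also have "c + (c * (\<Sum>k<n. surv D (Suc k) x) + K * surv D (Suc n) x)
        = c * (\<Sum>k<Suc n. surv D k x) + K * surv D (Suc n) x"
      using Suc.prems by (subst sum.lessThan_Suc_shift) (simp add: surv_0 algebra_simps)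
    finally show ?case .
  qed
  have "(\<lambda>n. c * (\<Sum>k<n. surv D k x) + K * surv D n x) \<longlonglongrightarrow> c * mexit D x + K * 0"
    unfolding mexit_def using assms
    by (intro tendsto_intros summable_LIMSEQ summable_surv surv_tendsto_0)
  then have "u x - M \<le> c * mexit D x + K * 0"
    by (rule LIMSEQ_le_const) (use bound \<open>x \<in> D\<close> in auto)
  then show ?thesis by simp
qed

text \<open>If the walk is still in \<open>A\<close> at time \<open>t\<close>, it needs at most \<open>M\<close> more steps in the mean.\<close>

lemma mexit_le_max:
  assumes "finite A" "\<And>y. y \<in> A \<Longrightarrow> mexit A y \<le> M" "x \<in> A"
  shows "mexit A x \<le> real t + M * surv A t x"
proof -
  have "kpow A t (mexit A) x \<le> kpow A t (\<lambda>y. M * indicator A y) x"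
    by (rule kpow_mono) (use assms in auto)
  also have "\<dots> = M * surv A t x" by (simp add: kpow_cmult surv_def)
  finally have "kpow A t (mexit A) x \<le> M * surv A t x" .
  moreover have "(\<Sum>k<t. surv A k x) \<le> (\<Sum>k<t. 1)" by (rule sum_mono) simp
  ultimately show ?thesis using mexit_split[OF assms(1), of x t] by simp
qed

lemma mean_exit_eq: "mean_exit x R = mexit (gball x R) x"
  unfolding mean_exit_def mexit_def
  by (simp add: nn_integral_exit_time suminf_ennreal2 summable_surv suminf_nonneg)

lemma mean_exit_nonneg [simp]: "0 \<le> mean_exit x R"
  by (simp add: mean_exit_eq mexit_nonneg)

lemma mean_exit_mono: "r \<le> R \<Longrightarrow> mean_exit x r \<le> mean_exit x R"
  by (simp add: mean_exit_eq mexit_mono gball_mono)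

lemma mean_exit_ge: "R \<le> mean_exit x R"
proof (cases "R > 0")
  case True
  have "R \<le> real (nat \<lceil>R\<rceil>)" by (rule real_nat_ceiling_ge)
  also have "\<dots> = (\<Sum>k<nat \<lceil>R\<rceil>. surv (gball x R) k x)"
  proof -
    have "surv (gball x R) k x = 1" if "k < nat \<lceil>R\<rceil>" for k
      using that by (intro surv_gball_early) (simp, linarith)
    then show ?thesis by simp
  qed
  also have "\<dots> \<le> mean_exit x R"
    unfolding mean_exit_eq mexit_def by (intro sum_le_suminf summable_surv) auto
  finally show ?thesis .
qed (use mean_exit_nonneg[of x R] in linarith)

lemma mean_exit_pos: "0 < R \<Longrightarrow> 0 < mean_exit x R"
  using mean_exit_ge[of R x] by linarith

lemma mean_exit_0 [simp]: "mean_exit x 0 = 0"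
  by (simp add: mean_exit_eq mexit_outside gball_def)

text \<open>One step leads out of \<open>B(x, 1) = {x}\<close> with probability at least \<open>p0\<close>.\<close>

lemma mean_exit_1_le: "mean_exit x 1 \<le> 1 / p0"
proof -
  have ball: "gball x 1 = {x}" by (auto simp: gball_def)
  obtain y where "gdist x y = 1" using sphere_nonempty[of x 1] by auto
  then obtain z where z: "y \<in> nb z" "gdist x z = 0" by (metis One_nat_def gdist_predecessor)
  then have y: "y \<in> nb x" "y \<noteq> x" using \<open>gdist x y = 1\<close> by auto
  have "trans_prob x x + trans_prob x y \<le> 1"
    using sum_trans_prob_le_1[of "{x, y}" x] y by simp
  moreover have "p0 \<le> trans_prob x y" using y trans_prob_ge_p0 by (auto simp: nb_def)
  ultimately have tx: "trans_prob x x \<le> 1 - p0" by linarith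
  have "mean_exit x 1 = 1 + (\<Sum>z\<in>nb x. trans_prob x z * mexit {x} z)"
    unfolding mean_exit_eq ball by (rule mexit_step) auto
  also have "(\<Sum>z\<in>nb x. trans_prob x z * mexit {x} z) = (\<Sum>z\<in>nb x. if z = x then trans_prob x x * mexit {x} x else 0)"
    by (rule sum.cong) (auto simp: mexit_outside)
  also have "\<dots> = trans_prob x x * mean_exit x 1"
    by (simp add: sum.delta' trans_prob_zero mean_exit_eq ball)
  also have "\<dots> \<le> (1 - p0) * mean_exit x 1"
    by (rule mult_right_mono[OF tx]) simp
  finally show ?thesis using p0_pos by (simp add: field_simps)
qed

section \<open>Heat kernels on the diagonal\<close>

text \<open>Times are doubled in \<open>diag\<close> because \<open>p\<^sub>2\<^sub>j(x, x)\<close> is a squared norm: even times are free of the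
  parity effects of bipartite graphs.\<close>

definition hk :: "'a set \<Rightarrow> nat \<Rightarrow> 'a \<Rightarrow> 'a \<Rightarrow> real" where
  "hk A n x y = killed_prob A n x y / mu y"

definition diag :: "'a set \<Rightarrow> nat \<Rightarrow> 'a \<Rightarrow> real" where
  "diag A j x = hk A (2 * j) x x"

lemma heat_kernel_eq: "heat_kernel n x y = hk UNIV n x y"
  by (simp add: heat_kernel_def hk_def walk_prob_eq)

lemma hk_nonneg [simp]: "0 \<le> hk A n x y"
  by (simp add: hk_def)

lemma diag_nonneg [simp]: "0 \<le> diag A j x"
  by (simp add: diag_def)

lemma hk_sym: "hk A n x y = hk A n y x"
  using killed_prob_sym[of x A n y] by (simp add: hk_def field_simps)

lemma hk_set_mono: "A \<subseteq> B \<Longrightarrow> hk A n x y \<le> hk B n x y"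
  by (simp add: hk_def divide_right_mono killed_prob_set_mono)

lemma hk_far: "n < gdist x y \<Longrightarrow> hk A n x y = 0"
  by (simp add: hk_def killed_prob_far)

lemma hk_outside: "x \<notin> A \<or> y \<notin> A \<Longrightarrow> hk A n x y = 0"
  by (simp add: hk_def killed_prob_outside)

lemma hk_add_op: "hk A (m + n) x y = kpow A m (\<lambda>z. hk A n z y) x"
proof -
  have "kpow A m (\<lambda>z. (1 / mu y) * killed_prob A n z y) x = (1 / mu y) * killed_prob A (m + n) x y"
    unfolding kpow_cmult by (simp add: killed_prob_def kpow_add)
  then show ?thesis by (simp add: hk_def)
qed

lemma hk_add:
  assumes "finite S" "{z. gdist y z \<le> n} \<subseteq> S"
  shows "hk A (m + n) x y = (\<Sum>z\<in>S. hk A m x z * hk A n z y * mu z)"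
proof -
  have "killed_prob A n z y = 0" if "z \<notin> S" for z
    using that assms killed_prob_far[of n z y A] by (force simp: gdist_sym)
  from killed_prob_add[OF assms(1) this] show ?thesis
    by (simp add: hk_def sum_divide_distrib)
qed

text \<open>By symmetry and the semigroup law, \<open>p\<^sub>m\<^sub>+\<^sub>n(x, y)\<close> is the inner product of \<open>p\<^sub>m(x, _)\<close> and \<open>p\<^sub>n(y, _)\<close>.\<close>

lemma hk_Cauchy_Schwarz: "(hk A (m + n) x y)\<^sup>2 \<le> hk A (2 * m) x x * hk A (2 * n) y y"
proof -
  define S where "S = {z. gdist x z \<le> m} \<union> {z. gdist y z \<le> n}"
  have S: "finite S" "{z. gdist x z \<le> m} \<subseteq> S" "{z. gdist y z \<le> n} \<subseteq> S"
    by (auto simp: S_def finite_cball)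
  have xy: "hk A (m + n) x y = (\<Sum>z\<in>S. (sqrt (mu z) * hk A m x z) * (sqrt (mu z) * hk A n z y))"
    unfolding hk_add[OF S(1,3), of A m x]
  proof (rule sum.cong[OF refl])
    fix z
    have "hk A m x z * hk A n z y * mu z = hk A m x z * hk A n z y * (sqrt (mu z) * sqrt (mu z))" by simp
    then show "hk A m x z * hk A n z y * mu z = (sqrt (mu z) * hk A m x z) * (sqrt (mu z) * hk A n z y)"
      by (simp only: mult_ac)
  qed
  have xx: "(\<Sum>z\<in>S. (sqrt (mu z) * hk A m x z)\<^sup>2) = hk A (m + m) x x"
    unfolding hk_add[OF S(1,2), of A m x]
  proof (rule sum.cong[OF refl])
    fix z
    show "(sqrt (mu z) * hk A m x z)\<^sup>2 = hk A m x z * hk A m z x * mu z"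
      using hk_sym[of A m z x] by (simp add: power_mult_distrib power2_eq_square mult.commute)
  qed
  have yy: "(\<Sum>z\<in>S. (sqrt (mu z) * hk A n z y)\<^sup>2) = hk A (n + n) y y"
    unfolding hk_add[OF S(1,3), of A n y]
  proof (rule sum.cong[OF refl])
    fix z
    show "(sqrt (mu z) * hk A n z y)\<^sup>2 = hk A n y z * hk A n z y * mu z"
      using hk_sym[of A n z y] by (simp add: power_mult_distrib power2_eq_square mult.commute)
  qed
  have "(hk A (m + n) x y)\<^sup>2 \<le> hk A (m + m) x x * hk A (n + n) y y"
    unfolding xy xx[symmetric] yy[symmetric] by (rule Cauchy_Schwarz_ineq_sum)
  then show ?thesis by (simp only: mult_2)
qed

lemma killed_prob_le_1: "killed_prob A n x y \<le> 1"
proof (cases "x \<in> A")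
  case True
  then show ?thesis unfolding killed_prob_def by (intro kpow_le_const) auto
qed (simp add: killed_prob_outside)

lemma hk_le_mu: "hk A n x y \<le> 1 / mu y"
  by (simp add: hk_def divide_right_mono killed_prob_le_1)

lemma diag_convex: "2 * diag A (Suc j) x \<le> diag A j x + diag A (Suc (Suc j)) x"
proof -
  have "(diag A (Suc j) x)\<^sup>2 \<le> diag A j x * diag A (Suc (Suc j)) x"
  proof -
    have "j + Suc (Suc j) = 2 * Suc j" by simp
    then show ?thesis unfolding diag_def using hk_Cauchy_Schwarz[of A j "Suc (Suc j)" x x] by (simp only:)
  qed
  then have "diag A (Suc j) x \<le> sqrt (diag A j x * diag A (Suc (Suc j)) x)"
    by (rule real_le_rsqrt)
  also have "\<dots> \<le> (diag A j x + diag A (Suc (Suc j)) x) / 2"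
    by (rule arith_geo_mean_sqrt) auto
  finally show ?thesis by simp
qed

text \<open>Being at most \<open>1 / \<mu>(x)\<close>, a convex sequence cannot increase anywhere.\<close>

lemma diag_Suc_le: "diag A (Suc j) x \<le> diag A j x"
proof (rule ccontr)
  assume neg: "\<not> diag A (Suc j) x \<le> diag A j x"
  define e where "e = diag A (Suc j) x - diag A j x"
  have e: "e > 0" using neg by (simp add: e_def)
  have inc: "e \<le> diag A (Suc (j + k)) x - diag A (j + k) x" for k
  proof (induction k)
    case (Suc k)
    then show ?case using diag_convex[of A "j + k" x] by simp
  qed (simp add: e_def)
  have "real k * e \<le> diag A (j + k) x" for k
  proof (induction k)
    case (Suc k)
    then show ?case using inc[of k] by (simp add: algebra_simps)
  qed simp
  then have "real k * e \<le> 1 / mu x" for k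
    using hk_le_mu[of A "2 * (j + k)" x x] order_trans unfolding diag_def by blast
  then show False using reals_Archimedean3[OF e, rule_format, of "1 / mu x"] by (metis not_le)
qed

lemma diag_antimono: "i \<le> j \<Longrightarrow> diag A j x \<le> diag A i x"
  by (rule lift_Suc_antimono_le[of "\<lambda>j. diag A j x"]) (auto intro: diag_Suc_le)

lemma hk_le_diag:
  assumes "diag A (t div 2) x \<le> c" "diag A (t div 2) y \<le> c"
  shows "hk A t x y \<le> c"
proof -
  define m where "m = t div 2"
  have c: "0 \<le> c" using assms diag_nonneg order_trans by blast
  have "(hk A (m + (t - m)) x y)\<^sup>2 \<le> diag A m x * diag A (t - m) y"
    unfolding diag_def by (rule hk_Cauchy_Schwarz)
  also have "\<dots> \<le> c * c"
  proof (rule mult_mono)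
    have "m \<le> t - m" by (simp add: m_def)
    from diag_antimono[OF this, of A y] show "diag A (t - m) y \<le> c" using assms by (simp add: m_def)
  qed (use assms c in \<open>auto simp: m_def\<close>)
  finally show ?thesis using c power2_le_imp_le[of "hk A t x y" c] by (simp add: m_def power2_eq_square)
qed

text \<open>Midpoint convexity of the logarithm, applied \<open>l\<close> times, in additive form: each midpoint costs a
  geometric mean, which is split by the inequality between the arithmetic and the geometric mean. A bound at a
  late time thus improves on a bound at an early time already at the intermediate time \<open>i + h\<close>.\<close>

lemma diag_interpolation:
  assumes "\<epsilon> > 0"
  shows "\<exists>C>0. \<forall>A i h x. diag A (i + h) x \<le> \<epsilon> * diag A i x + C * diag A (i + 2 ^ l * h) x"
  using assms
proof (induction l arbitrary: \<epsilon>)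
  case 0
  have "diag A (i + h) x \<le> \<epsilon> * diag A i x + 1 * diag A (i + 2 ^ 0 * h) x" for A i h x
    using 0 by simp
  then show ?case by (intro exI[of _ 1] conjI allI) auto
next
  case (Suc l)
  define e2 where "e2 = \<epsilon> * \<epsilon>"
  have e: "\<epsilon> > 0" "e2 > 0" using Suc.prems by (simp_all add: e2_def)
  obtain C where C: "C > 0"
    "\<And>A i h x. diag A (i + h) x \<le> e2 * diag A i x + C * diag A (i + 2 ^ l * h) x"
    using Suc.IH[OF e(2)] by blast
  have main: "diag A (i + h) x \<le> \<epsilon> * diag A i x + C / (2 * \<epsilon>) * diag A (i + 2 ^ Suc l * h) x" for A i h x
  proof -
    define a b m b' where "a = diag A i x" and "b = diag A (i + 2 * h) x" and "m = diag A (i + h) x"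
      and "b' = diag A (i + 2 ^ Suc l * h) x"
    have nn: "0 \<le> a" "0 \<le> b" by (simp_all add: a_def b_def)
    have "i + (i + 2 * h) = 2 * (i + h)" by simp
    then have "m\<^sup>2 \<le> a * b"
      unfolding a_def b_def m_def diag_def using hk_Cauchy_Schwarz[of A i "i + 2 * h" x x] by (simp only:)
    also have "a * b = (\<epsilon> * a) * (b / \<epsilon>)" using e by simp
    finally have "m \<le> sqrt ((\<epsilon> * a) * (b / \<epsilon>))" by (rule real_le_rsqrt)
    also have "\<dots> \<le> (\<epsilon> * a + b / \<epsilon>) / 2"
      using e nn by (intro arith_geo_mean_sqrt) auto
    also have "b \<le> e2 * a + C * b'"
    proof -
      have "i + 2 ^ l * (2 * h) = i + 2 ^ Suc l * h" by simp
      then show ?thesis using C(2)[of A i "2 * h" x] unfolding a_def b_def b'_def by (simp only:)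
    qed
    finally have "m \<le> (\<epsilon> * a + (e2 * a + C * b') / \<epsilon>) / 2"
      using e by (simp add: divide_right_mono)
    also have "\<dots> = \<epsilon> * a + C / (2 * \<epsilon>) * b'"
      using e by (simp add: e2_def field_simps)
    finally show ?thesis by (simp only: a_def m_def b'_def)
  qed
  show ?case
    by (rule exI[of _ "C / (2 * \<epsilon>)"]) (use main C(1) e in auto)
qed

text \<open>The part of \<open>P\<^sup>m f(x)\<close> carried by paths that leave \<open>A\<close> by time \<open>m\<close>: stop them when they
  leave, and bound what they still have to collect by its maximum over the exit points.\<close>

lemma exit_decomposition:
  assumes f: "\<And>z. 0 \<le> f z"
    and M: "\<And>k y z. k < m \<Longrightarrow> y \<in> A \<Longrightarrow> z \<in> nb y \<Longrightarrow> z \<notin> A \<Longrightarrow> kpow UNIV k f z \<le> M"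
    and "x \<in> A"
  shows "kpow UNIV m f x - kpow A m f x \<le> M * (1 - surv A m x)"
  using M \<open>x \<in> A\<close>
proof (induction m arbitrary: x)
  case (Suc m)
  have "kpow UNIV (Suc m) f x - kpow A (Suc m) f x =
      (\<Sum>z\<in>nb x. trans_prob x z * kpow UNIV m f z) - (\<Sum>z\<in>nb x \<inter> A. trans_prob x z * kpow A m f z)"
    using Suc.prems by (simp add: killed_op_UNIV) (simp add: killed_op_eq)
  also have "(\<Sum>z\<in>nb x \<inter> A. trans_prob x z * kpow A m f z)
      = (\<Sum>z\<in>nb x. trans_prob x z * (if z \<in> A then kpow A m f z else 0))"
    by (simp add: sum.inter_restrict if_distrib cong: if_cong)
  also have "(\<Sum>z\<in>nb x. trans_prob x z * kpow UNIV m f z) - \<dots>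
      = (\<Sum>z\<in>nb x. trans_prob x z * (kpow UNIV m f z - (if z \<in> A then kpow A m f z else 0)))"
    by (simp add: sum_subtractf right_diff_distrib)
  also have "\<dots> \<le> (\<Sum>z\<in>nb x. trans_prob x z * (M * (1 - surv A m z)))"
  proof (intro sum_mono mult_left_mono)
    fix z assume z: "z \<in> nb x"
    show "kpow UNIV m f z - (if z \<in> A then kpow A m f z else 0) \<le> M * (1 - surv A m z)"
    proof (cases "z \<in> A")
      case True
      then show ?thesis using Suc.IH[of z] Suc.prems(1) by auto
    next
      case False
      then show ?thesis using Suc.prems(1)[of m x z] Suc.prems(2) z by (simp add: surv_outside)
    qed
  qed simp
  also have "\<dots> = M * ((\<Sum>z\<in>nb x. trans_prob x z) - (\<Sum>z\<in>nb x. trans_prob x z * surv A m z))"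
    by (simp add: sum_distrib_left sum_subtractf algebra_simps)
  also have "\<dots> = M * (1 - surv A (Suc m) x)"
    using Suc.prems by (simp add: sum_trans_prob surv_Suc)
  finally show ?case .
qed (simp add: surv_0)

end

section \<open>Volume and time doubling\<close>

lemma geometric_growth:
  fixes f :: "real \<Rightarrow> real"
  assumes "c > 0" and step: "\<And>r. 1 \<le> r \<Longrightarrow> (1 + c) * f r \<le> f (4 * r)" and "1 \<le> r"
  shows "(1 + c) ^ k * f r \<le> f (4 ^ k * r)"
proof (induction k)
  case (Suc k)
  have "(1 + c) ^ Suc k * f r = (1 + c) * ((1 + c) ^ k * f r)" by simp
  also have "\<dots> \<le> (1 + c) * f (4 ^ k * r)" using Suc assms by (intro mult_left_mono) auto
  also have "\<dots> \<le> f (4 * (4 ^ k * r))"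
  proof (rule step)
    have "1 * 1 \<le> (4::real) ^ k * r" using \<open>1 \<le> r\<close> by (intro mult_mono) auto
    then show "1 \<le> (4::real) ^ k * r" by simp
  qed
  finally show ?case by (simp add: mult.assoc)
qed simp

text \<open>With \<open>y = L powr g\<close> the power is at most \<open>y ^ m\<close>, and \<open>(1 + c y / m) ^ m \<le> exp (c y)\<close>.\<close>

lemma powr_exp_bounded:
  fixes c g a :: real
  assumes "c > 0" "g > 0" "a \<ge> 0"
  shows "\<exists>C>0. \<forall>L\<ge>1. L powr a * exp (- c * L powr g) \<le> C"
proof -
  define m where "m = Suc (nat \<lceil>a / g\<rceil>)"
  have m: "a / g \<le> real m" "m > 0" unfolding m_def by linarith+
  have "L powr a * exp (- c * L powr g) \<le> (real m / c) ^ m" if "L \<ge> 1" for L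
  proof -
    define y where "y = L powr g"
    have y: "y \<ge> 1" using that assms by (simp add: y_def ge_one_powr_ge_zero)
    have "L powr a = y powr (a / g)" using assms by (simp add: y_def powr_powr)
    also have "\<dots> \<le> y powr real m" using m y by (intro powr_mono) auto
    also have "\<dots> = y ^ m" using y by (simp add: powr_realpow)
    also have "\<dots> = (real m / c) ^ m * (c * y / real m) ^ m"
      using assms m by (simp add: power_mult_distrib[symmetric])
    also have "(c * y / real m) ^ m \<le> (1 + c * y / real m) ^ m"
      using assms y m by (intro power_mono) auto
    also have "\<dots> \<le> exp (c * y)"
      by (rule exp_ge_one_plus_x_over_n_power_n) (use assms y m in \<open>auto intro: order_trans[of _ 0]\<close>)
    finally have "L powr a \<le> (real m / c) ^ m * exp (c * y)"
      using assms m by (simp add: mult_left_mono)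
    then have "L powr a * exp (- (c * y)) \<le> (real m / c) ^ m * exp (c * y) * exp (- (c * y))"
      by (rule mult_right_mono) simp
    also have "\<dots> = (real m / c) ^ m" by (simp add: mult.assoc flip: exp_add)
    finally show ?thesis by (simp add: y_def)
  qed
  then show ?thesis using assms m by (intro exI[of _ "(real m / c) ^ m"]) auto
qed

text \<open>Apply the bound with exponent \<open>a + 1\<close>; the extra factor \<open>n\<close> makes the product small.\<close>

lemma powr_exp_small:
  fixes c g a e :: real
  assumes "c > 0" "g > 0" "a \<ge> 0" "e > 0"
  shows "\<exists>n\<ge>1::nat. real n powr a * exp (- c * real n powr g) \<le> e"
proof -
  obtain C where C: "C > 0" "\<And>L. L \<ge> 1 \<Longrightarrow> L powr (a + 1) * exp (- c * L powr g) \<le> C"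
    using powr_exp_bounded[of c g "a + 1"] assms by auto
  define n where "n = Suc (nat \<lceil>C / e\<rceil>)"
  have n: "C / e \<le> real n" "1 \<le> real n" unfolding n_def by linarith+
  have "real n * (real n powr a * exp (- c * real n powr g)) \<le> C"
    using C(2)[of "real n"] n by (simp add: powr_add mult_ac)
  also have "C \<le> real n * e" using n assms by (simp add: field_simps)
  finally have "real n powr a * exp (- c * real n powr g) \<le> e" using n by simp
  then show ?thesis using n by (intro exI[of _ n]) auto
qed

locale doubling_graph = p0_graph adj w p0
  for adj :: "'a \<Rightarrow> 'a \<Rightarrow> bool" and w :: "'a \<Rightarrow> 'a \<Rightarrow> real" and p0 :: real +
  fixes D T :: real
  assumes volume_doubling: "0 < R \<Longrightarrow> vol x (2 * R) \<le> D * vol x R"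
    and T_gt_1: "1 < T"
    and time_comparison: "0 < R \<Longrightarrow> y \<in> gball x R \<Longrightarrow> mean_exit x (2 * R) \<le> T * mean_exit y R"
begin

lemma D_ge_1: "1 \<le> D"
proof -
  fix x :: 'a
  have "1 * vol x 1 \<le> vol x (2 * 1)" using vol_mono[of 1 "2 * 1" x] by simp
  also have "\<dots> \<le> D * vol x 1" by (rule volume_doubling) simp
  finally show ?thesis using vol_pos[of 1 x] by simp
qed

lemma vol_pow2: "0 < r \<Longrightarrow> vol x (2 ^ k * r) \<le> D ^ k * vol x r"
proof (induction k)
  case (Suc k)
  have "vol x (2 ^ Suc k * r) = vol x (2 * (2 ^ k * r))" by (simp add: mult.assoc)
  also have "\<dots> \<le> D * vol x (2 ^ k * r)" using Suc.prems by (intro volume_doubling) simp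
  also have "\<dots> \<le> D * (D ^ k * vol x r)" using Suc D_ge_1 by (intro mult_left_mono) auto
  finally show ?case by simp
qed simp

lemma time_doubling: "0 < R \<Longrightarrow> mean_exit x (2 * R) \<le> T * mean_exit x R"
  by (rule time_comparison) auto

lemma mean_exit_pow2: "0 < r \<Longrightarrow> mean_exit x (2 ^ k * r) \<le> T ^ k * mean_exit x r"
proof (induction k)
  case (Suc k)
  have "mean_exit x (2 ^ Suc k * r) = mean_exit x (2 * (2 ^ k * r))" by (simp add: mult.assoc)
  also have "\<dots> \<le> T * mean_exit x (2 ^ k * r)" using Suc.prems by (intro time_doubling) simp
  also have "\<dots> \<le> T * (T ^ k * mean_exit x r)" using Suc T_gt_1 by (intro mult_left_mono) auto
  finally show ?case by simp
qed simp

lemma pow2_exceeds: "\<exists>k. (s::real) \<le> 2 ^ k"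
  using real_arch_pow[of 2 s] less_imp_le by auto

lemma vol_dilate: "\<exists>C\<ge>1. \<forall>x r. 0 < r \<longrightarrow> vol x (s * r) \<le> C * vol x r"
proof -
  obtain k where k: "s \<le> 2 ^ k" using pow2_exceeds by blast
  have "vol x (s * r) \<le> D ^ k * vol x r" if "0 < r" for x r
  proof -
    have "vol x (s * r) \<le> vol x (2 ^ k * r)" using k that by (intro vol_mono mult_right_mono) auto
    then show ?thesis using vol_pow2[OF that, of x k] by linarith
  qed
  then show ?thesis using D_ge_1 by (intro exI[of _ "D ^ k"]) (auto intro: one_le_power)
qed

lemma mexit_ball_le: "0 < R \<Longrightarrow> y \<in> gball x R \<Longrightarrow> mexit (gball x R) y \<le> T * mean_exit x R"
proof -
  assume R: "0 < R" "y \<in> gball x R"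
  then have "gball x R \<subseteq> gball y (2 * R)"
    by (intro gball_subset_triangle) (auto simp: gball_def gdist_sym)
  then have "mexit (gball x R) y \<le> mean_exit y (2 * R)"
    unfolding mean_exit_eq by (intro mexit_mono) auto
  also have "\<dots> \<le> T * mean_exit x R" using R gball_sym by (intro time_comparison) auto
  finally show ?thesis .
qed

subsection \<open>Reverse doubling\<close>

text \<open>To leave \<open>B(x, 4r)\<close> the walk first leaves \<open>B(x, r)\<close>; from the exit point it still has to
  leave a ball of radius \<open>2r\<close>, whose exit time is comparable.\<close>

lemma mean_exit_reverse_step:
  assumes "1 \<le> r" shows "(1 + 1 / T) * mean_exit x r \<le> mean_exit x (4 * r)"
proof -
  let ?A = "gball x (4 * r)" and ?D = "gball x r" and ?M = "mean_exit x r / T"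
  have "- mexit ?A x \<le> (- 1) * mexit ?D x + (- ?M)"
  proof (rule exit_comparison[where u = "\<lambda>y. - mexit ?A y" and c = "- 1" and M = "- ?M"])
    fix y assume "y \<in> ?D"
    then have "y \<in> ?A" using assms gball_mono[of r "4 * r" x] by auto
    then show "- mexit ?A y \<le> - 1 + (\<Sum>z\<in>nb y. trans_prob y z * - mexit ?A z)"
      by (subst mexit_step) (auto simp: sum_negf)
  next
    fix y z assume yz: "y \<in> ?D" "z \<in> nb y" "z \<notin> ?D"
    have "real (gdist x z) \<le> real (gdist x y) + 1" using gdist_nb_le[OF yz(2), of x] by linarith
    then have d: "real (gdist x z) < 2 * r" using yz assms by (simp add: gball_def)
    have "mean_exit x r \<le> mean_exit x (2 * (2 * r))" using assms by (intro mean_exit_mono) auto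
    also have "\<dots> \<le> T * mean_exit z (2 * r)"
      using assms d by (intro time_comparison) (auto simp: gball_def)
    also have "mean_exit z (2 * r) \<le> mexit ?A z"
      unfolding mean_exit_eq using d by (intro mexit_mono gball_subset_triangle) auto
    finally show "- mexit ?A z \<le> - ?M" using T_gt_1 by (simp add: field_simps)
  qed (use assms in auto)
  then show ?thesis by (simp add: mean_exit_eq algebra_simps)
qed

lemma mean_exit_reverse: "\<exists>s\<ge>1. \<forall>x r. 1 \<le> r \<longrightarrow> M * mean_exit x r \<le> mean_exit x (s * r)"
proof -
  obtain k where k: "M < (1 + 1 / T) ^ k"
    using real_arch_pow[of "1 + 1 / T" M] T_gt_1 by auto
  have "M * mean_exit x r \<le> mean_exit x (4 ^ k * r)" if "1 \<le> r" for x r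
  proof -
    have "M * mean_exit x r \<le> (1 + 1 / T) ^ k * mean_exit x r"
      using k by (intro mult_right_mono) auto
    also have "\<dots> \<le> mean_exit x (4 ^ k * r)"
      using T_gt_1 that by (intro geometric_growth mean_exit_reverse_step) auto
    finally show ?thesis .
  qed
  then show ?thesis by (intro exI[of _ "4 ^ k"]) auto
qed

text \<open>The ball \<open>B(x, 4r)\<close> contains a ball of radius \<open>r\<close> disjoint from \<open>B(x, r)\<close>, because the graph is
  infinite and connected.\<close>

lemma vol_reverse_step:
  assumes "1 \<le> r" shows "(1 + 1 / D\<^sup>2) * vol x r \<le> vol x (4 * r)"
proof -
  obtain y where y: "gdist x y = nat \<lceil>2 * r\<rceil>" using sphere_nonempty by blast
  have d: "2 * r \<le> real (gdist x y)" "real (gdist x y) < 3 * r"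
    using assms unfolding y by linarith+
  have disj: "gball x r \<inter> gball y r = {}"
  proof (rule ccontr)
    assume "gball x r \<inter> gball y r \<noteq> {}"
    then obtain z where "real (gdist x z) < r" "real (gdist z y) < r"
      by (auto simp: gball_def gdist_sym)
    moreover have "real (gdist x y) \<le> real (gdist x z) + real (gdist z y)"
      using gdist_triangle[of x y z] by linarith
    ultimately show False using d by linarith
  qed
  have "gball x r \<union> gball y r \<subseteq> gball x (4 * r)"
    using d assms gball_mono[of r "4 * r" x] gball_subset_triangle[of x y r "4 * r"] by auto
  then have "(\<Sum>z\<in>gball x r \<union> gball y r. mu z) \<le> vol x (4 * r)"
    unfolding vol_eq by (intro sum_mono2) auto
  then have le: "vol x r + vol y r \<le> vol x (4 * r)"
    using disj by (simp add: sum.union_disjoint vol_eq)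
  have "vol x r \<le> vol y (2 ^ 2 * r)"
    using d by (intro vol_mono_set gball_subset_triangle) (simp add: gdist_sym)
  also have "\<dots> \<le> D\<^sup>2 * vol y r" using assms by (intro vol_pow2) auto
  finally have "vol x r / D\<^sup>2 \<le> vol y r" using D_ge_1 by (simp add: field_simps)
  then show ?thesis using le by (simp add: algebra_simps)
qed

lemma vol_reverse: "\<exists>s\<ge>1. \<forall>x r. 1 \<le> r \<longrightarrow> M * vol x r \<le> vol x (s * r)"
proof -
  have c: "0 < 1 / D\<^sup>2" using D_ge_1 by simp
  obtain k where k: "M < (1 + 1 / D\<^sup>2) ^ k"
    using real_arch_pow[of "1 + 1 / D\<^sup>2" M] c by auto
  have "M * vol x r \<le> vol x (4 ^ k * r)" if "1 \<le> r" for x r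
  proof -
    have "M * vol x r \<le> (1 + 1 / D\<^sup>2) ^ k * vol x r"
      using k by (intro mult_right_mono) auto
    also have "\<dots> \<le> vol x (4 ^ k * r)"
      using c that by (intro geometric_growth vol_reverse_step) auto
    finally show ?thesis .
  qed
  then show ?thesis by (intro exI[of _ "4 ^ k"]) auto
qed

text \<open>Time grows at least, and volume at most, polynomially in the radius; hence volume grows at most
  polynomially in time.\<close>

lemma vol_le_time:
  "\<exists>C\<ge>1. \<exists>a\<ge>0. \<forall>x r \<rho> L. 1 \<le> r \<longrightarrow> 1 \<le> L \<longrightarrow> mean_exit x \<rho> \<le> L * mean_exit x r \<longrightarrow>
      vol x \<rho> \<le> C * L powr a * vol x r"
proof -
  obtain s where s: "s \<ge> 1" "\<And>x r. 1 \<le> r \<Longrightarrow> 2 * mean_exit x r \<le> mean_exit x (s * r)"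
    using mean_exit_reverse[of 2] by blast
  obtain C where C: "C \<ge> 1" "\<And>x r. 0 < r \<Longrightarrow> vol x (s * r) \<le> C * vol x r"
    using vol_dilate[of s] by blast
  have sk: "1 \<le> s ^ k * r" if "1 \<le> r" for k r
    using mult_mono[of 1 "s ^ k" 1 r] s(1) that by auto
  have E: "2 ^ k * mean_exit x r \<le> mean_exit x (s ^ k * r)" if "1 \<le> r" for k x r
  proof (induction k)
    case (Suc k)
    have "2 ^ Suc k * mean_exit x r \<le> 2 * mean_exit x (s ^ k * r)" using Suc by simp
    also have "\<dots> \<le> mean_exit x (s * (s ^ k * r))" using sk[OF that] by (rule s(2))
    finally show ?case by (simp add: mult.assoc)
  qed simp
  have V: "vol x (s ^ k * r) \<le> C ^ k * vol x r" if "1 \<le> r" for k x r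
  proof (induction k)
    case (Suc k)
    have "vol x (s ^ Suc k * r) = vol x (s * (s ^ k * r))" by (simp add: mult.assoc)
    also have "\<dots> \<le> C * vol x (s ^ k * r)" using sk[OF that, of k] by (intro C) linarith
    also have "\<dots> \<le> C * (C ^ k * vol x r)" using Suc C by (intro mult_left_mono) auto
    finally show ?case by simp
  qed simp
  have "vol x \<rho> \<le> C * L powr (log 2 C) * vol x r"
    if r: "1 \<le> r" and L: "1 \<le> L" and le: "mean_exit x \<rho> \<le> L * mean_exit x r" for x r \<rho> L
  proof -
    define k where "k = nat \<lfloor>log 2 L\<rfloor>"
    have log0: "0 \<le> log 2 L" using L by simp
    have kl: "real k \<le> log 2 L" "log 2 L < real (Suc k)" unfolding k_def using log0 by linarith+
    have "L = 2 powr (log 2 L)" using L by simp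
    also have "\<dots> < 2 powr real (Suc k)" by (rule powr_less_mono) (use kl in auto)
    also have "\<dots> = 2 ^ Suc k" by (rule powr_realpow) simp
    finally have "L < 2 ^ Suc k" .
    have "\<rho> \<le> s ^ Suc k * r"
    proof (rule ccontr)
      assume "\<not> \<rho> \<le> s ^ Suc k * r"
      then have "mean_exit x (s ^ Suc k * r) \<le> mean_exit x \<rho>" by (intro mean_exit_mono) auto
      then have "2 ^ Suc k * mean_exit x r \<le> L * mean_exit x r" using E[OF r, of "Suc k" x] le by linarith
      then show False using mean_exit_pos[of r x] r \<open>L < 2 ^ Suc k\<close> by simp
    qed
    then have "vol x \<rho> \<le> vol x (s ^ Suc k * r)" by (rule vol_mono)
    also have "\<dots> \<le> C ^ Suc k * vol x r" by (rule V[OF r])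
    also have "C ^ Suc k = C * C powr (real k)" using C by (simp add: powr_realpow)
    also have "C powr real k \<le> C powr (log 2 L)" using kl C by (intro powr_mono) auto
    also have "C powr (log 2 L) = L powr (log 2 C)"
      using C L by (simp add: powr_def log_def)
    finally show ?thesis using C by (simp add: mult_left_mono mult_right_mono)
  qed
  moreover have "0 \<le> log 2 C" using C by simp
  ultimately show ?thesis using C(1) by blast
qed

subsection \<open>The inverse exit time\<close>

lemma inv_exit_ge: "real n \<le> mean_exit x (real (inv_exit x n))"
  unfolding inv_exit_def by (rule LeastI[of _ n]) (rule mean_exit_ge)

lemma inv_exit_pos: "0 < n \<Longrightarrow> 1 \<le> real (inv_exit x n)"
  using inv_exit_ge[of n x] by (cases "inv_exit x n") auto

lemma vol_inv_exit_pos: "0 < n \<Longrightarrow> 0 < vol x (real (inv_exit x n))"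
  using inv_exit_pos[of n x] by (intro vol_pos) linarith

lemma inv_exit_le: "real n \<le> mean_exit x (real R) \<Longrightarrow> inv_exit x n \<le> R"
  unfolding inv_exit_def by (rule Least_le)

text \<open>The inverse exit time overshoots by at most one doubling of the radius, or by the exit time of a
  single vertex.\<close>

definition inv_exit_const :: real where
  "inv_exit_const = max T (1 / p0)"

lemma inv_exit_const_ge_1: "1 \<le> inv_exit_const"
  using T_gt_1 by (simp add: inv_exit_const_def)

lemma mean_exit_inv_exit_le: "0 < n \<Longrightarrow> mean_exit x (real (inv_exit x n)) \<le> inv_exit_const * real n"
proof -
  assume n: "0 < n"
  show ?thesis
  proof (cases "inv_exit x n = 1")
    case True
    then have "mean_exit x (real (inv_exit x n)) \<le> (1 / p0) * 1" using mean_exit_1_le[of x] by simp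
    also have "\<dots> \<le> inv_exit_const * real n"
      using n inv_exit_const_ge_1 p0_pos by (intro mult_mono) (auto simp: inv_exit_const_def)
    finally show ?thesis .
  next
    case False
    define e where "e = inv_exit x n - 1"
    have e: "inv_exit x n = Suc e" "e \<ge> 1" using inv_exit_pos[OF n, of x] False by (auto simp: e_def)
    have "mean_exit x (real e) < real n"
      using inv_exit_le[of n x e] e by (cases "real n \<le> mean_exit x (real e)") auto
    moreover have "mean_exit x (real (Suc e)) \<le> mean_exit x (2 * real e)"
      using e by (intro mean_exit_mono) auto
    moreover have "mean_exit x (2 * real e) \<le> T * mean_exit x (real e)"
      using e by (intro time_doubling) auto
    moreover have "T * mean_exit x (real e) \<le> T * real n"
      using calculation(1) T_gt_1 by (intro mult_left_mono) auto
    moreover have "T * real n \<le> inv_exit_const * real n" by (intro mult_right_mono) (auto simp: inv_exit_const_def)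
    ultimately show ?thesis unfolding e(1) by linarith
  qed
qed

text \<open>Change the centre from \<open>x\<close> to \<open>z\<close> by the time comparison, at the price of doubling the radius; then
  compare volumes with the same centre through their times.\<close>

lemma vol_le_vol_inv_exit:
  "\<exists>C\<ge>1. \<exists>a\<ge>0. \<forall>x z r k L. 0 < r \<longrightarrow> 0 < k \<longrightarrow> 1 \<le> L \<longrightarrow> real (gdist x z) < r \<longrightarrow>
      mean_exit x r \<le> L * real k \<longrightarrow> vol x r \<le> C * L powr a * vol z (real (inv_exit z k))"
proof -
  obtain C a where C: "C \<ge> 1" "a \<ge> 0"
    "\<And>x r \<rho> L. 1 \<le> r \<Longrightarrow> 1 \<le> L \<Longrightarrow> mean_exit x \<rho> \<le> L * mean_exit x r \<Longrightarrow>
      vol x \<rho> \<le> C * L powr a * vol x r"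
    using vol_le_time by metis
  have "vol x r \<le> (C * T powr a) * L powr a * vol z (real (inv_exit z k))"
    if r: "0 < r" and k: "0 < k" and L: "1 \<le> L" and d: "real (gdist x z) < r"
      and E: "mean_exit x r \<le> L * real k" for x z r k L
  proof -
    let ?e = "real (inv_exit z k)"
    have "mean_exit z (2 * r) \<le> T * mean_exit x r"
      using r d by (intro time_comparison) (auto simp: gball_def gdist_sym)
    also have "\<dots> \<le> T * (L * real k)" using E T_gt_1 by (intro mult_left_mono) auto
    also have "\<dots> \<le> T * (L * mean_exit z ?e)"
      using T_gt_1 L by (intro mult_left_mono inv_exit_ge) auto
    finally have E': "mean_exit z (2 * r) \<le> (T * L) * mean_exit z ?e" by simp
    have "vol x r \<le> vol z (2 * r)"
      using d by (intro vol_mono_set gball_subset_triangle) (auto simp: gdist_sym)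
    also have "\<dots> \<le> C * (T * L) powr a * vol z ?e"
    proof (rule C(3)[OF inv_exit_pos[OF k] _ E'])
      show "1 \<le> T * L" using mult_mono[of 1 T 1 L] T_gt_1 L by simp
    qed
    also have "(T * L) powr a = T powr a * L powr a" using T_gt_1 L by (simp add: powr_mult)
    finally show ?thesis by (simp add: mult.assoc)
  qed
  moreover have "1 \<le> C * T powr a"
    using mult_mono[of 1 C 1 "T powr a"] C ge_one_powr_ge_zero[of T a] T_gt_1 by simp
  ultimately show ?thesis using C(2) by blast
qed

section \<open>The exit time tail\<close>

text \<open>The exponent \<open>log 2 T\<close> comes from iterating time doubling; adding \<open>1\<close> leaves room for the requirement
  \<open>\<beta> > 1\<close>.\<close>

definition walk_dim :: real where
  "walk_dim = 1 + log 2 T"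

lemma walk_dim_gt_1: "1 < walk_dim"
  using T_gt_1 by (simp add: walk_dim_def)

lemma mean_exit_polynomial:
  "\<exists>C\<ge>1. \<forall>x y R s. 0 < R \<longrightarrow> 1 \<le> s \<longrightarrow> y \<in> gball x R \<longrightarrow>
      mean_exit x R \<le> C * s powr walk_dim * mean_exit y (R / s)"
proof -
  have "mean_exit x R \<le> T\<^sup>2 * s powr walk_dim * mean_exit y (R / s)"
    if R: "0 < R" and s: "1 \<le> s" and y: "y \<in> gball x R" for x y R s
  proof -
    define k where "k = nat \<lceil>log 2 s\<rceil>"
    have log0: "0 \<le> log 2 s" using s by simp
    have kl: "log 2 s \<le> real k" "real k < 1 + log 2 s" unfolding k_def using log0 by linarith+
    have "s = 2 powr (log 2 s)" using s by simp
    also have "\<dots> \<le> 2 powr real k" by (rule powr_mono) (use kl in auto)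
    also have "\<dots> = 2 ^ k" by (rule powr_realpow) simp
    finally have sk: "s \<le> 2 ^ k" .
    have "mean_exit x R \<le> mean_exit x (2 * R)" using R by (intro mean_exit_mono) auto
    also have "\<dots> \<le> T * mean_exit y R" using R y by (intro time_comparison) auto
    also have "mean_exit y R \<le> mean_exit y (2 ^ k * (R / s))"
      using sk s R by (intro mean_exit_mono) (simp add: field_simps)
    also have "\<dots> \<le> T ^ k * mean_exit y (R / s)" using R s by (intro mean_exit_pow2) auto
    also have "T ^ k = T powr real k" using T_gt_1 by (simp add: powr_realpow)
    also have "\<dots> \<le> T powr (1 + log 2 s)" using kl T_gt_1 by (intro powr_mono) auto
    also have "\<dots> = T * T powr (log 2 s)" using T_gt_1 by (simp add: powr_add)
    also have "T powr (log 2 s) = s powr (log 2 T)"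
      using T_gt_1 s by (simp add: powr_def log_def)
    also have "s powr (log 2 T) \<le> s powr walk_dim" using s by (intro powr_mono) (auto simp: walk_dim_def)
    finally show ?thesis
      using T_gt_1 by (simp add: mult_left_mono mult_right_mono power2_eq_square mult.assoc)
  qed
  then show ?thesis using T_gt_1 by (intro exI[of _ "T\<^sup>2"]) auto
qed

text \<open>The mean is at most \<open>t\<close> plus the survival probability times the largest mean exit time over the ball,
  which is at most \<open>T\<close> times the mean from the centre.\<close>

lemma surv_half_mean:
  assumes "0 < r" "real t \<le> mean_exit z r / 2"
  shows "1 / (2 * T) \<le> surv (gball z r) t z"
proof -
  have E: "0 < mean_exit z r" using assms by (intro mean_exit_pos)
  have "mean_exit z r \<le> real t + (T * mean_exit z r) * surv (gball z r) t z"
    unfolding mean_exit_eq[of z r]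
    by (rule mexit_le_max) (use assms mexit_ball_le[of r _ z] in \<open>auto simp: mean_exit_eq\<close>)
  then have "mean_exit z r * (1 / 2) \<le> mean_exit z r * (T * surv (gball z r) t z)"
    using assms by (simp add: algebra_simps)
  then have "1 / 2 \<le> T * surv (gball z r) t z" using E by simp
  then show ?thesis using T_gt_1 by (simp add: field_simps)
qed

text \<open>One step of the chaining argument, in terms of the generating function of the exit time:
  here \<open>u n\<close> is the probability to have left a larger set by time \<open>n\<close>, and \<open>s ^ n * u n \<le> m\<close> is
  an exponential Markov bound. The factor gained is \<open>E(s ^ min(t, exit time of B))\<close>.\<close>

lemma generating_function_step:
  assumes s: "0 \<le> s" "s \<le> 1" and m: "0 \<le> m"
    and u0: "\<And>z. z \<in> B \<Longrightarrow> u 0 z \<le> 0"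
    and u1: "\<And>n z. z \<in> B \<Longrightarrow> u (Suc n) z = (\<Sum>v\<in>nb z. trans_prob z v * u n v)"
    and bound: "\<And>n z. z \<in> B \<Longrightarrow> s ^ n * u n z \<le> m"
    and bound': "\<And>n z v. z \<in> B \<Longrightarrow> v \<in> nb z \<Longrightarrow> s ^ n * u n v \<le> m"
    and "z \<in> B"
  shows "s ^ n * u n z \<le> m * (1 - (1 - s ^ t) * surv B t z)"
  using \<open>z \<in> B\<close>
proof (induction t arbitrary: n z)
  case 0
  then show ?case using bound by simp
next
  case (Suc t)
  have S: "(1 - s ^ Suc t) * surv B (Suc t) z \<le> 1"
  proof -
    have "0 \<le> s ^ Suc t" "s ^ Suc t \<le> 1" using s by (auto intro: power_le_one simp del: power_Suc)
    then show ?thesis by (intro mult_le_one) auto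
  qed
  show ?case
  proof (cases n)
    case 0
    have "0 \<le> m * (1 - (1 - s ^ Suc t) * surv B (Suc t) z)"
      using S m by (intro mult_nonneg_nonneg) auto
    then show ?thesis using 0 u0[OF Suc.prems] by simp
  next
    case (Suc n')
    let ?S = "surv B (Suc t) z"
    have "s ^ n * u n z = s * (\<Sum>v\<in>nb z. trans_prob z v * (s ^ n' * u n' v))"
      unfolding Suc u1[OF \<open>z \<in> B\<close>] by (simp add: sum_distrib_left algebra_simps)
    also have "\<dots> \<le> s * (\<Sum>v\<in>nb z. trans_prob z v * (m * (1 - (1 - s ^ t) * surv B t v)))"
    proof (intro mult_left_mono sum_mono)
      fix v assume v: "v \<in> nb z"
      show "s ^ n' * u n' v \<le> m * (1 - (1 - s ^ t) * surv B t v)"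
      proof (cases "v \<in> B")
        case False
        then show ?thesis using bound'[OF \<open>z \<in> B\<close> v] by (simp add: surv_outside)
      qed (rule Suc.IH)
    qed (use s in auto)
    also have "\<dots> = s * (m * ((\<Sum>v\<in>nb z. trans_prob z v) - (1 - s ^ t) * (\<Sum>v\<in>nb z. trans_prob z v * surv B t v)))"
      by (simp add: sum_distrib_left sum_subtractf right_diff_distrib mult_ac)
    also have "\<dots> = s * (m * (1 - (1 - s ^ t) * ?S))"
      using \<open>z \<in> B\<close> by (simp add: sum_trans_prob surv_Suc)
    also have "\<dots> = m * (1 - (1 - s ^ Suc t) * ?S) - m * ((1 - s) * (1 - ?S))"
      by (simp add: algebra_simps)
    also have "\<dots> \<le> m * (1 - (1 - s ^ Suc t) * ?S)"
      using m s by simp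
    finally show ?thesis .
  qed
qed

text \<open>A walk that leaves \<open>B(x, R)\<close> crosses \<open>N\<close> balls of radius \<open>r\<close> in succession. Each crossing lasts
  longer than \<open>t\<close> with probability at least \<open>h\<close>, whatever happened before.\<close>

lemma surv_chaining:
  assumes r: "1 \<le> r" and t: "0 < t" and h: "0 \<le> h" "h \<le> 1"
    and surv: "\<And>z. z \<in> gball x R \<Longrightarrow> h \<le> surv (gball z r) t z"
    and N: "2 * r * real N \<le> R" and "0 < R"
  shows "1 - surv (gball x R) n x \<le> 2 powr (real n / real t) * (1 - h / 2) ^ N"
proof -
  \<comment> \<open>With \<open>s ^ t = 1 / 2\<close> a crossing multiplies the generating function by at most \<open>1 - h / 2\<close>.\<close>
  define s :: real where "s = (1 / 2) powr (1 / real t)"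
  have s: "0 < s" "s \<le> 1" "s ^ t = 1 / 2"
    using t by (auto simp: s_def powr_le_one_le powr_power intro!: powr_le1)
  let ?u = "\<lambda>n z. 1 - surv (gball x R) n z"
  let ?q = "1 - h / 2"
  have main: "s ^ n * ?u n z \<le> ?q ^ j" if "real (gdist x z) + 2 * r * real j \<le> R" "real (gdist x z) < R" for j n z
    using that
  proof (induction j arbitrary: z n)
    case 0
    have "s ^ n * ?u n z \<le> 1" using s by (intro mult_le_one) (auto intro: power_le_one)
    then show ?case by simp
  next
    case (Suc j)
    have close: "real (gdist x v) + 2 * r * real j \<le> R \<and> real (gdist x v) < R" if "real (gdist z v) < 2 * r" for v
    proof -
      have "real (gdist x v) \<le> real (gdist x z) + real (gdist z v)"
        using gdist_triangle[of x v z] by linarith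
      moreover have "2 * r * real (Suc j) = 2 * r * real j + 2 * r" by (simp add: algebra_simps)
      moreover have "0 \<le> 2 * r * real j" using r by simp
      ultimately show ?thesis using that Suc.prems(1) by linarith
    qed
    have inB: "real (gdist z v) < 2 * r" if "v \<in> gball z r" for v
      using that r by (simp add: gball_def)
    have inB': "real (gdist z v) < 2 * r" if "y \<in> gball z r" "v \<in> nb y" for y v
    proof -
      have "real (gdist z v) \<le> real (gdist z y) + 1" using gdist_nb_le[OF that(2), of z] by linarith
      then show ?thesis using that r by (simp add: gball_def)
    qed
    have "s ^ n * ?u n z \<le> ?q ^ j * (1 - (1 - s ^ t) * surv (gball z r) t z)"
    proof (rule generating_function_step)
      show "0 \<le> ?q ^ j" using h by simp
      show "?u 0 v \<le> 0" if "v \<in> gball z r" for v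
        using close[OF inB[OF that]] by (simp add: surv_0 gball_def)
      show "?u (Suc k) v = (\<Sum>y\<in>nb v. trans_prob v y * ?u k y)" if "v \<in> gball z r" for k v
        using close[OF inB[OF that]]
        by (simp add: surv_Suc right_diff_distrib sum_subtractf sum_trans_prob) (simp add: gball_def)
      show "s ^ k * ?u k v \<le> ?q ^ j" if "v \<in> gball z r" for k v
        using Suc.IH close[OF inB[OF that]] by blast
      show "s ^ k * ?u k v \<le> ?q ^ j" if "y \<in> gball z r" "v \<in> nb y" for k y v
        using Suc.IH close[OF inB'[OF that]] by blast
    qed (use s r in auto)
    also have "\<dots> \<le> ?q ^ j * ?q"
    proof (rule mult_left_mono)
      show "1 - (1 - s ^ t) * surv (gball z r) t z \<le> ?q"
        unfolding s(3) using surv[of z] Suc.prems(2) by (simp add: gball_def)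
    qed (use h in simp)
    finally show ?case by (simp add: mult.commute)
  qed
  have "s ^ n * ?u n x \<le> ?q ^ N" using N \<open>0 < R\<close> by (intro main) auto
  moreover have "s ^ n * 2 powr (real n / real t) = 1"
  proof -
    have "s ^ n = (1 / 2) powr (real n / real t)" by (simp add: s_def powr_power)
    then have "s ^ n * 2 powr (real n / real t) = (1 / 2 * 2) powr (real n / real t)"
      by (simp only: powr_mult[symmetric])
    then show ?thesis by simp
  qed
  then have "?u n x = 2 powr (real n / real t) * (s ^ n * ?u n x)"
    by (simp add: algebra_simps)
  ultimately show ?thesis by (metis mult_left_mono powr_ge_zero)
qed

lemma p0_le_1: "p0 \<le> 1"
proof -
  fix x :: 'a
  have "1 \<le> mean_exit x 1" by (rule mean_exit_ge)
  also have "\<dots> \<le> 1 / p0" by (rule mean_exit_1_le)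
  finally show ?thesis using p0_pos by (simp add: field_simps)
qed

abbreviation tail_exp :: real where
  "tail_exp \<equiv> 1 / (walk_dim - 1)"

lemma tail_exp_pos: "0 < tail_exp"
  using walk_dim_gt_1 by simp

text \<open>The number \<open>N\<close> of intermediate scales is chosen as large as possible subject to the sum of \<open>N\<close>
  typical exit times at radius \<open>R / (4 N)\<close> being at least a fixed multiple of \<open>n\<close>.\<close>

lemma exit_tail:
  "\<exists>C\<ge>1. \<exists>c>0. \<forall>x R n. 0 < R \<longrightarrow> 0 < n \<longrightarrow>
     1 - surv (gball x R) n x \<le> C * exp (- c * (mean_exit x R / real n) powr tail_exp)"
proof -
  obtain C1 where C1: "C1 \<ge> 1"
    "\<And>x y R s. 0 < R \<Longrightarrow> 1 \<le> s \<Longrightarrow> y \<in> gball x R \<Longrightarrow>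
      mean_exit x R \<le> C1 * s powr walk_dim * mean_exit y (R / s)"
    using mean_exit_polynomial by metis
  define b where "b = walk_dim"
  have b: "b > 1" using walk_dim_gt_1 by (simp add: b_def)
  define h where "h = 1 / (2 * T)"
  have h: "0 < h" "h \<le> 1" using T_gt_1 by (auto simp: h_def)
  define lq where "lq = - ln (1 - h / 2)"
  have lq: "lq > 0" using h by (simp add: lq_def ln_less_zero)
  have q_pow: "(1 - h / 2) ^ N = exp (- (real N * lq))" for N
  proof -
    have "1 - h / 2 = exp (- lq)" using h by (simp add: lq_def)
    then show ?thesis by (simp add: exp_of_nat_mult[symmetric])
  qed
  define \<kappa> where "\<kappa> = lq / (2 * ln 2)"
  have \<kappa>: "\<kappa> > 0" using lq by (simp add: \<kappa>_def)
  define K where "K = C1 * 4 powr b"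
  have K: "K \<ge> 1" using C1(1) b mult_mono[of 1 C1 1 "4 powr b"] by (simp add: K_def ge_one_powr_ge_zero)
  \<comment> \<open>Small enough for three purposes: the radius \<open>R / (4 N)\<close> is at least \<open>1\<close>, the typical exit time \<open>t\<close> at that
    radius is at least \<open>1\<close>, and \<open>n / t\<close> is at most \<open>\<kappa> N\<close>, so that half of the exponential gain survives.\<close>
  define c' where "c' = min \<kappa> p0 / (4 * K)"
  have c'0: "c' > 0" using \<kappa> p0_pos K by (simp add: c'_def)
  have c'1: "4 * K * c' \<le> \<kappa>" and c'2: "4 * K * c' \<le> p0" using K by (auto simp: c'_def)
  define c where "c = lq / 4 * c' powr tail_exp"
  have c: "c > 0" using lq c'0 by (simp add: c_def)
  have main: "1 - surv (gball x R) n x \<le> exp (lq / 4) * exp (- c * (mean_exit x R / real n) powr tail_exp)"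
    if R: "0 < R" and n: "0 < n" for x R n
  proof -
    define E where "E = mean_exit x R"
    define A where "A = (c' * (E / real n)) powr tail_exp"
    define N where "N = nat \<lfloor>A\<rfloor>"
    have E: "0 < E" using R mean_exit_pos by (simp add: E_def)
    have A0: "0 \<le> A" by (simp add: A_def)
    have N: "real N \<le> A" "A < real N + 1" unfolding N_def using A0 by linarith+
    have cA: "c * (E / real n) powr tail_exp = lq / 4 * A"
      unfolding c_def A_def by (subst powr_mult) (use c'0 E in auto)
    have eA: "- c * (mean_exit x R / real n) powr tail_exp = - (lq / 4 * A)"
      by (simp only: mult_minus_left cA[unfolded E_def])
    consider "N = 0" | "real n < R" | "1 \<le> N" "R \<le> real n" by linarith
    then show ?thesis
    proof cases
      case 1
      then have "lq / 4 * A \<le> lq / 4 * 1" using N lq by (intro mult_left_mono) auto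
      then have "1 \<le> exp (lq / 4) * exp (- (lq / 4 * A))" by (simp flip: exp_add)
      moreover have "1 - surv (gball x R) n x \<le> 1" by simp
      ultimately show ?thesis unfolding eA by linarith
    next
      case 2
      then have "surv (gball x R) n x = 1" by (intro surv_gball_early) simp
      then show ?thesis by simp
    next
      case 3
      have Ab: "A powr (b - 1) = c' * (E / real n)"
        using c'0 E n b by (simp add: A_def powr_powr b_def)
      have "real N powr (b - 1) \<le> A powr (b - 1)"
        using N b by (intro powr_mono2) auto
      then have Npow: "real N powr (b - 1) \<le> c' * (E / real n)" unfolding Ab .
      have N1: "real N powr (b - 1) \<ge> 1" using 3 b by (intro ge_one_powr_ge_zero) auto
      have R1: "1 \<le> R"
      proof (rule ccontr)
        assume "\<not> 1 \<le> R"
        then have "E \<le> mean_exit x 1" unfolding E_def by (intro mean_exit_mono) auto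
        also have "\<dots> \<le> 1 / p0" by (rule mean_exit_1_le)
        finally have Ep: "E * p0 \<le> 1" using p0_pos by (simp add: field_simps)
        have "real n \<le> c' * E" using order_trans[OF N1 Npow] n by (simp add: field_simps)
        then have "1 \<le> c' * E" using n by linarith
        also have "4 * (c' * E) \<le> (4 * K * c') * E"
          using K c'0 E mult_right_mono[of 1 K "c' * E"] by (simp add: mult_ac)
        also have "\<dots> \<le> p0 * E" using c'2 E by (intro mult_right_mono) auto
        finally show False using Ep by (simp add: mult.commute)
      qed
      have ER: "E \<le> C1 * R powr b / p0"
      proof -
        have "E \<le> C1 * R powr b * mean_exit x (R / R)"
          unfolding E_def b_def using R1 by (intro C1) auto
        also have "\<dots> \<le> C1 * R powr b * (1 / p0)"
          using R1 C1(1) mean_exit_1_le[of x] by (intro mult_left_mono) auto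
        finally show ?thesis by simp
      qed
      have NR: "4 * real N \<le> R"
      proof (rule ccontr)
        assume "\<not> 4 * real N \<le> R"
        then have "(R / 4) powr (b - 1) < real N powr (b - 1)"
          using R1 b by (intro powr_less_mono2) auto
        also have "\<dots> \<le> c' * (E / real n)" by (rule Npow)
        also have "\<dots> \<le> c' * (C1 * R powr b / p0 / R)"
          using c'0 ER 3 R1 n E by (intro mult_left_mono frac_le) auto
        also have "\<dots> = (c' * C1 / p0) * R powr (b - 1)"
          using R1 by (simp add: powr_diff)
        also have "\<dots> \<le> (1 / 4 powr (b - 1)) * R powr (b - 1)"
        proof (rule mult_right_mono)
          have "16 * (4 powr (b - 1) * (c' * C1)) = 4 * K * c'" by (simp add: K_def powr_diff)
          then have "16 * (4 powr (b - 1) * (c' * C1)) \<le> p0" using c'2 by (simp only:)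
          moreover have "0 \<le> 4 powr (b - 1) * (c' * C1)" using c'0 C1(1) by simp
          ultimately have "4 powr (b - 1) * (c' * C1) \<le> p0" by linarith
          then show "c' * C1 / p0 \<le> 1 / 4 powr (b - 1)" using p0_pos by (simp add: field_simps)
        qed simp
        also have "\<dots> = (R / 4) powr (b - 1)" using R1 by (simp add: powr_divide)
        finally show False by simp
      qed
      define r where "r = R / (4 * real N)"
      have r: "1 \<le> r" "2 * r * real N \<le> R" using NR 3 R by (auto simp: r_def field_simps)
      define B where "B = E / (2 * K * real N powr b)"
      define t where "t = nat \<lfloor>B\<rfloor>"
      have Nb: "real N powr b = real N * real N powr (b - 1)" using 3 by (simp add: powr_diff)
      have KN: "4 * K * real N powr b * real n \<le> (4 * K * c') * real N * E"
      proof -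
        have "real N powr (b - 1) * real n \<le> c' * E" using Npow n by (simp add: field_simps)
        then have "(4 * K * real N) * (real N powr (b - 1) * real n) \<le> (4 * K * real N) * (c' * E)"
          using K by (intro mult_left_mono) auto
        then show ?thesis unfolding Nb by (simp add: mult_ac)
      qed
      have Npos: "0 < real N powr b" using 3 by simp
      have B1: "1 \<le> B"
      proof -
        have "4 * K * real N powr b * real n \<le> 1 * real N * E"
          using KN mult_right_mono[OF order_trans[OF c'2 p0_le_1], of "real N * E"] E by (simp add: mult.assoc)
        also have "\<dots> \<le> real n * E"
          using NR 3 E by (intro mult_right_mono) auto
        finally have "4 * K * real N powr b \<le> E" using n by (simp add: mult.commute)
        then have "2 * K * real N powr b \<le> E" using K Npos mult_pos_pos[of K "real N powr b"] by linarith
        then show ?thesis using K Npos by (simp add: B_def)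
      qed
      have t: "real t \<le> B" "B < real t + 1" unfolding t_def using B1 by linarith+
      then have t1: "0 < t" "B / 2 \<le> real t" using B1 by (cases t; linarith)+
      have nt: "real n / real t \<le> \<kappa> * real N"
      proof -
        have "real n \<le> \<kappa> * real N * (B / 2)"
        proof -
          have "4 * K * real N powr b * real n \<le> \<kappa> * real N * E"
            using KN mult_right_mono[OF c'1, of "real N * E"] E by (simp add: mult.assoc)
          then show ?thesis using K Npos by (simp add: B_def field_simps)
        qed
        also have "\<dots> \<le> \<kappa> * real N * real t" using t1 \<kappa> by (intro mult_left_mono) auto
        finally show ?thesis using t1 by (simp add: field_simps)
      qed
      have surv: "h \<le> surv (gball z r) t z" if "z \<in> gball x R" for z
        unfolding h_def
      proof (rule surv_half_mean)
        have "E \<le> C1 * (4 * real N) powr b * mean_exit z (R / (4 * real N))"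
          unfolding E_def b_def using 3 R that by (intro C1) auto
        also have "C1 * (4 * real N) powr b = K * real N powr b" by (simp add: K_def powr_mult)
        finally have "E \<le> K * real N powr b * mean_exit z r" by (simp add: r_def)
        then have "B \<le> mean_exit z r / 2" using K Npos by (simp add: B_def field_simps)
        then show "real t \<le> mean_exit z r / 2" using t by linarith
      qed (use r in auto)
      have "1 - surv (gball x R) n x \<le> 2 powr (real n / real t) * (1 - h / 2) ^ N"
        by (rule surv_chaining[OF r(1) t1(1) _ h(2) surv r(2) R]) (use h in auto)
      also have "\<dots> \<le> 2 powr (\<kappa> * real N) * (1 - h / 2) ^ N"
        using nt h by (intro mult_right_mono powr_mono) auto
      also have "2 powr (\<kappa> * real N) = exp (real N * lq / 2)"
        by (simp add: powr_def \<kappa>_def)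
      also have "exp (real N * lq / 2) * (1 - h / 2) ^ N = exp (- (real N * lq / 2))"
        unfolding q_pow by (simp flip: exp_add)
      also have "\<dots> \<le> exp (- (lq / 4 * A))"
      proof -
        have "A \<le> 2 * real N" using N 3 by linarith
        then have "lq / 4 * A \<le> lq / 4 * (2 * real N)" using lq by (intro mult_left_mono) auto
        then show ?thesis by (simp add: mult.commute)
      qed
      also have "\<dots> \<le> exp (lq / 4) * exp (- (lq / 4 * A))" using lq by simp
      finally show ?thesis unfolding eA .
    qed
  qed
  show ?thesis
    by (intro exI[of _ "exp (lq / 4)"] exI[of _ c] conjI allI impI main) (use lq c in auto)
qed

section \<open>The volume at a time scale\<close>

definition tvol :: "'a \<Rightarrow> nat \<Rightarrow> real" where
  "tvol x n = vol x (real (inv_exit x n))"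

lemma tvol_pos: "0 < n \<Longrightarrow> 0 < tvol x n"
  unfolding tvol_def by (rule vol_inv_exit_pos)

lemma tvol_small: "0 < n \<Longrightarrow> tvol x n \<le> vol x (real n)"
  unfolding tvol_def by (intro vol_mono) (simp add: inv_exit_le mean_exit_ge)

lemma inv_exit_dilate:
  fixes \<Lambda> n :: nat and x :: 'a
  assumes "1 \<le> \<Lambda>" "0 < n"
  defines "R \<equiv> real (inv_exit x (\<Lambda> * n))"
  shows "1 \<le> R" "real \<Lambda> * real n \<le> mean_exit x R" "mean_exit x R \<le> inv_exit_const * (real \<Lambda> * real n)"
    "tvol x n \<le> vol x R"
proof -
  have pos: "0 < \<Lambda> * n" using assms by simp
  show "1 \<le> R" unfolding R_def using pos by (rule inv_exit_pos)
  show E: "real \<Lambda> * real n \<le> mean_exit x R" using inv_exit_ge[of "\<Lambda> * n" x] by (simp add: R_def)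
  show "mean_exit x R \<le> inv_exit_const * (real \<Lambda> * real n)"
    using mean_exit_inv_exit_le[OF pos, of x] by (simp add: R_def)
  have "1 * real n \<le> real \<Lambda> * real n" using assms by (intro mult_right_mono) auto
  then have "inv_exit x n \<le> inv_exit x (\<Lambda> * n)" using E unfolding R_def by (intro inv_exit_le) linarith
  then show "tvol x n \<le> vol x R" unfolding tvol_def R_def by (intro vol_mono) simp
qed

lemma tvol_compare:
  "\<exists>C\<ge>1. \<exists>a\<ge>0. \<forall>x z n k L \<rho>. 0 < n \<longrightarrow> 0 < k \<longrightarrow> 1 \<le> L \<longrightarrow> real (gdist x z) < \<rho> \<longrightarrow>
      real n \<le> L * real k \<longrightarrow> mean_exit x \<rho> \<le> L * real k \<longrightarrow> tvol x n \<le> C * L powr a * tvol z k"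
proof -
  obtain C a where C: "C \<ge> 1" "a \<ge> 0"
    "\<And>x z r k L. 0 < r \<Longrightarrow> 0 < k \<Longrightarrow> 1 \<le> L \<Longrightarrow> real (gdist x z) < r \<Longrightarrow>
      mean_exit x r \<le> L * real k \<Longrightarrow> vol x r \<le> C * L powr a * vol z (real (inv_exit z k))"
    using vol_le_vol_inv_exit by metis
  have "tvol x n \<le> (C * inv_exit_const powr a) * L powr a * tvol z k"
    if n: "0 < n" and k: "0 < k" and L: "1 \<le> L" and d: "real (gdist x z) < \<rho>"
      and nk: "real n \<le> L * real k" and E: "mean_exit x \<rho> \<le> L * real k" for x z n k L \<rho>
  proof -
    define r where "r = max (real (inv_exit x n)) \<rho>"
    have "L * real k \<le> inv_exit_const * L * real k"
      using inv_exit_const_ge_1 L mult_right_mono[of 1 inv_exit_const "L * real k"] by (simp add: mult.assoc)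
    moreover have "inv_exit_const * real n \<le> inv_exit_const * (L * real k)"
      using nk inv_exit_const_ge_1 by (intro mult_left_mono) auto
    ultimately have Er: "mean_exit x r \<le> (inv_exit_const * L) * real k"
      using mean_exit_inv_exit_le[OF n, of x] E by (simp add: r_def max_def mult.assoc)
    have "tvol x n \<le> vol x r" unfolding tvol_def r_def by (intro vol_mono) simp
    also have "\<dots> \<le> C * (inv_exit_const * L) powr a * tvol z k"
      unfolding tvol_def
    proof (rule C(3)[OF _ k _ _ Er])
      show "0 < r" using inv_exit_pos[OF n, of x] by (simp add: r_def)
      show "1 \<le> inv_exit_const * L" using mult_mono[of 1 inv_exit_const 1 L] inv_exit_const_ge_1 L by simp
      show "real (gdist x z) < r" using d by (simp add: r_def)
    qed
    also have "(inv_exit_const * L) powr a = inv_exit_const powr a * L powr a"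
      using inv_exit_const_ge_1 L by (simp add: powr_mult)
    finally show ?thesis by (simp add: mult.assoc)
  qed
  moreover have "1 \<le> C * inv_exit_const powr a"
    using mult_mono[of 1 C 1 "inv_exit_const powr a"] C ge_one_powr_ge_zero[of inv_exit_const a] inv_exit_const_ge_1 by simp
  ultimately show ?thesis using C(2) by blast
qed

lemma tvol_parity: "\<exists>C\<ge>1. \<forall>x k. 2 \<le> k \<longrightarrow> tvol x k \<le> C * tvol x (2 * (k div 2))"
proof -
  obtain C a where C: "C \<ge> 1" "a \<ge> 0"
    "\<And>x z n k L \<rho>. 0 < n \<Longrightarrow> 0 < k \<Longrightarrow> 1 \<le> L \<Longrightarrow> real (gdist x z) < \<rho> \<Longrightarrow> real n \<le> L * real k \<Longrightarrow>
      mean_exit x \<rho> \<le> L * real k \<Longrightarrow> tvol x n \<le> C * L powr a * tvol z k"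
    using tvol_compare by metis
  define L where "L = 2 * inv_exit_const"
  have L: "1 \<le> L" "2 \<le> L" using inv_exit_const_ge_1 by (auto simp: L_def)
  have "tvol x k \<le> (C * L powr a) * tvol x (2 * (k div 2))" if "2 \<le> k" for x k
  proof (rule C(3)[where \<rho> = 1])
    have j: "1 \<le> real (k div 2)" using that by (simp add: Suc_le_eq div_greater_zero_iff)
    then show "0 < 2 * (k div 2)" by simp
    have "real k \<le> 2 * real (2 * (k div 2))" using that by linarith
    also have "\<dots> \<le> L * real (2 * (k div 2))" using L by (intro mult_right_mono) auto
    finally show "real k \<le> L * real (2 * (k div 2))" .
    have "mean_exit x 1 \<le> 1 / p0" by (rule mean_exit_1_le)
    also have "\<dots> \<le> L * 1" using inv_exit_const_ge_1 by (simp add: L_def inv_exit_const_def)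
    also have "\<dots> \<le> L * real (2 * (k div 2))" using L j by (intro mult_left_mono) auto
    finally show "mean_exit x 1 \<le> L * real (2 * (k div 2))" .
  qed (use that L in auto)
  moreover have "1 \<le> C * L powr a"
    using mult_mono[of 1 C 1 "L powr a"] C ge_one_powr_ge_zero[of L a] L by simp
  ultimately show ?thesis by blast
qed

definition diag_bounded :: "real \<Rightarrow> nat \<Rightarrow> bool" where
  "diag_bounded K m \<longleftrightarrow> (\<forall>j z. 1 \<le> j \<longrightarrow> j < m \<longrightarrow> diag UNIV j z \<le> K / tvol z (2 * j))"

lemma diag_bounded_half:
  "\<exists>C\<ge>1. \<forall>K m t x. diag_bounded K m \<longrightarrow> 0 \<le> K \<longrightarrow> 2 \<le> t \<longrightarrow> t < 2 * m \<longrightarrow>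
     diag UNIV (t div 2) x \<le> C * K / tvol x t"
proof -
  obtain C where C: "C \<ge> 1" "\<And>x k. 2 \<le> k \<Longrightarrow> tvol x k \<le> C * tvol x (2 * (k div 2))"
    using tvol_parity by blast
  have "diag UNIV (t div 2) x \<le> C * K / tvol x t"
    if "diag_bounded K m" "0 \<le> K" "2 \<le> t" "t < 2 * m" for K m t x
  proof -
    have j: "1 \<le> t div 2" "t div 2 < m" using that by auto
    then have "diag UNIV (t div 2) x \<le> K / tvol x (2 * (t div 2))"
      using that(1) unfolding diag_bounded_def by blast
    also have "\<dots> \<le> C * K / tvol x t"
    proof -
      have "K * tvol x t \<le> K * (C * tvol x (2 * (t div 2)))"
        using that C(2)[of t x] by (intro mult_left_mono) auto
      moreover have "0 < tvol x t" "0 < tvol x (2 * (t div 2))"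
        using that j by (intro tvol_pos; linarith)+
      ultimately show ?thesis by (simp add: field_simps)
    qed
    finally show ?thesis .
  qed
  then show ?thesis using C(1) by blast
qed

text \<open>By the Cauchy-Schwarz inequality the kernel at \<open>(y, z)\<close> is controlled by the diagonal at \<open>y\<close> and \<open>z\<close>;
  the volumes there are then moved to \<open>x\<close>.\<close>

lemma hk_le_tvol:
  "\<exists>C\<ge>1. \<exists>a\<ge>0. \<forall>x y z n k L \<rho> K. 0 < n \<longrightarrow> 0 < k \<longrightarrow> 1 \<le> L \<longrightarrow> 0 \<le> K \<longrightarrow>
      real (gdist x y) < \<rho> \<longrightarrow> real (gdist x z) < \<rho> \<longrightarrow>
      real n \<le> L * real k \<longrightarrow> mean_exit x \<rho> \<le> L * real k \<longrightarrow>
      diag UNIV (k div 2) y \<le> K / tvol y k \<longrightarrow> diag UNIV (k div 2) z \<le> K / tvol z k \<longrightarrow>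
      hk UNIV k y z \<le> K * C * L powr a / tvol x n"
proof -
  obtain C a where C: "C \<ge> 1" "a \<ge> 0"
    "\<And>x z n k L \<rho>. 0 < n \<Longrightarrow> 0 < k \<Longrightarrow> 1 \<le> L \<Longrightarrow> real (gdist x z) < \<rho> \<Longrightarrow> real n \<le> L * real k \<Longrightarrow>
      mean_exit x \<rho> \<le> L * real k \<Longrightarrow> tvol x n \<le> C * L powr a * tvol z k"
    using tvol_compare by metis
  have "hk UNIV k y z \<le> K * C * L powr a / tvol x n"
    if n: "0 < n" and k: "0 < k" and L: "1 \<le> L" and K: "0 \<le> K"
      and d: "real (gdist x y) < \<rho>" "real (gdist x z) < \<rho>"
      and nk: "real n \<le> L * real k" and E: "mean_exit x \<rho> \<le> L * real k"
      and dg: "diag UNIV (k div 2) y \<le> K / tvol y k" "diag UNIV (k div 2) z \<le> K / tvol z k"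
    for x y z n k L \<rho> K
  proof -
    have "K / tvol v k \<le> K * C * L powr a / tvol x n" if "real (gdist x v) < \<rho>" for v
    proof -
      have "tvol x n \<le> C * L powr a * tvol v k" by (rule C(3)[OF n k L that nk E])
      then have "K * tvol x n \<le> K * (C * L powr a * tvol v k)" using K by (rule mult_left_mono)
      then show ?thesis using tvol_pos[OF n, of x] tvol_pos[OF k, of v] by (simp add: field_simps)
    qed
    then show ?thesis using dg d by (intro hk_le_diag) (meson order_trans)+
  qed
  then show ?thesis using C(1,2) by blast
qed

section \<open>From the diagonal to the full upper estimate\<close>

lemma diag_from_diagonal_estimate:
  assumes local_diagonal_upper_estimate
  shows "\<exists>C\<ge>1. \<forall>x k. 0 < k \<longrightarrow> diag UNIV (k div 2) x \<le> C / tvol x k"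
proof -
  obtain C0 where C0: "C0 > 0" "\<And>x n. 0 < n \<Longrightarrow> hk UNIV n x x \<le> C0 / tvol x n"
    using assms unfolding local_diagonal_upper_estimate_def heat_kernel_eq tvol_def by blast
  have bounded: "diag_bounded C0 m" for m
    using C0(2) by (simp add: diag_bounded_def diag_def)
  obtain C1 where C1: "C1 \<ge> 1" "\<And>K m t x. diag_bounded K m \<Longrightarrow> 0 \<le> K \<Longrightarrow> 2 \<le> t \<Longrightarrow> t < 2 * m \<Longrightarrow>
     diag UNIV (t div 2) x \<le> C1 * K / tvol x t"
    using diag_bounded_half by metis
  have "diag UNIV (k div 2) x \<le> max 1 (C1 * C0) / tvol x k" if k: "0 < k" for x k
  proof (cases "k = 1")
    case True
    have "diag UNIV (k div 2) x \<le> 1 / mu x" unfolding diag_def by (rule hk_le_mu)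
    also have "mu x = vol x 1" by (simp add: vol_unit)
    also have "1 / vol x 1 \<le> 1 / tvol x 1"
      using tvol_small[of 1 x] tvol_pos[of 1 x] by (intro divide_left_mono) auto
    also have "\<dots> \<le> max 1 (C1 * C0) / tvol x 1"
      using tvol_pos[of 1 x] by (intro divide_right_mono) auto
    finally show ?thesis using True by simp
  next
    case False
    have "diag UNIV (k div 2) x \<le> C1 * C0 / tvol x k"
      using False k C0(1) by (intro C1(2)[OF bounded[of k]]) auto
    also have "\<dots> \<le> max 1 (C1 * C0) / tvol x k"
      using tvol_pos[OF k, of x] by (intro divide_right_mono) auto
    finally show ?thesis .
  qed
  then show ?thesis by (intro exI[of _ "max 1 (C1 * C0)"]) auto
qed

lemma hk_from_diagonal_estimate:
  assumes local_diagonal_upper_estimate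
  shows "\<exists>C\<ge>1. \<exists>a\<ge>0. \<forall>x y z n k L \<rho>. 0 < n \<longrightarrow> 0 < k \<longrightarrow> 1 \<le> L \<longrightarrow>
      real (gdist x y) < \<rho> \<longrightarrow> real (gdist x z) < \<rho> \<longrightarrow>
      real n \<le> L * real k \<longrightarrow> mean_exit x \<rho> \<le> L * real k \<longrightarrow>
      hk UNIV k y z \<le> C * L powr a / tvol x n"
proof -
  obtain K where K: "K \<ge> 1" "\<And>x k. 0 < k \<Longrightarrow> diag UNIV (k div 2) x \<le> K / tvol x k"
    using diag_from_diagonal_estimate[OF assms] by blast
  obtain C a where C: "C \<ge> 1" "a \<ge> 0" "\<And>x y z n k L \<rho> K. 0 < n \<Longrightarrow> 0 < k \<Longrightarrow> 1 \<le> L \<Longrightarrow> 0 \<le> K \<Longrightarrow>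
      real (gdist x y) < \<rho> \<Longrightarrow> real (gdist x z) < \<rho> \<Longrightarrow>
      real n \<le> L * real k \<Longrightarrow> mean_exit x \<rho> \<le> L * real k \<Longrightarrow>
      diag UNIV (k div 2) y \<le> K / tvol y k \<Longrightarrow> diag UNIV (k div 2) z \<le> K / tvol z k \<Longrightarrow>
      hk UNIV k y z \<le> K * C * L powr a / tvol x n"
    using hk_le_tvol by metis
  have "1 \<le> K * C" using mult_mono[of 1 K 1 C] K(1) C(1) by simp
  then show ?thesis
    using C(2) by (intro exI[of _ "K * C"] exI[of _ a] conjI allI impI C(3) K(2)) (use K(1) in auto)
qed

text \<open>Both sides are the sum over \<open>z\<close> of \<open>f(z) p\<^sub>m(x, z) p\<^sub>n(z, y) \<mu>(z)\<close>; this is the reversal of paths.\<close>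

lemma kpow_swap:
  "kpow UNIV m (\<lambda>z. f z * hk UNIV n z y) x = kpow UNIV n (\<lambda>z. f z * hk UNIV m z x) y"
proof -
  define S where "S = {z. gdist x z \<le> m} \<union> {z. gdist y z \<le> n}"
  have S: "finite S" by (simp add: S_def finite_cball)
  have 0: "hk UNIV n z y = 0" "hk UNIV m z x = 0" if "z \<notin> S" for z
    using that by (auto simp: S_def gdist_sym not_le intro!: hk_far)
  have "kpow UNIV m (\<lambda>z. f z * hk UNIV n z y) x = (\<Sum>z\<in>S. killed_prob UNIV m x z * (f z * hk UNIV n z y))"
    by (rule kpow_kernel) (use S 0 in auto)
  also have "\<dots> = (\<Sum>z\<in>S. killed_prob UNIV n y z * (f z * hk UNIV m z x))"
  proof (rule sum.cong[OF refl])
    fix z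
    show "killed_prob UNIV m x z * (f z * hk UNIV n z y) = killed_prob UNIV n y z * (f z * hk UNIV m z x)"
    proof -
      have "killed_prob UNIV m x z = hk UNIV m z x * mu z"
        by (subst hk_sym) (simp add: hk_def)
      moreover have "killed_prob UNIV n y z = hk UNIV n z y * mu z"
        by (subst hk_sym) (simp add: hk_def)
      ultimately show ?thesis by simp
    qed
  qed
  also have "\<dots> = kpow UNIV n (\<lambda>z. f z * hk UNIV m z x) y"
    by (rule kpow_kernel[symmetric]) (use S 0 in auto)
  finally show ?thesis .
qed

text \<open>A path that starts in \<open>A\<close> and is outside at time \<open>m\<close> has left \<open>A\<close> by then.\<close>

lemma kpow_far:
  assumes f: "\<And>z. 0 \<le> f z" and "x \<in> A"
    and M: "\<And>k y z. k < m \<Longrightarrow> y \<in> A \<Longrightarrow> z \<in> nb y \<Longrightarrow> kpow UNIV k f z \<le> M"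
  shows "kpow UNIV m (\<lambda>z. (if z \<in> A then 0 else 1) * f z) x \<le> M * (1 - surv A m x)"
proof -
  let ?g = "\<lambda>z. (if z \<in> A then 0 else 1) * f z"
  have "kpow UNIV m ?g x - kpow A m ?g x \<le> M * (1 - surv A m x)"
  proof (rule exit_decomposition)
    fix k y z assume "k < m" "y \<in> A" "z \<in> nb y"
    have "kpow UNIV k ?g z \<le> kpow UNIV k f z" by (rule kpow_mono) (use f in auto)
    then show "kpow UNIV k ?g z \<le> M" using M[OF \<open>k < m\<close> \<open>y \<in> A\<close> \<open>z \<in> nb y\<close>] by simp
  qed (use assms in auto)
  moreover have "kpow A m ?g x = kpow A m (\<lambda>z. 0 * 0) x" by (rule kpow_cong) (use assms in auto)
  then have "kpow A m ?g x = 0" unfolding kpow_cmult by simp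
  ultimately show ?thesis by simp
qed

lemma upper_imp_diagonal: "upper_estimate \<Longrightarrow> local_diagonal_upper_estimate"
proof -
  assume upper_estimate
  then obtain C b c where C: "C > 0" "\<And>x y n. 0 < n \<Longrightarrow>
      heat_kernel n x y \<le> C / vol x (real (inv_exit x n)) *
        exp (- c * (mean_exit x (real (gdist x y)) / real n) powr (1 / (b - 1)))"
    unfolding upper_estimate_def by blast
  have "heat_kernel n x x \<le> C / vol x (real (inv_exit x n))" if "0 < n" for x n
    using C(2)[OF that, of x x] by simp
  then show ?thesis using C(1) unfolding local_diagonal_upper_estimate_def by blast
qed

text \<open>A path from \<open>x\<close> to \<open>y\<close> is, at half time, outside \<open>B(x, d/2)\<close> or outside \<open>B(y, d/2)\<close>; the second
  case is the first one for the reversed path.\<close>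

lemma diagonal_imp_upper:
  assumes local_diagonal_upper_estimate shows upper_estimate
proof -
  obtain Ch a where Ch: "Ch \<ge> 1" "a \<ge> 0" "\<And>x y z n k L \<rho>. 0 < n \<Longrightarrow> 0 < k \<Longrightarrow> 1 \<le> L \<Longrightarrow>
      real (gdist x y) < \<rho> \<Longrightarrow> real (gdist x z) < \<rho> \<Longrightarrow>
      real n \<le> L * real k \<Longrightarrow> mean_exit x \<rho> \<le> L * real k \<Longrightarrow>
      hk UNIV k y z \<le> Ch * L powr a / tvol x n"
    using hk_from_diagonal_estimate[OF assms] by metis
  obtain Ct ct where Ct: "Ct \<ge> 1" "ct > 0" "\<And>x R n. 0 < R \<Longrightarrow> 0 < n \<Longrightarrow>
     1 - surv (gball x R) n x \<le> Ct * exp (- ct * (mean_exit x R / real n) powr tail_exp)"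
    using exit_tail by metis
  define g where "g = tail_exp"
  have g: "g > 0" using tail_exp_pos by (simp add: g_def)
  define c1 where "c1 = ct * (1 / T ^ 3) powr g"
  have c1: "c1 > 0" using Ct(2) T_gt_1 by (simp add: c1_def)
  define c where "c = c1 / 2"
  have c: "c > 0" using c1 by (simp add: c_def)
  obtain Cp where Cp: "Cp > 0" "\<And>L. 1 \<le> L \<Longrightarrow> L powr a * exp (- c * L powr g) \<le> Cp"
    using powr_exp_bounded[OF c g Ch(2)] by blast
  \<comment> \<open>The times that occur after half time are at least \<open>n / 3\<close>, and all points are within \<open>4 d\<close> of \<open>x\<close>.\<close>
  define L0 where "L0 = 3 * T\<^sup>2"
  have L0: "3 \<le> L0" using T_gt_1 by (simp add: L0_def)
  define C2 where "C2 = 2 * (Ch * L0 powr a) * Ct * Cp"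
  define C3 where "C3 = Ch * (L0 / p0) powr a * exp (c * (1 / p0) powr g)"
  have C2: "C2 > 0" using Ch(1) Ct(1) Cp(1) L0 by (simp add: C2_def)
  have C3: "C3 > 0" using Ch(1) L0 p0_pos by (simp add: C3_def)
  have bound: "hk UNIV n x y \<le> max C2 C3 / tvol x n * exp (- c * (mean_exit x (real (gdist x y)) / real n) powr g)"
    if n: "0 < n" for x y n
  proof -
    define d where "d = real (gdist x y)"
    define E where "E = mean_exit x d"
    have d0: "0 \<le> d" by (simp add: d_def)
    have E0: "0 \<le> E" by (simp add: E_def)
    have W: "0 < tvol x n" using n by (rule tvol_pos)
    have E4: "mean_exit x (4 * d) \<le> T\<^sup>2 * E"
    proof (cases "d = 0")
      case False
      then show ?thesis using mean_exit_pow2[of d x 2] d0 by (simp add: E_def)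
    qed (simp add: E_def)
    have step: "mean_exit v d \<le> T * mean_exit v (d / 2)" if "0 < d" for v
      using time_doubling[of "d / 2" v] that by simp
    consider "E / real n \<le> 1 / p0" | "E / real n > 1 / p0" "n = 1" | "E / real n > 1 / p0" "2 \<le> n"
      using n by linarith
    then show ?thesis
    proof cases
      case 1
      have "mean_exit x (max (4 * d) 1) \<le> L0 / p0 * real n"
      proof (cases "4 * d \<le> 1")
        case True
        have "mean_exit x 1 \<le> 1 / p0" by (rule mean_exit_1_le)
        also have "\<dots> \<le> L0 / p0 * real n"
          using L0 n p0_pos mult_mono[of 1 L0 1 "real n"] by (simp add: field_simps)
        finally show ?thesis using True by (simp add: max_def)
      next
        case False
        have "T\<^sup>2 * E \<le> T\<^sup>2 * (1 / p0 * real n)"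
          using 1 n by (intro mult_left_mono) (auto simp: field_simps)
        also have "\<dots> \<le> L0 / p0 * real n"
          using p0_pos by (simp add: L0_def field_simps)
        finally show ?thesis using E4 False by (simp add: max_def)
      qed
      moreover have "1 \<le> L0 / p0" using L0 p0_pos p0_le_1 by (simp add: field_simps)
      moreover have "real n \<le> L0 / p0 * real n" using mult_right_mono[OF calculation(2), of "real n"] by simp
      ultimately have "hk UNIV n x y \<le> Ch * (L0 / p0) powr a / tvol x n"
        using n by (intro Ch(3)[where \<rho> = "max (4 * d) 1"]) (auto simp: d_def)
      also have "\<dots> = C3 / tvol x n * exp (- c * (1 / p0) powr g)"
        by (simp add: C3_def mult.assoc flip: exp_add)
      also have "\<dots> \<le> max C2 C3 / tvol x n * exp (- c * (E / real n) powr g)"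
        using 1 c g W E0 C2 by (intro mult_mono divide_right_mono) (auto intro!: powr_mono2)
      finally show ?thesis by (simp add: E_def d_def)
    next
      case 2
      \<comment> \<open>At time \<open>1\<close> there is no room for halving, but then \<open>y\<close> is out of reach.\<close>
      have "gdist x y > 1"
      proof (rule ccontr)
        assume "\<not> gdist x y > 1"
        then have "E \<le> mean_exit x 1" unfolding E_def d_def by (intro mean_exit_mono) auto
        then show False using 2 mean_exit_1_le[of x] by simp
      qed
      then have "hk UNIV n x y = 0" using 2 by (intro hk_far) simp
      then show ?thesis using W C2 by simp
    next
      case 3
      define m where "m = n div 2"
      have m: "0 < m" "0 < n - m" "real n \<le> 3 * real m" "real n \<le> 3 * real (n - m)" "m \<le> n"
      proof -
        have "n \<le> 3 * (n div 2)" "n \<le> 3 * (n - n div 2)" using 3 by linarith+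
        then have "real n \<le> real (3 * (n div 2))" "real n \<le> real (3 * (n - n div 2))"
          unfolding of_nat_le_iff .
        then show "real n \<le> 3 * real m" "real n \<le> 3 * real (n - m)" unfolding m_def by simp_all
      qed (use 3 in \<open>auto simp: m_def\<close>)
      have dpos: "0 < d"
      proof (rule ccontr)
        assume "\<not> 0 < d"
        then have "d = 0" using d0 by simp
        then have "E = 0" by (simp add: E_def)
        then show False using 3 p0_pos by simp
      qed
      then have d1: "1 \<le> d" by (simp add: d_def)
      define Q where "Q = E / real n"
      have Q: "1 \<le> Q"
      proof -
        have "1 \<le> 1 / p0" using p0_pos p0_le_1 by simp
        then show ?thesis using 3(1) unfolding Q_def by linarith
      qed
      define M where "M = Ch * (L0 * Q) powr a / tvol x n"
      have M0: "0 \<le> M" using Ch(1) W by (simp add: M_def)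
      have hkM: "hk UNIV k u v \<le> M"
        if k: "0 < k" "real n \<le> 3 * real k" and u: "real (gdist x u) < 4 * d" and v: "real (gdist x v) < 4 * d" for k u v
        unfolding M_def
      proof (rule Ch(3)[OF n k(1) _ u v])
        show "1 \<le> L0 * Q" using mult_mono[of 1 L0 1 Q] L0 Q by simp
        have "3 * real k \<le> L0 * Q * real k" using mult_mono[of 3 L0 1 Q] L0 Q by (intro mult_right_mono) auto
        then show "real n \<le> L0 * Q * real k" using k by linarith
        have "T\<^sup>2 * E = T\<^sup>2 * Q * real n" using n by (simp add: Q_def)
        also have "\<dots> \<le> T\<^sup>2 * Q * (3 * real k)" using k Q by (intro mult_left_mono) auto
        finally show "mean_exit x (4 * d) \<le> L0 * Q * real k" using E4 by (simp add: L0_def mult_ac)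
      qed
      have near: "real (gdist u z) < d / 2 + 1" if "v \<in> gball u (d / 2)" "z \<in> nb v" for u v z
        using gdist_nb_le[OF that(2), of u] that(1) unfolding gball_def by auto
      have tail: "1 - surv (gball v (d / 2)) k v \<le> Ct * exp (- c1 * Q powr g)"
        if k: "0 < k" "k \<le> n" and v: "E \<le> T ^ 3 * mean_exit v (d / 2)" for v k
      proof -
        have "E / T ^ 3 \<le> mean_exit v (d / 2)"
          using v T_gt_1 by (simp add: divide_le_eq mult.commute)
        then have "E / T ^ 3 / real n \<le> mean_exit v (d / 2) / real n" by (rule divide_right_mono) simp
        then have "(1 / T ^ 3) * Q \<le> mean_exit v (d / 2) / real n" by (simp add: Q_def mult.commute)
        also have "\<dots> \<le> mean_exit v (d / 2) / real k" using k by (intro divide_left_mono) auto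
        finally have "((1 / T ^ 3) * Q) powr g \<le> (mean_exit v (d / 2) / real k) powr g"
          using T_gt_1 Q g by (intro powr_mono2) auto
        moreover have "((1 / T ^ 3) * Q) powr g = (1 / T ^ 3) powr g * Q powr g"
          by (rule powr_mult)
        ultimately have "ct * ((1 / T ^ 3) powr g * Q powr g) \<le> ct * (mean_exit v (d / 2) / real k) powr g"
          using Ct(2) by (intro mult_left_mono) auto
        then have "c1 * Q powr g \<le> ct * (mean_exit v (d / 2) / real k) powr g"
          by (simp only: c1_def mult.assoc)
        then have "Ct * exp (- ct * (mean_exit v (d / 2) / real k) powr g) \<le> Ct * exp (- c1 * Q powr g)"
          using Ct(1) by (intro mult_left_mono) auto
        moreover have "1 - surv (gball v (d / 2)) k v \<le> Ct * exp (- ct * (mean_exit v (d / 2) / real k) powr g)"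
          unfolding g_def using dpos k by (intro Ct(3)) auto
        ultimately show ?thesis by linarith
      qed
      have Ex: "E \<le> T ^ 3 * mean_exit x (d / 2)"
      proof -
        have "E \<le> T ^ 1 * mean_exit x (d / 2)" using step[OF dpos, of x] by (simp add: E_def)
        also have "\<dots> \<le> T ^ 3 * mean_exit x (d / 2)"
          using T_gt_1 by (intro mult_right_mono power_increasing) auto
        finally show ?thesis .
      qed
      have Ey: "E \<le> T ^ 3 * mean_exit y (d / 2)"
      proof -
        have "E \<le> mean_exit x (2 * (2 * d))" unfolding E_def using d0 by (intro mean_exit_mono) auto
        also have "\<dots> \<le> T * mean_exit y (2 * d)"
          using dpos by (intro time_comparison) (auto simp: gball_def d_def)
        also have "mean_exit y (2 * d) = mean_exit y (2 ^ 2 * (d / 2))" by simp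
        also have "\<dots> \<le> T ^ 2 * mean_exit y (d / 2)" using dpos by (intro mean_exit_pow2) auto
        finally show ?thesis using T_gt_1 by (simp add: power3_eq_cube power2_eq_square mult.assoc)
      qed
      let ?A = "gball x (d / 2)" and ?A' = "gball y (d / 2)"
      let ?f = "\<lambda>z. hk UNIV (n - m) z y"
      have disj: "z \<notin> ?A \<or> z \<notin> ?A'" for z
        using gdist_triangle[of x y z] gdist_sym[of y z] unfolding gball_def d_def by auto
      have "hk UNIV n x y = kpow UNIV m ?f x"
        using hk_add_op[of UNIV m "n - m" x y] m by simp
      also have "\<dots> \<le> kpow UNIV m (\<lambda>z. (if z \<in> ?A then 0 else 1) * ?f z + (if z \<in> ?A' then 0 else 1) * ?f z) x"
        by (rule kpow_mono) (use disj in auto)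
      also have "\<dots> = kpow UNIV m (\<lambda>z. (if z \<in> ?A then 0 else 1) * ?f z) x
          + kpow UNIV (n - m) (\<lambda>z. (if z \<in> ?A' then 0 else 1) * hk UNIV m z x) y"
        unfolding kpow_add_fun kpow_swap[of m "\<lambda>z. if z \<in> ?A' then 0 else 1"] by simp
      also have "\<dots> \<le> M * (1 - surv ?A m x) + M * (1 - surv ?A' (n - m) y)"
      proof (rule add_mono; rule kpow_far)
        fix k v z assume *: "k < m" "v \<in> ?A" "z \<in> nb v"
        have "real (gdist x z) < 4 * d" using near[OF *(2,3)] d1 by linarith
        then show "kpow UNIV k ?f z \<le> M"
          unfolding hk_add_op[symmetric] using m dpos by (intro hkM) (auto simp: d_def)
      next
        fix k v z assume *: "k < n - m" "v \<in> ?A'" "z \<in> nb v"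
        have "real (gdist y z) < d / 2 + 1" using near[OF *(2,3)] .
        moreover have "real (gdist x z) \<le> d + real (gdist y z)"
          using gdist_triangle[of x z y] unfolding d_def by linarith
        ultimately have "real (gdist x z) < 4 * d" using d1 by linarith
        then show "kpow UNIV k (\<lambda>z. hk UNIV m z x) z \<le> M"
          unfolding hk_add_op[symmetric] using m dpos by (intro hkM) (auto simp: d_def)
      qed (use dpos in auto)
      also have "\<dots> \<le> M * (Ct * exp (- c1 * Q powr g)) + M * (Ct * exp (- c1 * Q powr g))"
        using m M0 Ex Ey by (intro add_mono mult_left_mono tail) auto
      also have "\<dots> = 2 * (Ch * L0 powr a) * Ct * (Q powr a * exp (- c * Q powr g)) / tvol x n * exp (- c * Q powr g)"
      proof -
        have "exp (- c1 * Q powr g) = exp (- c * Q powr g) * exp (- c * Q powr g)"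
          by (simp add: c_def flip: exp_add)
        then show ?thesis using L0 Q by (simp add: M_def powr_mult)
      qed
      also have "\<dots> \<le> C2 / tvol x n * exp (- c * Q powr g)"
        unfolding C2_def using Q Ch(1) Ct(1) W
        by (intro mult_right_mono divide_right_mono mult_left_mono Cp(2)) auto
      also have "\<dots> \<le> max C2 C3 / tvol x n * exp (- c * Q powr g)"
        using W by (intro mult_right_mono divide_right_mono) auto
      finally show ?thesis by (simp add: Q_def E_def d_def)
    qed
  qed
  show ?thesis
    unfolding upper_estimate_def heat_kernel_eq
    using bound walk_dim_gt_1 c C2 unfolding g_def tvol_def
    by (intro exI[of _ "max C2 C3"] conjI exI[of _ walk_dim] exI[of _ c]) auto
qed

section \<open>Bootstrapping the diagonal estimate\<close>

text \<open>A strong induction on time. If the estimate holds with the constant \<open>K\<close> at all earlier times, then the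
  paths that leave a large ball contribute at most \<open>K / 4\<close>: the exit time tail is exponential in a power of
  the time dilation \<open>\<Lambda>\<close>, while the volumes involved lose only a power of \<open>\<Lambda>\<close>. It therefore suffices that
  the kernel killed outside the ball has a bound with a small multiple of \<open>K\<close> plus a constant.\<close>

lemma bootstrap:
  assumes gain: "\<And>\<Lambda> \<epsilon>. 1 \<le> (\<Lambda>::nat) \<Longrightarrow> 0 < \<epsilon> \<Longrightarrow>
    \<exists>C. \<forall>x m K. 2 \<le> m \<longrightarrow> 0 \<le> K \<longrightarrow> diag_bounded K m \<longrightarrow>
      diag (gball x (real (inv_exit x (\<Lambda> * (2 * m))))) m x \<le> (\<epsilon> * K + C) / tvol x (2 * m)"
  shows local_diagonal_upper_estimate
proof -
  obtain Ch a where Ch: "Ch \<ge> 1" "a \<ge> 0" "\<And>x y z n k L \<rho> K. 0 < n \<Longrightarrow> 0 < k \<Longrightarrow> 1 \<le> L \<Longrightarrow> 0 \<le> K \<Longrightarrow>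
      real (gdist x y) < \<rho> \<Longrightarrow> real (gdist x z) < \<rho> \<Longrightarrow>
      real n \<le> L * real k \<Longrightarrow> mean_exit x \<rho> \<le> L * real k \<Longrightarrow>
      diag UNIV (k div 2) y \<le> K / tvol y k \<Longrightarrow> diag UNIV (k div 2) z \<le> K / tvol z k \<Longrightarrow>
      hk UNIV k y z \<le> K * Ch * L powr a / tvol x n"
    using hk_le_tvol by metis
  obtain Cp where Cp: "Cp \<ge> 1" "\<And>K m t x. diag_bounded K m \<Longrightarrow> 0 \<le> K \<Longrightarrow> 2 \<le> t \<Longrightarrow> t < 2 * m \<Longrightarrow>
     diag UNIV (t div 2) x \<le> Cp * K / tvol x t"
    using diag_bounded_half by metis
  obtain Ct ct where Ct: "Ct \<ge> 1" "ct > 0" "\<And>x R n. 0 < R \<Longrightarrow> 0 < n \<Longrightarrow>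
     1 - surv (gball x R) n x \<le> Ct * exp (- ct * (mean_exit x R / real n) powr tail_exp)"
    using exit_tail by metis
  define g where "g = tail_exp"
  have g: "g > 0" using tail_exp_pos by (simp add: g_def)
  define L0 where "L0 = 2 * T\<^sup>2 * inv_exit_const"
  have L0: "2 \<le> L0"
    using mult_mono[of 1 "T\<^sup>2" 1 inv_exit_const] T_gt_1 inv_exit_const_ge_1 by (simp add: L0_def mult.assoc)
  define B where "B = 2 * (Cp * Ch * L0 powr a) * Ct"
  have B: "B > 0" using Cp(1) Ch(1) L0 Ct(1) by (simp add: B_def)
  obtain \<Lambda> :: nat where \<Lambda>: "1 \<le> \<Lambda>" "real \<Lambda> powr a * exp (- ct * real \<Lambda> powr g) \<le> 1 / (4 * B)"
    using powr_exp_small[OF Ct(2) g Ch(2), of "1 / (4 * B)"] B by auto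
  obtain C where C: "\<And>x m K. 2 \<le> m \<Longrightarrow> 0 \<le> K \<Longrightarrow>
      diag_bounded K m \<Longrightarrow>
      diag (gball x (real (inv_exit x (\<Lambda> * (2 * m))))) m x \<le> (1 / 4 * K + C) / tvol x (2 * m)"
  proof -
    have "0 < (1 / 4 :: real)" by simp
    from gain[OF \<Lambda>(1) this] show ?thesis using that by blast
  qed
  \<comment> \<open>The constant \<open>D\<close> is for \<open>m = 1\<close>; the other bound makes \<open>K / 2 + C\<close> at most \<open>K\<close>.\<close>
  define K where "K = max D (2 * C)"
  have K: "D \<le> K" "2 * C \<le> K" "0 \<le> K" using D_ge_1 by (auto simp: K_def)
  have main: "diag UNIV m x \<le> K / tvol x (2 * m)" if "1 \<le> m" for m x
    using that
  proof (induction m arbitrary: x rule: less_induct)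
    case (less m)
    have W: "0 < tvol x (2 * m)" using less.prems by (intro tvol_pos) simp
    show ?case
    proof (cases "m = 1")
      case True
      have "tvol x 2 \<le> vol x (2 * 1)" using tvol_small[of 2 x] by simp
      also have "\<dots> \<le> D * vol x 1" by (rule volume_doubling) simp
      also have "vol x 1 = mu x" by (rule vol_unit) auto
      also have "D * mu x \<le> K * mu x" using K by (intro mult_right_mono) auto
      finally have "1 / mu x \<le> K / tvol x 2"
        using tvol_pos[of 2 x] mu_pos[of x] by (simp add: field_simps)
      then show ?thesis using hk_le_mu[of UNIV 2 x x] True by (simp add: diag_def)
    next
      case False
      then have m2: "2 \<le> m" using less.prems by simp
      define R where "R = real (inv_exit x (\<Lambda> * (2 * m)))"
      define A where "A = gball x R"
      have R1: "1 \<le> R"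
        and ER: "real \<Lambda> * (2 * real m) \<le> mean_exit x R" "mean_exit x R \<le> inv_exit_const * (real \<Lambda> * (2 * real m))"
        using inv_exit_dilate[OF \<Lambda>(1), of "2 * m" x] m2 by (simp_all add: R_def)
      have fA: "finite A" and xA: "x \<in> A" using R1 by (auto simp: A_def)
      have hyp: "diag_bounded K m" using less.IH by (simp add: diag_bounded_def)
      define M where "M = (Cp * K) * Ch * (L0 * real \<Lambda>) powr a / tvol x (2 * m)"
      have dg: "diag UNIV (t div 2) v \<le> (Cp * K) / tvol v t" if "m \<le> t" "t < 2 * m" for t v
        using that m2 K by (intro Cp(2)[OF hyp]) auto
      have hkM: "hk UNIV t v x \<le> M" if t: "m \<le> t" "t < 2 * m" and v: "real (gdist x v) < 4 * R" for t v
        unfolding M_def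
      proof (rule Ch(3)[OF _ _ _ _ v _ _ _ dg[OF t] dg[OF t]])
        have L: "2 * 1 \<le> L0 * real \<Lambda>" using L0 \<Lambda> by (intro mult_mono) auto
        then show "1 \<le> L0 * real \<Lambda>" by simp
        have "2 * real m \<le> 2 * real t" using t by simp
        also have "\<dots> \<le> L0 * real \<Lambda> * real t" using L by (intro mult_right_mono) auto
        finally show "real (2 * m) \<le> L0 * real \<Lambda> * real t" by simp
        have "mean_exit x (4 * R) \<le> T\<^sup>2 * mean_exit x R" using mean_exit_pow2[of R x 2] R1 by simp
        also have "\<dots> \<le> T\<^sup>2 * (inv_exit_const * (real \<Lambda> * (2 * real m)))" using ER by (intro mult_left_mono) auto
        also have "\<dots> \<le> T\<^sup>2 * (inv_exit_const * (real \<Lambda> * (2 * real t)))"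
          using t inv_exit_const_ge_1 by (intro mult_left_mono) auto
        finally show "mean_exit x (4 * R) \<le> L0 * real \<Lambda> * real t" by (simp add: L0_def mult_ac)
      qed (use m2 t K Cp(1) R1 in auto)
      have M0: "0 \<le> M" using K Cp(1) Ch(1) W by (simp add: M_def)
      let ?f = "\<lambda>z. hk UNIV m z x"
      have dec: "kpow UNIV m ?f x - kpow A m ?f x \<le> M * (1 - surv A m x)"
      proof (rule exit_decomposition)
        fix k y z assume *: "k < m" "y \<in> A" "z \<in> nb y"
        have "real (gdist x z) < R + 1"
          using gdist_nb_le[OF *(3), of x] *(2) by (auto simp: A_def gball_def)
        then show "kpow UNIV k ?f z \<le> M"
          unfolding hk_add_op[symmetric] using * R1 by (intro hkM) auto
      qed (use xA in auto)
      have tail: "1 - surv A m x \<le> Ct * exp (- ct * real \<Lambda> powr g)"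
      proof -
        have "real \<Lambda> * real m \<le> real \<Lambda> * (2 * real m)" by (intro mult_left_mono) auto
        also have "\<dots> \<le> mean_exit x R" by (rule ER(1))
        finally have "real \<Lambda> \<le> mean_exit x R / real m" using m2 by (simp add: field_simps)
        then have "real \<Lambda> powr g \<le> (mean_exit x R / real m) powr g" using g by (intro powr_mono2) auto
        then have "Ct * exp (- ct * (mean_exit x R / real m) powr g) \<le> Ct * exp (- ct * real \<Lambda> powr g)"
          using Ct by auto
        moreover have "1 - surv A m x \<le> Ct * exp (- ct * (mean_exit x R / real m) powr g)"
          unfolding A_def g_def using R1 m2 by (intro Ct) auto
        ultimately show ?thesis by linarith
      qed
      \<comment> \<open>This is \<open>p\<^sup>2 - q\<^sup>2 \<le> 2 p (p - q)\<close>, integrated; here \<open>p\<close> is the free and \<open>q\<close> the killed kernel.\<close>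
      have sq: "diag UNIV m x - diag A m x \<le> 2 * (kpow UNIV m ?f x - kpow A m ?f x)"
      proof -
        define S where "S = {z. gdist x z \<le> m} \<union> A"
        have S: "finite S" "{z. gdist x z \<le> m} \<subseteq> S" "A \<subseteq> S" using fA by (auto simp: S_def finite_cball)
        let ?p = "hk UNIV m x" and ?q = "hk A m x"
        have "diag UNIV m x = (\<Sum>z\<in>S. ?p z * ?p z * mu z)"
          unfolding diag_def mult_2 hk_add[OF S(1,2), of UNIV m x]
          by (intro sum.cong) (simp_all add: hk_sym[of UNIV m _ x])
        moreover have "diag A m x = (\<Sum>z\<in>S. ?q z * ?q z * mu z)"
          unfolding diag_def mult_2 hk_add[OF S(1,2), of A m x]
          by (intro sum.cong) (simp_all add: hk_sym[of A m _ x])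
        moreover have "kpow UNIV m ?f x = (\<Sum>z\<in>S. ?p z * ?p z * mu z)"
          unfolding hk_add_op[symmetric] using calculation(1) by (simp add: diag_def mult_2)
        moreover have "kpow A m ?f x = (\<Sum>z\<in>S. ?q z * ?p z * mu z)"
        proof -
          have "kpow A m ?f x = kpow A m (\<lambda>z. if z \<in> A then ?f z else 0) x"
            by (rule kpow_cong) (use xA in auto)
          also have "\<dots> = (\<Sum>z\<in>A. killed_prob A m x z * (if z \<in> A then ?f z else 0))"
            by (rule kpow_kernel) (use fA in auto)
          also have "\<dots> = (\<Sum>z\<in>A. ?q z * ?p z * mu z)"
            by (intro sum.cong) (simp_all add: hk_def[of A] hk_sym[of UNIV m _ x])
          also have "\<dots> = (\<Sum>z\<in>S. ?q z * ?p z * mu z)"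
            by (rule sum.mono_neutral_left) (use S in \<open>auto simp: hk_outside\<close>)
          finally show ?thesis .
        qed
        ultimately have "2 * (kpow UNIV m ?f x - kpow A m ?f x) - (diag UNIV m x - diag A m x)
            = (\<Sum>z\<in>S. (?p z - ?q z)\<^sup>2 * mu z)"
          by (simp add: sum_subtractf[symmetric] sum_distrib_left power2_eq_square algebra_simps sum.distrib[symmetric])
        then show ?thesis
          using sum_nonneg[of S "\<lambda>z. (?p z - ?q z)\<^sup>2 * mu z"] by simp
      qed
      have "diag UNIV m x \<le> diag A m x + 2 * (M * (Ct * exp (- ct * real \<Lambda> powr g)))"
      proof -
        have "kpow UNIV m ?f x - kpow A m ?f x \<le> M * (Ct * exp (- ct * real \<Lambda> powr g))"
          using dec mult_left_mono[OF tail M0] by (rule order_trans)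
        then have "2 * (kpow UNIV m ?f x - kpow A m ?f x) \<le> 2 * (M * (Ct * exp (- ct * real \<Lambda> powr g)))"
          by (rule mult_left_mono) simp
        from order_trans[OF sq this] show ?thesis by (simp only: diff_le_eq add.commute)
      qed
      also have "2 * (M * (Ct * exp (- ct * real \<Lambda> powr g)))
          = K * B * (real \<Lambda> powr a * exp (- ct * real \<Lambda> powr g)) / tvol x (2 * m)"
        using L0 by (simp add: M_def B_def powr_mult mult_ac)
      also have "\<dots> \<le> K * B * (1 / (4 * B)) / tvol x (2 * m)"
        using \<Lambda> K B W by (intro divide_right_mono mult_left_mono) auto
      also have "\<dots> = K / 4 / tvol x (2 * m)" using B by simp
      also have "diag A m x \<le> (1 / 4 * K + C) / tvol x (2 * m)"
        unfolding A_def R_def using m2 K hyp by (intro C)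
      finally have "diag UNIV m x \<le> (K / 2 + C) / tvol x (2 * m)" by (simp add: add_divide_distrib)
      also have "\<dots> \<le> K / tvol x (2 * m)" using K W by (intro divide_right_mono) auto
      finally show ?thesis by simp
    qed
  qed
  have "heat_kernel n x x \<le> (Cp * K) / tvol x n" if n: "0 < n" for x n
  proof (cases "n = 1")
    case True
    have "hk UNIV 1 x x \<le> 1 / vol x 1" using hk_le_mu[of UNIV 1 x x] by (simp add: vol_unit)
    also have "\<dots> \<le> 1 / tvol x 1"
      using tvol_small[of 1 x] tvol_pos[of 1 x] by (intro divide_left_mono) auto
    also have "\<dots> \<le> (Cp * K) / tvol x 1"
      using tvol_pos[of 1 x] mult_mono[of 1 Cp 1 K] Cp(1) K D_ge_1 by (intro divide_right_mono) auto
    finally show ?thesis using True by (simp add: heat_kernel_eq)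
  next
    case False
    then have n2: "2 \<le> n" using n by simp
    have "diag_bounded K n" using main by (simp add: diag_bounded_def)
    then have "diag UNIV (n div 2) x \<le> (Cp * K) / tvol x n" using n2 K by (intro Cp(2)) auto
    then show ?thesis unfolding heat_kernel_eq by (intro hk_le_diag)
  qed
  moreover have "0 < Cp * K" using Cp(1) K D_ge_1 by simp
  ultimately show ?thesis unfolding local_diagonal_upper_estimate_def tvol_def by blast
qed

lemma mean_exit_ge_1: "0 < R \<Longrightarrow> 1 \<le> mean_exit x R"
proof -
  assume "0 < R"
  then have "(\<Sum>n<1. surv (gball x R) n x) = 1" by (simp add: surv_0)
  moreover have "(\<Sum>n<1. surv (gball x R) n x) \<le> mean_exit x R"
    unfolding mean_exit_eq mexit_def by (intro sum_le_suminf summable_surv) auto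
  ultimately show ?thesis by simp
qed

lemma surv_eq_sum_hk: "finite A \<Longrightarrow> surv A n y = (\<Sum>z\<in>A. hk A n y z * mu z)"
  by (simp add: surv_kernel hk_def)

lemma vol_le_tvol:
  "\<exists>C\<ge>1. \<exists>a\<ge>0. \<forall>x R n L. 0 < R \<longrightarrow> 0 < n \<longrightarrow> 1 \<le> L \<longrightarrow> mean_exit x R \<le> L * real n \<longrightarrow>
      vol x R \<le> C * L powr a * tvol x n"
proof -
  obtain C a where C: "C \<ge> 1" "a \<ge> 0"
    "\<And>x z r k L. 0 < r \<Longrightarrow> 0 < k \<Longrightarrow> 1 \<le> L \<Longrightarrow> real (gdist x z) < r \<Longrightarrow>
      mean_exit x r \<le> L * real k \<Longrightarrow> vol x r \<le> C * L powr a * vol z (real (inv_exit z k))"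
    using vol_le_vol_inv_exit by metis
  show ?thesis
    unfolding tvol_def using C(1,2)
    by (intro exI[of _ C] exI[of _ a] conjI allI impI C(3)) auto
qed

lemma hk_ball_bound:
  assumes local_diagonal_upper_estimate "0 < \<delta>"
  shows "\<exists>C\<ge>1. \<forall>x R y z k. 0 < R \<longrightarrow> y \<in> gball x R \<longrightarrow> z \<in> gball x R \<longrightarrow> \<delta> * mean_exit x R \<le> real k \<longrightarrow>
      hk UNIV k y z \<le> C / vol x R"
proof -
  obtain Ch a where Ch: "Ch \<ge> 1" "a \<ge> 0" "\<And>x y z n k L \<rho>. 0 < n \<Longrightarrow> 0 < k \<Longrightarrow> 1 \<le> L \<Longrightarrow>
      real (gdist x y) < \<rho> \<Longrightarrow> real (gdist x z) < \<rho> \<Longrightarrow>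
      real n \<le> L * real k \<Longrightarrow> mean_exit x \<rho> \<le> L * real k \<Longrightarrow>
      hk UNIV k y z \<le> Ch * L powr a / tvol x n"
    using hk_from_diagonal_estimate[OF assms(1)] by metis
  obtain Cv av where Cv: "Cv \<ge> 1" "av \<ge> 0"
    "\<And>x R n L. 0 < R \<Longrightarrow> 0 < n \<Longrightarrow> 1 \<le> L \<Longrightarrow> mean_exit x R \<le> L * real n \<Longrightarrow>
      vol x R \<le> Cv * L powr av * tvol x n"
    using vol_le_tvol by metis
  define L where "L = max 1 (2 / \<delta>)"
  have L: "1 \<le> L" by (simp add: L_def)
  define C where "C = Ch * L powr a * Cv"
  have C: "1 \<le> C"
    using mult_mono[OF mult_mono[of 1 Ch 1 "L powr a"], of 1 Cv] Ch(1,2) Cv(1) L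
    by (simp add: C_def ge_one_powr_ge_zero)
  have "hk UNIV k y z \<le> C / vol x R"
    if R: "0 < R" and yz: "y \<in> gball x R" "z \<in> gball x R" and k: "\<delta> * mean_exit x R \<le> real k" for x R y z k
  proof -
    define E where "E = mean_exit x R"
    define n where "n = nat \<lceil>E\<rceil>"
    have E: "1 \<le> E" using mean_exit_ge_1[OF R] by (simp add: E_def)
    have n: "0 < n" "E \<le> real n" "real n \<le> 2 * E" unfolding n_def using E by linarith+
    have k0: "0 < k" using k R mean_exit_pos[OF R, of x] assms(2) by (cases k) (auto simp: mult_le_0_iff)
    have "2 * E \<le> (2 / \<delta>) * real k" using k assms(2) by (simp add: E_def field_simps)
    also have "\<dots> \<le> L * real k" by (intro mult_right_mono) (auto simp: L_def)
    finally have Lk: "2 * E \<le> L * real k" .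
    have "hk UNIV k y z \<le> Ch * L powr a / tvol x n"
    proof (rule Ch(3)[OF n(1) k0 L])
      show "real n \<le> L * real k" using Lk n by linarith
      show "mean_exit x R \<le> L * real k" using Lk E unfolding E_def[symmetric] by linarith
    qed (use yz in \<open>auto simp: gball_def\<close>)
    also have "\<dots> \<le> C / vol x R"
    proof -
      have "vol x R \<le> Cv * 1 powr av * tvol x n" using R n by (intro Cv(3)) (auto simp: E_def)
      then have "Ch * L powr a * vol x R \<le> Ch * L powr a * (Cv * tvol x n)"
        using Ch(1) by (intro mult_left_mono) auto
      then show ?thesis
        using vol_pos[OF R, of x] tvol_pos[OF n(1), of x] by (simp add: C_def field_simps)
    qed
    finally show ?thesis .
  qed
  then show ?thesis using C by blast
qed

section \<open>The parabolic mean value inequality\<close>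

lemma dirichlet_solution_kpow:
  assumes "nonneg_dirichlet_solution B n u" "i + k \<le> n"
  shows "u (i + k) = kpow B k (u i)"
  using assms(2)
proof (induction k)
  case (Suc k)
  then have lt: "i + k < n" and IH: "u (i + k) = kpow B k (u i)" by simp_all
  have "killed_op B (u (i + k)) = u (Suc (i + k))"
    using assms(1) lt unfolding nonneg_dirichlet_solution_def by blast
  then show ?case by (simp add: IH)
qed simp

lemma dirichlet_solution_bound:
  assumes sol: "nonneg_dirichlet_solution B n u" and B: "finite B" and "i \<le> n" "x \<in> B"
    and M: "\<And>y. y \<in> B \<Longrightarrow> hk B (n - i) x y \<le> M"
  shows "u n x \<le> M * (\<Sum>y\<in>B. u i y * mu y)"
proof -
  have nn: "0 \<le> u i y" and out: "y \<notin> B \<Longrightarrow> u i y = 0" for y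
    using sol \<open>i \<le> n\<close> by (auto simp: nonneg_dirichlet_solution_def)
  have "u n x = kpow B (n - i) (u i) x"
    using dirichlet_solution_kpow[OF sol, of i "n - i"] \<open>i \<le> n\<close> by simp
  also have "\<dots> = (\<Sum>y\<in>B. killed_prob B (n - i) x y * u i y)"
    by (rule kpow_kernel) (use B out in auto)
  also have "\<dots> = (\<Sum>y\<in>B. hk B (n - i) x y * (u i y * mu y))" by (simp add: hk_def)
  also have "\<dots> \<le> (\<Sum>y\<in>B. M * (u i y * mu y))"
    using M nn by (intro sum_mono mult_right_mono) auto
  finally show ?thesis by (simp add: sum_distrib_left)
qed

text \<open>Average over the first part of the time interval: from there on, enough time is left for the
  diagonal estimate to apply. When the exit time is bounded, the ball is, and the value at the centre alone
  is enough.\<close>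

lemma diagonal_imp_parabolic:
  assumes due: local_diagonal_upper_estimate and c: "0 \<le> c1" "c1 < c2"
  shows "parabolic_mean_value_inequality c1 c2"
proof -
  define \<delta> where "\<delta> = c2 - c1"
  have \<delta>: "0 < \<delta>" using c by (simp add: \<delta>_def)
  obtain Ch where Ch: "Ch \<ge> 1" "\<And>x R y z k. 0 < R \<Longrightarrow> y \<in> gball x R \<Longrightarrow> z \<in> gball x R \<Longrightarrow>
      \<delta> / 2 * mean_exit x R \<le> real k \<Longrightarrow> hk UNIV k y z \<le> Ch / vol x R"
    using hk_ball_bound[OF due, of "\<delta> / 2"] \<delta> by (auto simp del: times_divide_eq_left)
  define E0 where "E0 = 4 / \<delta>"
  have E0: "0 < E0" using \<delta> by (simp add: E0_def)
  obtain Cd where Cd: "Cd \<ge> 1" "\<And>x r. 0 < r \<Longrightarrow> vol x (E0 * r) \<le> Cd * vol x r"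
    using vol_dilate[of E0] by blast
  define C where "C = 1 + max (Cd * E0) (Ch * 4 / \<delta>)"
  have C: "1 < C" "Cd * E0 \<le> C" "Ch * 4 / \<delta> \<le> C" 
  proof -
    have "0 < Cd * E0" using Cd(1) E0 by simp
    then show "1 < C" by (simp add: C_def less_max_iff_disj)
  qed (simp_all add: C_def max_def)
  have main: "u n x \<le> C / (vol x R * E) * (\<Sum>i=m..n. \<Sum>\<^sub>\<infinity>y\<in>B. u i y * mu y)"
    if R: "0 < R" and E_def: "E = mean_exit x R" and B_def: "B = gball x R"
      and m_def: "m = nat \<lfloor>c1 * E\<rfloor>" and n_def: "n = nat \<lfloor>c2 * E\<rfloor>"
      and sol: "nonneg_dirichlet_solution B n u" for x R E B m n u
  proof -
    have E: "1 \<le> E" "R \<le> E" using mean_exit_ge_1[OF R] mean_exit_ge[of R x] by (auto simp: E_def)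
    have V: "0 < vol x R" using R by (rule vol_pos)
    have xB: "x \<in> B" and fB: "finite B" using R by (auto simp: B_def)
    define S where "S i = (\<Sum>y\<in>B. u i y * mu y)" for i
    have S0: "0 \<le> S i" if "i \<le> n" for i
      unfolding S_def using sol that
      by (intro sum_nonneg mult_nonneg_nonneg) (auto simp: nonneg_dirichlet_solution_def)
    have c1E: "0 \<le> c1 * E" and c12: "c1 * E \<le> c2 * E" using c E by auto
    have mn: "m \<le> n" unfolding m_def n_def using c12 by (intro nat_mono floor_mono)
    have eq: "(\<Sum>i=m..n. \<Sum>\<^sub>\<infinity>y\<in>B. u i y * mu y) = sum S {m..n}"
      by (simp add: S_def infsum_finite fB)
    have S_nonneg: "0 \<le> sum S {m..n}" by (intro sum_nonneg S0) auto
    have "u n x * (vol x R * E) \<le> C * sum S {m..n}"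
    proof (cases "E < E0")
      case True
      have "vol x R \<le> vol x (E0 * 1)" using True E by (intro vol_mono) auto
      also have "\<dots> \<le> Cd * vol x 1" by (rule Cd) simp
      finally have vR: "vol x R \<le> Cd * mu x" by (simp add: vol_unit)
      have "u n x * mu x \<le> S n"
        unfolding S_def using xB fB sol
        by (intro member_le_sum) (auto simp: nonneg_dirichlet_solution_def)
      also have "\<dots> \<le> sum S {m..n}" using mn S0 by (intro member_le_sum) auto
      finally have uS: "u n x * mu x \<le> sum S {m..n}" .
      have u0: "0 \<le> u n x" using sol by (simp add: nonneg_dirichlet_solution_def)
      have "u n x * (vol x R * E) \<le> u n x * ((Cd * mu x) * E0)"
        using vR True E V u0 Cd(1) by (intro mult_left_mono mult_mono) auto
      also have "\<dots> = (Cd * E0) * (u n x * mu x)" by simp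
      also have "\<dots> \<le> C * sum S {m..n}"
        using C uS u0 S_nonneg E0 Cd(1) by (intro mult_mono) auto
      finally show ?thesis .
    next
      case False
      then have dE: "4 \<le> \<delta> * E" using \<delta> by (simp add: E0_def field_simps)
      define q where "q = nat \<lfloor>\<delta> * E / 4\<rfloor>"
      have q: "real q \<le> \<delta> * E / 4" "\<delta> * E / 4 < real q + 1" unfolding q_def using dE by linarith+
      have mr: "real m \<le> c1 * E" unfolding m_def using c1E by linarith
      have nr: "c2 * E < real n + 1" unfolding n_def using c1E c12 by linarith
      have cc: "c2 * E = c1 * E + \<delta> * E" by (simp add: \<delta>_def algebra_simps)
      have mq: "m + q \<le> n"
      proof -
        have "real m + real q \<le> real n" using mr nr cc q dE by linarith
        then show ?thesis by linarith
      qed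
      have each: "u n x \<le> Ch / vol x R * S i" if i: "i \<in> {m..m + q}" for i
        unfolding S_def
      proof (rule dirichlet_solution_bound[OF sol fB _ xB])
        show "i \<le> n" using i mq by auto
        fix y assume "y \<in> B"
        have "real i \<le> real m + real q" using i by auto
        moreover have "real (n - i) = real n - real i" using i mq by auto
        ultimately have "\<delta> / 2 * E \<le> real (n - i)" using mr nr cc q dE by linarith
        then have "hk UNIV (n - i) x y \<le> Ch / vol x R"
          using R \<open>y \<in> B\<close> by (intro Ch) (auto simp: E_def B_def)
        then show "hk B (n - i) x y \<le> Ch / vol x R"
          using hk_set_mono[of B UNIV "n - i" x y] by simp
      qed
      have u0: "0 \<le> u n x" using sol by (simp add: nonneg_dirichlet_solution_def)
      have "\<delta> * E / 4 * u n x \<le> real (card {m..m + q}) * u n x"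
        using q u0 by (intro mult_right_mono) auto
      also have "\<dots> = (\<Sum>i\<in>{m..m + q}. u n x)" by simp
      also have "\<dots> \<le> (\<Sum>i\<in>{m..m + q}. Ch / vol x R * S i)" by (rule sum_mono) (rule each)
      also have "\<dots> = Ch / vol x R * sum S {m..m + q}" by (simp add: sum_distrib_left)
      also have "\<dots> \<le> Ch / vol x R * sum S {m..n}"
        using mq S0 Ch(1) V by (intro mult_left_mono sum_mono2) auto
      finally have "u n x * (vol x R * E) \<le> (Ch * 4 / \<delta>) * sum S {m..n}"
        using V \<delta> by (simp add: field_simps)
      also have "\<dots> \<le> C * sum S {m..n}" using C S_nonneg by (intro mult_right_mono) auto
      finally show ?thesis .
    qed
    then show ?thesis unfolding eq using V E by (simp add: field_simps)
  qed
  show ?thesis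
    unfolding parabolic_mean_value_inequality_def Let_def
    using C(1) main by (intro exI[of _ C]) auto
qed

lemma dirichlet_solution_hk: "nonneg_dirichlet_solution B n (\<lambda>i z. hk B i z y)"
  unfolding nonneg_dirichlet_solution_def
proof (intro conjI allI impI)
  fix i assume "i < n"
  show "killed_op B (\<lambda>z. hk B i z y) = (\<lambda>z. hk B (Suc i) z y)"
    using hk_add_op[of B 1 i _ y] by auto
qed (auto simp: hk_outside)

text \<open>Applied to the killed heat kernel, the parabolic inequality bounds the latter at a late time, a
  multiple \<open>c2\<close> of the exit time. The killed walk may have lost most of its mass by then, so this does not
  bound the free kernel directly; but logarithmic convexity in time transports part of the gain to
  earlier times, and this is enough for the bootstrap.\<close>

lemma parabolic_imp_diagonal:
  assumes pmv: "parabolic_mean_value_inequality c1 c2" and c: "0 \<le> c1" "c1 < c2"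
  shows local_diagonal_upper_estimate
proof (rule bootstrap)
  obtain C3 where C3: "C3 > 1" "\<And>x R u. 0 < R \<Longrightarrow>
      nonneg_dirichlet_solution (gball x R) (nat \<lfloor>c2 * mean_exit x R\<rfloor>) u \<Longrightarrow>
      u (nat \<lfloor>c2 * mean_exit x R\<rfloor>) x \<le> C3 / (vol x R * mean_exit x R) *
        (\<Sum>i=nat \<lfloor>c1 * mean_exit x R\<rfloor>..nat \<lfloor>c2 * mean_exit x R\<rfloor>. \<Sum>\<^sub>\<infinity>y\<in>gball x R. u i y * mu y)"
    using pmv unfolding parabolic_mean_value_inequality_def Let_def by blast
  define C4 where "C4 = C3 * (c2 + 1)"
  have C4: "0 < C4" using C3(1) c by (simp add: C4_def)
  have late: "hk (gball x R) k x x \<le> C4 / vol x R"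
    if R: "0 < R" and k: "c2 * mean_exit x R \<le> real k" for x R k
  proof -
    define B E n m where "B = gball x R" and "E = mean_exit x R"
      and "n = nat \<lfloor>c2 * E\<rfloor>" and "m = nat \<lfloor>c1 * E\<rfloor>"
    have E: "1 \<le> E" using mean_exit_ge_1[OF R] by (simp add: E_def)
    have V: "0 < vol x R" using R by (rule vol_pos)
    have fB: "finite B" by (simp add: B_def)
    have c2E: "0 \<le> c2 * E" using c E by simp
    have nE: "real n \<le> c2 * E" unfolding n_def using c2E by linarith
    have at_n: "hk B n x y \<le> C4 / vol x R" for y
    proof -
      have "hk B n x y \<le> C3 / (vol x R * E) * (\<Sum>i=m..n. \<Sum>\<^sub>\<infinity>z\<in>B. hk B i z y * mu z)"
        unfolding B_def E_def n_def m_def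
        by (rule C3(2)[OF R, of x "\<lambda>i z. hk (gball x R) i z y"]) (rule dirichlet_solution_hk)
      also have "\<dots> \<le> C3 / (vol x R * E) * (\<Sum>i=m..n. 1)"
      proof (intro mult_left_mono sum_mono)
        fix i
        have "(\<Sum>\<^sub>\<infinity>z\<in>B. hk B i z y * mu z) = surv B i y"
          by (simp add: infsum_finite fB surv_eq_sum_hk hk_sym[of B i y])
        then show "(\<Sum>\<^sub>\<infinity>z\<in>B. hk B i z y * mu z) \<le> 1" by simp
      qed (use C3(1) V E in auto)
      also have "\<dots> \<le> C3 / (vol x R * E) * ((c2 + 1) * E)"
      proof (rule mult_left_mono)
        have "(\<Sum>i=m..n. 1 :: real) \<le> real n + 1" by simp
        also have "\<dots> \<le> (c2 + 1) * E" using nE E by (simp add: algebra_simps)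
        finally show "(\<Sum>i=m..n. 1 :: real) \<le> (c2 + 1) * E" .
      qed (use C3(1) V E in auto)
      also have "\<dots> = C4 / vol x R" using E by (simp add: C4_def)
      finally show ?thesis .
    qed
    have "n \<le> k" using nE k by (simp add: E_def)
    then have "hk B k x x = kpow B (k - n) (\<lambda>z. hk B n z x) x"
      using hk_add_op[of B "k - n" n x x] by simp
    also have "\<dots> \<le> C4 / vol x R"
    proof (rule kpow_le_const)
      show "hk B n z x \<le> C4 / vol x R" for z using at_n by (subst hk_sym)
    qed (use C4 V R in \<open>auto simp: B_def\<close>)
    finally show ?thesis by (simp add: B_def)
  qed
  obtain Cw a where Cw: "Cw \<ge> 1" "a \<ge> 0"
    "\<And>x z n k L \<rho>. 0 < n \<Longrightarrow> 0 < k \<Longrightarrow> 1 \<le> L \<Longrightarrow> real (gdist x z) < \<rho> \<Longrightarrow> real n \<le> L * real k \<Longrightarrow>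
      mean_exit x \<rho> \<le> L * real k \<Longrightarrow> tvol x n \<le> Cw * L powr a * tvol z k"
    using tvol_compare by metis
  define C5 where "C5 = Cw * (3 * inv_exit_const) powr a"
  have C5: "0 < C5" using Cw(1) inv_exit_const_ge_1 by (simp add: C5_def)
  fix \<Lambda> :: nat and \<epsilon> :: real assume \<Lambda>: "1 \<le> \<Lambda>" and \<epsilon>: "0 < \<epsilon>"
  \<comment> \<open>After \<open>l\<close> doublings of a time step of order \<open>m\<close>, the time \<open>c2 E\<close> has been passed.\<close>
  obtain l where l: "2 * c2 * inv_exit_const * real \<Lambda> \<le> 2 ^ l" using pow2_exceeds by blast
  have "0 < \<epsilon> / C5" using \<epsilon> C5 by simp
  from diag_interpolation[OF this, of l] obtain Ci where Ci: "Ci > 0"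
    "\<And>A i h x. diag A (i + h) x \<le> \<epsilon> / C5 * diag A i x + Ci * diag A (i + 2 ^ l * h) x" by blast
  have "diag (gball x (real (inv_exit x (\<Lambda> * (2 * m))))) m x \<le> (\<epsilon> * K + Ci * C4) / tvol x (2 * m)"
    if m: "2 \<le> m" and K: "0 \<le> K"
      and hyp: "diag_bounded K m" for x m K
  proof -
    define R where "R = real (inv_exit x (\<Lambda> * (2 * m)))"
    define B where "B = gball x R"
    define i where "i = m div 2"
    define h where "h = m - i"
    have i: "1 \<le> i" "i < m" "m \<le> 3 * i" "i + h = m" "m \<le> 2 * h"
      using m unfolding i_def h_def by linarith+
    have R: "1 \<le> R" and ER: "mean_exit x R \<le> inv_exit_const * (real \<Lambda> * (2 * real m))"
      and VW: "tvol x (2 * m) \<le> vol x R"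
      using inv_exit_dilate[OF \<Lambda>, of "2 * m" x] m by (simp_all add: R_def)
    have W: "0 < tvol x (2 * m)" "0 < tvol x (2 * i)" using m i by (auto intro!: tvol_pos)
    have first: "\<epsilon> / C5 * diag B i x \<le> \<epsilon> * K / tvol x (2 * m)"
    proof -
      have "tvol x (2 * m) \<le> C5 * tvol x (2 * i)"
        unfolding C5_def
      proof (rule Cw(3)[where \<rho> = 1])
        have "real (2 * m) \<le> 3 * real (2 * i)" using i(3) by linarith
        also have "\<dots> \<le> 3 * inv_exit_const * real (2 * i)" using inv_exit_const_ge_1 by (intro mult_right_mono) auto
        finally show "real (2 * m) \<le> 3 * inv_exit_const * real (2 * i)" .
        have "mean_exit x 1 \<le> 1 / p0" by (rule mean_exit_1_le)
        also have "\<dots> \<le> 3 * inv_exit_const * 1" using inv_exit_const_ge_1 by (simp add: inv_exit_const_def)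
        also have "\<dots> \<le> 3 * inv_exit_const * real (2 * i)"
          using i inv_exit_const_ge_1 by (intro mult_left_mono) auto
        finally show "mean_exit x 1 \<le> 3 * inv_exit_const * real (2 * i)" .
      qed (use i m inv_exit_const_ge_1 in auto)
      then have "K * tvol x (2 * m) \<le> K * (C5 * tvol x (2 * i))" using K by (rule mult_left_mono)
      then have "K / tvol x (2 * i) \<le> C5 * (K / tvol x (2 * m))" using W by (simp add: field_simps)
      moreover have "diag B i x \<le> diag UNIV i x" unfolding diag_def by (rule hk_set_mono) simp
      moreover have "diag UNIV i x \<le> K / tvol x (2 * i)" using hyp i unfolding diag_bounded_def by blast
      ultimately have "diag B i x \<le> C5 * (K / tvol x (2 * m))" by linarith
      then have "\<epsilon> / C5 * diag B i x \<le> \<epsilon> / C5 * (C5 * (K / tvol x (2 * m)))"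
        using \<epsilon> C5 by (intro mult_left_mono) auto
      then show ?thesis using C5 by simp
    qed
    have second: "diag B (i + 2 ^ l * h) x \<le> C4 / tvol x (2 * m)"
    proof -
      have "c2 * mean_exit x R \<le> c2 * (inv_exit_const * (real \<Lambda> * (2 * real m)))"
        using ER c by (intro mult_left_mono) auto
      also have "\<dots> = (2 * c2 * inv_exit_const * real \<Lambda>) * real m" by simp
      also have "\<dots> \<le> 2 ^ l * (2 * real h)" using l i(5) by (intro mult_mono) auto
      also have "\<dots> \<le> real (2 * (i + 2 ^ l * h))" by simp
      finally have "diag B (i + 2 ^ l * h) x \<le> C4 / vol x R"
        unfolding diag_def B_def using R by (intro late) auto
      also have "\<dots> \<le> C4 / tvol x (2 * m)" using VW W C4 vol_pos[of R x] R by (intro divide_left_mono) auto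
      finally show ?thesis .
    qed
    have "diag B m x \<le> \<epsilon> / C5 * diag B i x + Ci * diag B (i + 2 ^ l * h) x"
      using Ci(2)[of B i h x] i by simp
    also have "\<dots> \<le> \<epsilon> * K / tvol x (2 * m) + Ci * (C4 / tvol x (2 * m))"
      using first second Ci(1) by (intro add_mono mult_left_mono) auto
    finally show ?thesis by (simp add: B_def R_def add_divide_distrib)
  qed
  then show "\<exists>C. \<forall>x m K. 2 \<le> m \<longrightarrow> 0 \<le> K \<longrightarrow> diag_bounded K m \<longrightarrow>
      diag (gball x (real (inv_exit x (\<Lambda> * (2 * m))))) m x \<le> (\<epsilon> * K + C) / tvol x (2 * m)"
    by blast
qed

section \<open>Mean value inequalities for harmonic functions and Green kernels\<close>

lemma harmonic_on_iff: "harmonic_on A h \<longleftrightarrow> (\<forall>x\<in>A. (\<Sum>y\<in>nb x. trans_prob x y * h y) = h x)"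
proof -
  have "(\<Sum>\<^sub>\<infinity>y\<in>{y. adj x y}. trans_prob x y * h y) = (\<Sum>y\<in>nb x. trans_prob x y * h y)" for x
    unfolding nb_def[symmetric] by (rule infsum_finite) simp
  then show ?thesis by (simp add: harmonic_on_def)
qed

lemma gclosure_eq: "gclosure A = A \<union> (\<Union>x\<in>A. nb x)"
  by (auto simp: gclosure_def nb_def)

lemma green_step:
  assumes B: "finite B" and z: "z \<in> B" "z \<noteq> y"
  shows "(\<Sum>v\<in>nb z. trans_prob z v * green B v y) = green B z y"
proof (cases "y \<in> B")
  case True
  have eq: "green B v y = (1 / mu y) * green_op B (indicator {y}) v" for v
    using green_eq_green_op[OF B True, of v] by simp
  have out: "green_op B (indicator {y}) v = 0" if "v \<notin> B" for v
    using green_outside[of v B y] that eq[of v] by simp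
  have "indicator {y} v = (0 :: real)" if "v \<notin> B" for v using True that by (auto simp: indicator_def)
  from green_op_step[OF B this, where x = z]
  have "green_op B (indicator {y}) z = killed_op B (green_op B (indicator {y})) z"
    using z by simp
  also have "\<dots> = (\<Sum>v\<in>nb z. trans_prob z v * green_op B (indicator {y}) v)"
    by (rule killed_op_vanishing) (use z out in auto)
  finally have step: "green_op B (indicator {y}) z = (\<Sum>v\<in>nb z. trans_prob z v * green_op B (indicator {y}) v)" .
  have "(\<Sum>v\<in>nb z. trans_prob z v * green B v y)
      = (1 / mu y) * (\<Sum>v\<in>nb z. trans_prob z v * green_op B (indicator {y}) v)"
    unfolding sum_distrib_left by (rule sum.cong[OF refl]) (simp add: eq)
  also have "\<dots> = green B z y" by (subst step[symmetric]) (rule eq[symmetric])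
  finally show ?thesis .
next
  case False
  then have "green B v y = 0" for v by (intro green_outside) simp
  then show ?thesis by simp
qed

text \<open>The Green kernel with pole \<open>y\<close> is harmonic in \<open>B(x, d(x, y))\<close>.\<close>

lemma mean_value_imp_green_mean_value:
  assumes mean_value_inequality shows green_mean_value_property
proof -
  obtain C where C: "C > 0" and mvi: "\<forall>x. \<forall>R>0. \<forall>u. (\<forall>y\<in>gclosure (gball x R). 0 \<le> u y) \<longrightarrow>
      harmonic_on (gball x R) u \<longrightarrow> u x \<le> C / vol x R * (\<Sum>\<^sub>\<infinity>y\<in>gball x R. u y * mu y)"
    using assms unfolding mean_value_inequality_def by (elim exE conjE)
  have main: "green (gball x R) y x \<le> (C + 1) / vol x d * (\<Sum>\<^sub>\<infinity>z\<in>gball x d. green (gball x R) y z * mu z)"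
    if R: "0 < R" and d0: "0 < gdist x y" and d: "d = real (gdist x y)" for x y R d
  proof -
    let ?B = "gball x R"
    let ?S = "\<Sum>z\<in>gball x d. green ?B y z * mu z"
    have S: "0 \<le> ?S" by (intro sum_nonneg mult_nonneg_nonneg green_nonneg) auto
    have V: "0 < vol x d" using d0 d by (intro vol_pos) simp
    have "green ?B y x \<le> C / vol x d * ?S"
    proof (cases "y \<in> ?B")
      case True
      then have sub: "gball x d \<subseteq> ?B" using d by (intro gball_mono) (simp add: gball_def)
      have "green ?B x y \<le> C / vol x d * (\<Sum>\<^sub>\<infinity>z\<in>gball x d. green ?B z y * mu z)"
      proof (rule mvi[rule_format])
        show "0 < d" using d0 d by simp
        show "harmonic_on (gball x d) (\<lambda>z. green ?B z y)"
          unfolding harmonic_on_iff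
        proof
          fix z assume z: "z \<in> gball x d"
          then have "z \<noteq> y" using d by (auto simp: gball_def)
          then show "(\<Sum>v\<in>nb z. trans_prob z v * green ?B v y) = green ?B z y"
            using z sub by (intro green_step) auto
        qed
      qed (auto intro: green_nonneg)
      then show ?thesis by (simp add: infsum_finite green_sym[of ?B _ y])
    next
      case False
      then have "green ?B y x = 0" by (intro green_outside) simp
      then show ?thesis using C V S by simp
    qed
    also have "\<dots> \<le> (C + 1) / vol x d * ?S"
      using S V by (intro mult_right_mono divide_right_mono) auto
    finally show ?thesis by (simp add: infsum_finite)
  qed
  show ?thesis
    unfolding green_mean_value_property_def Let_def
    by (intro exI[of _ "C + 1"] conjI allI impI main) (use C in auto)
qed

lemma green_mean_value_imp_green_bound:
  assumes green_mean_value_property shows green_upper_bound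
proof -
  obtain C where C: "C > 1" "\<And>x y R. 0 < R \<Longrightarrow> 0 < gdist x y \<Longrightarrow>
      green (gball x R) y x \<le> C / vol x (real (gdist x y)) *
        (\<Sum>\<^sub>\<infinity>z\<in>gball x (real (gdist x y)). green (gball x R) y z * mu z)"
    using assms unfolding green_mean_value_property_def Let_def by blast
  have main: "green (gball x R) y x \<le> (C * T) * (mean_exit x R / vol x (real (gdist x y)))"
    if R: "0 < R" and d0: "0 < gdist x y" for x y R
  proof -
    let ?B = "gball x R" and ?d = "real (gdist x y)"
    have V: "0 < vol x ?d" using d0 by (intro vol_pos) simp
    show ?thesis
    proof (cases "y \<in> ?B")
      case True
      then have sub: "gball x ?d \<subseteq> ?B" by (intro gball_mono) (simp add: gball_def)
      have "(\<Sum>\<^sub>\<infinity>z\<in>gball x ?d. green ?B y z * mu z) = (\<Sum>z\<in>gball x ?d. green ?B y z * mu z)"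
        by (simp add: infsum_finite)
      also have "\<dots> \<le> (\<Sum>z\<in>?B. green ?B y z * mu z)"
        using sub by (intro sum_mono2) (auto intro!: mult_nonneg_nonneg green_nonneg)
      also have "\<dots> = mexit ?B y" by (simp add: mexit_eq_green)
      also have "\<dots> \<le> T * mean_exit x R" using R True by (intro mexit_ball_le)
      finally have le: "(\<Sum>\<^sub>\<infinity>z\<in>gball x ?d. green ?B y z * mu z) \<le> T * mean_exit x R" .
      have "green ?B y x \<le> C / vol x ?d * (\<Sum>\<^sub>\<infinity>z\<in>gball x ?d. green ?B y z * mu z)" by (rule C(2)[OF R d0])
      also have "\<dots> \<le> C / vol x ?d * (T * mean_exit x R)"
        using le C(1) V by (intro mult_left_mono) auto
      finally show ?thesis by simp
    next
      case False
      then show ?thesis using C(1) V T_gt_1 by (simp add: green_outside)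
    qed
  qed
  have "1 * 1 < C * T" using C(1) T_gt_1 by (intro mult_strict_mono) auto
  then show ?thesis
    unfolding green_upper_bound_def by (intro exI[of _ "C * T"] conjI allI impI main) auto
qed

text \<open>Balayage: a nonnegative function which is harmonic in \<open>B\<close> agrees on \<open>A\<close> with the
  Green potential of a nonnegative charge that sits on the inner boundary of \<open>A\<close>. The potential is the
  limit of the iteration that keeps the values in \<open>A\<close> and averages outside; it is at most \<open>u\<close>.\<close>

lemma balayage:
  assumes B: "finite B" and "A \<subseteq> B"
    and nonneg: "\<And>y. y \<in> gclosure B \<Longrightarrow> 0 \<le> u y" and harm: "harmonic_on B u"
  obtains v f where
    "\<And>y. y \<in> A \<Longrightarrow> v y = u y" "\<And>y. y \<in> B \<Longrightarrow> v y \<le> u y"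
    "\<And>y. v y = green_op B f y" "\<And>y. 0 \<le> f y" "\<And>y. y \<notin> A \<Longrightarrow> f y = 0"
    "\<And>y. nb y \<subseteq> A \<Longrightarrow> f y = 0"
proof -
  \<comment> \<open>\<open>V k y\<close> is the mean of \<open>u\<close> at the first visit to \<open>A\<close>, for the walk from \<open>y\<close> and visits within \<open>k\<close> steps
    and before leaving \<open>B\<close>.\<close>
  define V where "V = rec_nat (\<lambda>y. if y \<in> A then u y else 0)
    (\<lambda>_ v y. if y \<in> A then u y else killed_op B v y)"
  have V0: "V 0 y = (if y \<in> A then u y else 0)" for y by (simp add: V_def)
  have VS: "V (Suc k) y = (if y \<in> A then u y else killed_op B (V k) y)" for k y by (simp add: V_def)
  have u0: "0 \<le> u y" if "y \<in> B" for y using nonneg that by (simp add: gclosure_eq)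
  have uA: "0 \<le> u y" if "y \<in> A" for y using u0 that \<open>A \<subseteq> B\<close> by blast
  have unb: "0 \<le> u y" if "x \<in> B" "y \<in> nb x" for x y using nonneg that by (auto simp: gclosure_eq)
  have uh: "(\<Sum>y\<in>nb x. trans_prob x y * u y) = u x" if "x \<in> B" for x
    using harm that by (simp add: harmonic_on_iff)
  have Pu: "killed_op B u x \<le> u x" if x: "x \<in> B" for x
  proof -
    have "killed_op B u x = (\<Sum>y\<in>nb x \<inter> B. trans_prob x y * u y)" using x by (simp add: killed_op_eq)
    also have "\<dots> \<le> (\<Sum>y\<in>nb x. trans_prob x y * u y)"
      by (rule sum_mono2) (use unb[OF x] in auto)
    finally show ?thesis by (simp add: uh[OF x])
  qed
  have Vnn: "0 \<le> V k y" for k y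
  proof (induction k arbitrary: y)
    case (Suc k)
    have "0 \<le> killed_op B (V k) y" by (rule killed_op_nonneg) (rule Suc)
    then show ?case using uA by (simp add: VS)
  qed (use uA in \<open>simp add: V0\<close>)
  have Vle: "V k y \<le> u y" if "y \<in> B" for k y
    using that
  proof (induction k arbitrary: y)
    case (Suc k)
    have "killed_op B (V k) y \<le> killed_op B u y" by (rule killed_op_mono) (rule Suc.IH)
    then show ?case using Pu[OF Suc.prems] by (simp add: VS)
  qed (simp add: V0 u0)
  have Vinc: "V k y \<le> V (Suc k) y" for k y
  proof (induction k arbitrary: y)
    case 0
    have "0 \<le> killed_op B (V 0) y" by (rule killed_op_nonneg) (rule Vnn)
    then show ?case by (simp add: VS V0[of y])
  next
    case (Suc k)
    show ?case using killed_op_mono[of B "V k" "V (Suc k)" y] Suc by (simp add: VS)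
  qed
  have Vout: "V k y = 0" if "y \<notin> B" for k y
    using that \<open>A \<subseteq> B\<close> by (cases k) (auto simp: V0 VS killed_op_outside)
  have "\<exists>l. (\<lambda>k. V k y) \<longlonglongrightarrow> l" for y
  proof (cases "y \<in> B")
    case True
    have "incseq (\<lambda>k. V k y)" using Vinc by (rule incseq_SucI)
    then show ?thesis using incseq_convergent[of "\<lambda>k. V k y" "u y"] Vle[OF True] by blast
  next
    case False
    then show ?thesis by (simp add: Vout) (use tendsto_const in blast)
  qed
  then obtain v where v: "\<And>y. (\<lambda>k. V k y) \<longlonglongrightarrow> v y" by metis
  have vA: "v y = u y" if "y \<in> A" for y
  proof -
    have "V k y = u y" for k using that by (cases k) (auto simp: V0 VS)
    then show ?thesis using v[of y] LIMSEQ_const_iff[of "u y" "v y"] by simp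
  qed
  have vle: "v y \<le> u y" if "y \<in> B" for y
    by (rule LIMSEQ_le_const2[OF v]) (use Vle[OF that] in auto)
  have vout: "v y = 0" if "y \<notin> B" for y
    using v[of y] LIMSEQ_const_iff[of 0 "v y"] by (simp add: Vout[OF that])
  have vstep: "v y = killed_op B v y" if "y \<notin> A" for y
  proof -
    have "(\<lambda>k. V (Suc k) y) \<longlonglongrightarrow> v y" using v by (rule LIMSEQ_Suc)
    moreover have "(\<lambda>k. V (Suc k) y) \<longlonglongrightarrow> killed_op B v y"
      using that unfolding VS killed_op_eq by (cases "y \<in> B") (auto intro!: tendsto_intros v)
    ultimately show ?thesis by (rule LIMSEQ_unique)
  qed
  define f where "f y = v y - killed_op B v y" for y
  show ?thesis
  proof (rule that[of v f])
    show "v y = green_op B f y" for y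
      unfolding f_def by (rule green_op_unique[OF B vout])
    show fz: "f y = 0" if "y \<notin> A" for y using vstep[OF that] by (simp add: f_def)
    show "0 \<le> f y" for y
    proof (cases "y \<in> A")
      case True
      then have "y \<in> B" using \<open>A \<subseteq> B\<close> by auto
      have "killed_op B v y \<le> killed_op B u y" by (rule killed_op_mono) (rule vle)
      then show ?thesis using Pu[OF \<open>y \<in> B\<close>] vA[OF True] by (simp add: f_def)
    qed (use fz in simp)
    show "f y = 0" if "nb y \<subseteq> A" for y
    proof (cases "y \<in> A")
      case True
      then have "y \<in> B" using \<open>A \<subseteq> B\<close> by auto
      have "killed_op B v y = (\<Sum>z\<in>nb y. trans_prob y z * v z)"
        by (rule killed_op_vanishing) (use \<open>y \<in> B\<close> vout in auto)
      also have "\<dots> = (\<Sum>z\<in>nb y. trans_prob y z * u z)"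
        using that vA by (intro sum.cong) auto
      finally show ?thesis using uh[OF \<open>y \<in> B\<close>] vA[OF True] by (simp add: f_def)
    qed (use fz in simp)
  qed (use vA vle in auto)
qed

text \<open>Represent \<open>u\<close> on \<open>B(x, R/2)\<close> as the potential of a charge \<open>f\<close> at distance about \<open>R/2\<close> from
  \<open>x\<close>. The Green bound compares \<open>u(x)\<close> with the total charge, and the total charge times the exit time is
  comparable to the integral of the potential.\<close>

lemma green_bound_imp_mean_value:
  assumes green_upper_bound shows mean_value_inequality
proof -
  obtain C where C: "C > 1" "\<And>x y R. 0 < R \<Longrightarrow> 0 < gdist x y \<Longrightarrow>
      green (gball x R) y x \<le> C * (mean_exit x R / vol x (real (gdist x y)))"
    using assms unfolding green_upper_bound_def by blast
  define C' where "C' = C * D\<^sup>2 * T"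
  have D2: "1 \<le> D\<^sup>2" using D_ge_1 by simp
  have C': "D\<^sup>2 \<le> C'" "0 < C'"
  proof -
    have "1 * D\<^sup>2 * 1 \<le> C * D\<^sup>2 * T" using C(1) T_gt_1 D2 by (intro mult_mono) auto
    then show "D\<^sup>2 \<le> C'" "0 < C'" using D2 by (auto simp: C'_def)
  qed
  have main: "u x \<le> C' / vol x R * (\<Sum>\<^sub>\<infinity>y\<in>gball x R. u y * mu y)"
    if R: "0 < R" and nonneg: "\<And>y. y \<in> gclosure (gball x R) \<Longrightarrow> 0 \<le> u y"
      and harm: "harmonic_on (gball x R) u" for x R u
  proof -
    define B where "B = gball x R"
    define S where "S = (\<Sum>y\<in>B. u y * mu y)"
    have fB: "finite B" and xB: "x \<in> B" using R by (auto simp: B_def)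
    have u0: "0 \<le> u y" if "y \<in> B" for y using nonneg that by (auto simp: gclosure_eq B_def)
    have V: "0 < vol x R" using R by (rule vol_pos)
    have "u x * vol x R \<le> C' * S"
    proof (cases "R \<le> 4")
      \<comment> \<open>On a small ball the centre alone carries a fixed part of the volume.\<close>
      case True
      have "vol x R \<le> vol x (2 ^ 2 * 1)" using True by (intro vol_mono) auto
      also have "\<dots> \<le> D\<^sup>2 * vol x 1" by (rule vol_pow2) simp
      also have "\<dots> \<le> C' * mu x" using C' by (simp add: vol_unit mult_right_mono)
      finally have "u x * vol x R \<le> u x * (C' * mu x)" using u0[OF xB] by (intro mult_left_mono) auto
      also have "\<dots> = C' * (u x * mu x)" by simp
      also have "\<dots> \<le> C' * S"
        unfolding S_def using C' xB fB u0 by (intro mult_left_mono member_le_sum) auto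
      finally show ?thesis .
    next
      case False
      define A where "A = gball x (R / 2)"
      define E where "E = mean_exit x R"
      have E: "0 < E" using R mean_exit_pos by (simp add: E_def)
      have AB: "A \<subseteq> B" unfolding A_def B_def using R by (intro gball_mono) simp
      have xA: "x \<in> A" using R by (simp add: A_def)
      obtain v f where v: "\<And>y. y \<in> A \<Longrightarrow> v y = u y" "\<And>y. y \<in> B \<Longrightarrow> v y \<le> u y"
        "\<And>y. v y = green_op B f y" "\<And>y. 0 \<le> f y" "\<And>y. y \<notin> A \<Longrightarrow> f y = 0"
        "\<And>y. nb y \<subseteq> A \<Longrightarrow> f y = 0"
        using balayage[OF fB AB, of u] nonneg harm unfolding B_def[symmetric] by metis
      have fB0: "f y = 0" if "y \<notin> B" for y using v(5) AB that by blast
      have v_eq: "v y = (\<Sum>z\<in>B. green B y z * f z * mu z)" for y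
        unfolding v(3) by (rule green_op_eq_green[OF fB fB0])
      define F where "F = (\<Sum>z\<in>B. f z * mu z)"
      have gbound: "green B x z * f z * mu z \<le> (C * D\<^sup>2 * E / vol x R) * (f z * mu z)" for z
      proof (cases "f z = 0")
        case False
        then have "z \<in> A" "\<not> nb z \<subseteq> A" using v(5,6) by blast+
        then obtain y where y: "y \<in> nb z" "y \<notin> A" by blast
        have "R / 2 \<le> real (gdist x y)" using y by (simp add: A_def gball_def)
        also have "\<dots> \<le> real (gdist x z) + 1" using gdist_nb_le[OF y(1), of x] by linarith
        finally have d: "R / 4 \<le> real (gdist x z)" using \<open>\<not> R \<le> 4\<close> by linarith
        then have d0: "0 < gdist x z" using R by (cases "gdist x z") auto
        have "green B x z = green B z x" by (rule green_sym[OF fB])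
        also have "\<dots> \<le> C * (E / vol x (real (gdist x z)))" unfolding B_def E_def by (rule C(2)[OF R d0])
        also have "\<dots> \<le> C * (E / (vol x R / D\<^sup>2))"
        proof (intro mult_left_mono divide_left_mono)
          have "vol x R = vol x (2 ^ 2 * (R / 4))" by simp
          also have "\<dots> \<le> D\<^sup>2 * vol x (R / 4)" using R by (intro vol_pow2) simp
          also have "\<dots> \<le> D\<^sup>2 * vol x (real (gdist x z))" using d D2 by (intro mult_left_mono vol_mono) auto
          finally show "vol x R / D\<^sup>2 \<le> vol x (real (gdist x z))"
            using D2 by (simp add: divide_le_eq mult.commute)
          show "0 < vol x (real (gdist x z)) * (vol x R / D\<^sup>2)"
            using V D2 d0 vol_pos[of "real (gdist x z)" x] by (intro mult_pos_pos divide_pos_pos) auto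
        qed (use C(1) E in auto)
        finally have "green B x z \<le> C * D\<^sup>2 * E / vol x R" by (simp add: mult_ac)
        then have "green B x z * (f z * mu z) \<le> (C * D\<^sup>2 * E / vol x R) * (f z * mu z)"
          using v(4) by (intro mult_right_mono) auto
        then show ?thesis by (simp add: mult.assoc)
      qed simp
      have "u x = v x" using v(1)[OF xA] by simp
      also have "\<dots> \<le> (\<Sum>z\<in>B. (C * D\<^sup>2 * E / vol x R) * (f z * mu z))"
        unfolding v_eq by (rule sum_mono) (rule gbound)
      also have "\<dots> = (C * D\<^sup>2 * E / vol x R) * F" by (simp only: F_def sum_distrib_left)
      also have "\<dots> = (C * D\<^sup>2 / vol x R) * (E * F)" by simp
      finally have ux: "u x \<le> (C * D\<^sup>2 / vol x R) * (E * F)" .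
      have "E * F = (\<Sum>z\<in>B. E * (f z * mu z))" by (simp add: F_def sum_distrib_left)
      also have "\<dots> \<le> (\<Sum>z\<in>B. (T * mexit B z) * (f z * mu z))"
      proof (rule sum_mono)
        fix z
        show "E * (f z * mu z) \<le> (T * mexit B z) * (f z * mu z)"
        proof (cases "z \<in> A")
          case True
          have "E = mean_exit x (2 * (R / 2))" by (simp add: E_def)
          also have "\<dots> \<le> T * mean_exit z (R / 2)"
            using R True by (intro time_comparison) (auto simp: A_def)
          also have "\<dots> \<le> T * mexit B z"
          proof (rule mult_left_mono)
            have "gball z (R / 2) \<subseteq> B"
              unfolding B_def using True by (intro gball_subset_triangle) (simp add: A_def gball_def)
            then show "mean_exit z (R / 2) \<le> mexit B z"
              unfolding mean_exit_eq by (rule mexit_mono) (rule fB)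
          qed (use T_gt_1 in simp)
          finally show ?thesis using v(4) by (intro mult_right_mono) auto
        qed (simp add: v(5))
      qed
      also have "\<dots> = (\<Sum>z\<in>B. \<Sum>y\<in>B. T * (green B y z * f z * mu z * mu y))"
        unfolding mexit_eq_green[OF fB]
        by (intro sum.cong refl) (simp add: sum_distrib_left sum_distrib_right green_sym[OF fB] mult_ac)
      also have "\<dots> = (\<Sum>y\<in>B. \<Sum>z\<in>B. T * (green B y z * f z * mu z * mu y))" by (rule sum.swap)
      also have "\<dots> = T * (\<Sum>y\<in>B. v y * mu y)"
        unfolding v_eq by (simp add: sum_distrib_left sum_distrib_right)
      also have "\<dots> \<le> T * S"
        unfolding S_def using T_gt_1 v(2) by (intro mult_left_mono sum_mono mult_right_mono) auto
      finally have EF: "E * F \<le> T * S" .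
      have "u x \<le> (C * D\<^sup>2 / vol x R) * (T * S)"
        using ux mult_left_mono[OF EF, of "C * D\<^sup>2 / vol x R"] C(1) V D2 by simp
      then show ?thesis using V by (simp add: C'_def field_simps)
    qed
    then show ?thesis using V by (simp add: S_def B_def infsum_finite field_simps)
  qed
  show ?thesis
    unfolding mean_value_inequality_def
    by (intro exI[of _ C'] conjI allI impI main) (use C'(2) in auto)
qed

section \<open>Green kernels and the heat kernel\<close>

text \<open>Off the diagonal, the exponential factor compensates the growth of the on-diagonal bound at small
  times.\<close>

lemma upper_imp_hk_le_vol:
  assumes upper_estimate
  shows "\<exists>C\<ge>1. \<forall>k x y. 0 < gdist x y \<longrightarrow> hk UNIV k x y \<le> C / vol x (real (gdist x y))"
proof -
  obtain C b c where C: "C > 0" "b > 1" "c > 0" "\<And>x y n. 0 < n \<Longrightarrow> hk UNIV n x y \<le> C / tvol x n *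
        exp (- c * (mean_exit x (real (gdist x y)) / real n) powr (1 / (b - 1)))"
    using assms unfolding upper_estimate_def heat_kernel_eq tvol_def by blast
  obtain Cv a where Cv: "Cv \<ge> 1" "a \<ge> 0"
    "\<And>x R n L. 0 < R \<Longrightarrow> 0 < n \<Longrightarrow> 1 \<le> L \<Longrightarrow> mean_exit x R \<le> L * real n \<Longrightarrow>
      vol x R \<le> Cv * L powr a * tvol x n"
    using vol_le_tvol by metis
  have "0 < 1 / (b - 1)" using C(2) by simp
  from powr_exp_bounded[OF C(3) this Cv(2)] obtain Cp where Cp: "Cp > 0"
    "\<And>L. 1 \<le> L \<Longrightarrow> L powr a * exp (- c * L powr (1 / (b - 1))) \<le> Cp" by blast
  define K where "K = 1 + C * Cv * max 1 Cp"
  have K0: "0 < C * Cv * max 1 Cp" using C(1) Cv(1) by simp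
  have K: "1 \<le> K" using K0 by (simp add: K_def)
  have "hk UNIV k x y \<le> K / vol x (real (gdist x y))" if d: "0 < gdist x y" for k x y
  proof -
    define r where "r = real (gdist x y)"
    have r: "0 < r" using d by (simp add: r_def)
    have V: "0 < vol x r" using r by (rule vol_pos)
    show ?thesis
    proof (cases "k = 0")
      case True
      then have "hk UNIV k x y = 0" using d by (intro hk_far) simp
      then show ?thesis using K V by (simp add: r_def)
    next
      case False
      then have k: "0 < k" by simp
      define L where "L = max 1 (mean_exit x r / real k)"
      define e where "e = exp (- c * (mean_exit x r / real k) powr (1 / (b - 1)))"
      have L: "1 \<le> L" by (simp add: L_def)
      have "mean_exit x r \<le> L * real k" using k by (simp add: L_def field_simps max_def)
      then have vr: "vol x r \<le> Cv * L powr a * tvol x k" by (rule Cv(3)[OF r k L])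
      have Le: "L powr a * e \<le> max 1 Cp"
      proof (cases "mean_exit x r / real k \<le> 1")
        case True
        then have "L = 1" by (simp add: L_def)
        moreover have "e \<le> 1" using C(3) by (simp add: e_def)
        ultimately show ?thesis by simp
      next
        case False
        then have "L = mean_exit x r / real k" by (simp add: L_def)
        then show ?thesis using Cp(2)[OF L] by (simp add: e_def)
      qed
      have W: "0 < tvol x k" using k by (rule tvol_pos)
      have e: "0 \<le> e" by (simp add: e_def)
      have "hk UNIV k x y \<le> C / tvol x k * e" unfolding e_def r_def by (rule C(4)[OF k])
      then have "hk UNIV k x y * vol x r \<le> C / tvol x k * e * (Cv * L powr a * tvol x k)"
        using vr V W e C(1) by (intro mult_mono) auto
      also have "\<dots> = C * Cv * (L powr a * e)" using W by simp
      also have "\<dots> \<le> C * Cv * max 1 Cp" using Le C(1) Cv(1) by (intro mult_left_mono) auto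
      also have "\<dots> \<le> K" by (simp add: K_def)
      finally show ?thesis using V by (simp add: r_def field_simps)
    qed
  qed
  then show ?thesis using K by (intro exI[of _ K]) simp
qed

text \<open>Up to the exit time, sum the pointwise bounds; what the walk collects after that time is at most the
  on-diagonal bound at the exit time, multiplied by the remaining lifetime.\<close>

lemma upper_imp_green_bound:
  assumes upper_estimate shows green_upper_bound
proof -
  obtain C1 where C1: "C1 \<ge> 1" "\<And>k x y. 0 < gdist x y \<Longrightarrow> hk UNIV k x y \<le> C1 / vol x (real (gdist x y))"
    using upper_imp_hk_le_vol[OF assms] by blast
  obtain C2 where C2: "C2 \<ge> 1" "\<And>x R y z k. 0 < R \<Longrightarrow> y \<in> gball x R \<Longrightarrow> z \<in> gball x R \<Longrightarrow>
      mean_exit x R \<le> real k \<Longrightarrow> hk UNIV k y z \<le> C2 / vol x R"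
    using hk_ball_bound[OF upper_imp_diagonal[OF assms], of 1] by auto
  define C where "C = 2 * C1 + C2 * T"
  have C: "1 < C"
  proof -
    have "0 < C2 * T" using C2(1) T_gt_1 by simp
    then show ?thesis using C1(1) by (simp add: C_def)
  qed
  have main: "green (gball x R) y x \<le> C * (mean_exit x R / vol x (real (gdist x y)))"
    if R: "0 < R" and d: "0 < gdist x y" for x y R
  proof -
    define B E r where "B = gball x R" and "E = mean_exit x R" and "r = real (gdist x y)"
    have fB: "finite B" by (simp add: B_def)
    have E: "1 \<le> E" using mean_exit_ge_1[OF R] by (simp add: E_def)
    have V: "0 < vol x r" using d by (intro vol_pos) (simp add: r_def)
    show ?thesis
    proof (cases "y \<in> B")
      case False
      then show ?thesis using C E V by (simp add: B_def green_outside)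
    next
      case True
      then have rR: "vol x r \<le> vol x R" by (intro vol_mono) (simp add: B_def gball_def r_def)
      define N where "N = nat \<lceil>E\<rceil>"
      have N: "E \<le> real N" "real N \<le> 2 * E" unfolding N_def using E by linarith+
      have sm: "summable (\<lambda>k. hk B k y x)"
        unfolding hk_def by (intro summable_divide killed_prob_summable fB)
      have "green B y x = (\<Sum>k. hk B k y x)"
        unfolding green_def hk_def by (simp add: suminf_divide killed_prob_summable fB)
      also have "\<dots> = (\<Sum>j. hk B (j + N) y x) + (\<Sum>k<N. hk B k y x)"
        by (rule suminf_split_initial_segment[OF sm])
      also have "(\<Sum>k<N. hk B k y x) \<le> (\<Sum>k<N. C1 / vol x r)"
      proof (rule sum_mono)
        fix k
        have "hk B k y x \<le> hk UNIV k y x" by (rule hk_set_mono) simp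
        also have "\<dots> = hk UNIV k x y" by (rule hk_sym)
        also have "\<dots> \<le> C1 / vol x r" unfolding r_def using d by (rule C1)
        finally show "hk B k y x \<le> C1 / vol x r" .
      qed
      also have "(\<Sum>k<N. C1 / vol x r) \<le> 2 * C1 * (E / vol x r)"
      proof -
        have "real N * (C1 / vol x r) \<le> (2 * E) * (C1 / vol x r)"
          using N C1(1) V by (intro mult_right_mono) auto
        then show ?thesis by (simp add: mult_ac)
      qed
      also have "(\<Sum>j. hk B (j + N) y x) \<le> (\<Sum>j. C2 / vol x R * surv B j y)"
      proof (rule suminf_le)
        fix j
        have "hk B (j + N) y x = kpow B j (\<lambda>z. hk B N z x) y" by (rule hk_add_op)
        also have "\<dots> \<le> kpow B j (\<lambda>z. C2 / vol x R * indicator B z) y"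
        proof (rule kpow_mono)
          fix z assume z: "z \<in> B"
          have "hk B N z x \<le> hk UNIV N z x" by (rule hk_set_mono) simp
          also have "\<dots> \<le> C2 / vol x R" using R z N by (intro C2) (auto simp: B_def E_def)
          finally show "hk B N z x \<le> C2 / vol x R * indicator B z" using z by simp
        qed (rule True)
        also have "\<dots> = C2 / vol x R * surv B j y" unfolding kpow_cmult surv_def ..
        finally show "hk B (j + N) y x \<le> C2 / vol x R * surv B j y" .
      next
        show "summable (\<lambda>j. hk B (j + N) y x)" using sm by (rule summable_ignore_initial_segment)
        show "summable (\<lambda>j. C2 / vol x R * surv B j y)" by (intro summable_mult summable_surv fB)
      qed
      also have "(\<Sum>j. C2 / vol x R * surv B j y) = C2 / vol x R * mexit B y"
        unfolding mexit_def by (rule suminf_mult[OF summable_surv[OF fB]])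
      also have "\<dots> \<le> C2 / vol x r * (T * E)"
        using mexit_ball_le[OF R, of y x] True C2(1) V rR mexit_nonneg[OF fB, of y]
        by (intro mult_mono divide_left_mono) (auto simp: B_def E_def intro!: mult_pos_pos)
      also have "C2 / vol x r * (T * E) + 2 * C1 * (E / vol x r) = C * (E / vol x r)"
        by (simp add: C_def algebra_simps add_divide_distrib)
      finally show ?thesis by (simp add: B_def E_def r_def)
    qed
  qed
  show ?thesis
    unfolding green_upper_bound_def by (intro exI[of _ C] conjI allI impI main C)
qed

text \<open>The time spent near the centre is a small part of the exit time: after leaving an intermediate ball,
  the walk returns only for a time which the Green bound controls by a ratio of volumes.\<close>

lemma near_occupation_small:
  assumes green_upper_bound "0 < \<epsilon>"
  shows "\<exists>s\<ge>1. \<forall>x R. s \<le> R \<longrightarrow>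
      (\<Sum>z\<in>gball x (R / s). green (gball x R) z x * mu z) \<le> \<epsilon> * mean_exit x R"
proof -
  obtain C where C: "C > 1" "\<And>x y R. 0 < R \<Longrightarrow> 0 < gdist x y \<Longrightarrow>
      green (gball x R) y x \<le> C * (mean_exit x R / vol x (real (gdist x y)))"
    using assms(1) unfolding green_upper_bound_def by blast
  obtain s1 where s1: "s1 \<ge> 1" "\<And>x r. 1 \<le> r \<Longrightarrow> (2 / \<epsilon>) * mean_exit x r \<le> mean_exit x (s1 * r)"
    using mean_exit_reverse by blast
  define Mv where "Mv = 2 * C * T / \<epsilon>"
  have Mv: "0 < Mv" using C(1) T_gt_1 assms(2) by (simp add: Mv_def)
  obtain s2 where s2: "s2 \<ge> 1" "\<And>x r. 1 \<le> r \<Longrightarrow> Mv * vol x r \<le> vol x (s2 * r)"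
    using vol_reverse by blast
  \<comment> \<open>Dividing \<open>R\<close> by \<open>s1\<close> gives the intermediate ball, with a small exit time; dividing further by
    \<open>4 s2\<close> gives the inner ball, of small volume in comparison.\<close>
  define s where "s = 4 * s1 * s2"
  have s: "1 \<le> s" "s1 \<le> s"
  proof -
    have "s1 * 1 \<le> s1 * s2" using s1(1) s2(1) by (intro mult_left_mono) auto
    then show "1 \<le> s" "s1 \<le> s" using s1(1) unfolding s_def by linarith+
  qed
  have "(\<Sum>z\<in>gball x (R / s). green (gball x R) z x * mu z) \<le> \<epsilon> * mean_exit x R" if R: "s \<le> R" for x R
  proof -
    define r' r where "r' = R / s1" and "r = R / s"
    define A B F where "A = gball x r" and "B = gball x R" and "F = gball x r'"
    define E where "E = mean_exit x R"
    have R0: "0 < R" using R s by linarith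
    have rr: "r' / 4 = s2 * r" using s1(1) s2(1) by (simp add: r'_def r_def s_def)
    have r1: "1 \<le> r" "1 \<le> r'" "r' \<le> R"
      using R R0 s s1(1) by (simp_all add: r_def r'_def field_simps mult_le_cancel_left1)
    have r4: "r \<le> r' / 4" unfolding rr using s2(1) r1 mult_right_mono[of 1 s2 r] by simp
    have fB: "finite B" by (simp add: B_def)
    have AB: "A \<subseteq> B" and FB: "F \<subseteq> B"
      using r1 r4 by (auto simp: A_def B_def F_def gball_def)
    have E: "0 < E" using mean_exit_pos[OF R0] by (simp add: E_def)
    define v where "v = green_op B (indicator A)"
    have iA: "indicator A y = (0::real)" if "y \<notin> B" for y
      using AB that by (auto simp: indicator_def)
    have v_eq: "v y = (\<Sum>z\<in>A. green B y z * mu z)" for y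
    proof -
      have "v y = (\<Sum>z\<in>B. green B y z * indicator A z * mu z)"
        unfolding v_def by (rule green_op_eq_green[OF fB iA])
      also have "\<dots> = (\<Sum>z\<in>A. green B y z * mu z)"
        using fB AB by (intro sum.mono_neutral_cong_right) auto
      finally show ?thesis .
    qed
    have v0: "v y = 0" if "y \<notin> B" for y using that by (simp add: v_eq green_outside)
    have step: "v y \<le> 1 + (\<Sum>z\<in>nb y. trans_prob y z * v z)" if "y \<in> F" for y
    proof -
      have "v y = indicator A y + killed_op B v y"
        unfolding v_def by (rule green_op_step[OF fB iA])
      also have "killed_op B v y = (\<Sum>z\<in>nb y. trans_prob y z * v z)"
        by (rule killed_op_vanishing) (use that FB v0 in auto)
      also have "indicator A y \<le> (1 :: real)" by (simp add: indicator_def)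
      finally show ?thesis by simp
    qed
    have far: "v y \<le> \<epsilon> / 2 * E" if y: "y \<notin> F" for y
    proof (cases "y \<in> B")
      case False
      then show ?thesis using v0 assms(2) E by simp
    next
      case True
      have g: "green B y z \<le> C * T * E / vol x (r' / 4)" if z: "z \<in> A" for z
      proof -
        have dz: "real (gdist x z) < r" using z by (simp add: A_def gball_def)
        have "r' \<le> real (gdist x y)" using y by (simp add: F_def gball_def)
        also have "\<dots> \<le> real (gdist x z) + real (gdist z y)" using gdist_triangle[of x y z] by linarith
        finally have d: "r' / 2 \<le> real (gdist z y)" using dz r4 r1 by linarith
        then have d0: "0 < gdist z y" using r1 by (cases "gdist z y") auto
        have "B \<subseteq> gball z (2 * R)"
          unfolding B_def using dz r4 r1 by (intro gball_subset_triangle) (simp add: gdist_sym)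
        then have "green B y z \<le> green (gball z (2 * R)) y z" by (rule green_mono) simp
        also have "\<dots> \<le> C * (mean_exit z (2 * R) / vol z (real (gdist z y)))"
          using R0 d0 by (intro C) auto
        also have "\<dots> \<le> C * ((T * E) / vol x (r' / 4))"
        proof (intro mult_left_mono frac_le)
          show "mean_exit z (2 * R) \<le> T * E"
            unfolding E_def using R0 dz r4 r1
            by (intro time_comparison) (auto simp: gball_def gdist_sym)
          have "vol x (r' / 4) \<le> vol z (r' / 2)"
            using dz r4 by (intro vol_mono_set gball_subset_triangle) (simp add: gdist_sym)
          also have "\<dots> \<le> vol z (real (gdist z y))" using d by (rule vol_mono)
          finally show "vol x (r' / 4) \<le> vol z (real (gdist z y))" .
          show "0 < vol x (r' / 4)" using r1 by (intro vol_pos) simp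
        qed (use C(1) T_gt_1 E in auto)
        finally show ?thesis by simp
      qed
      have V4: "0 < vol x (r' / 4)" using r1 by (intro vol_pos) simp
      have "v y \<le> (\<Sum>z\<in>A. C * T * E / vol x (r' / 4) * mu z)"
        unfolding v_eq by (intro sum_mono mult_right_mono g) auto
      also have "\<dots> = C * T * E / vol x (r' / 4) * vol x r"
        by (simp add: vol_eq A_def sum_distrib_left)
      also have "\<dots> \<le> C * T * E / vol x (r' / 4) * (vol x (r' / 4) / Mv)"
      proof (rule mult_left_mono)
        have "Mv * vol x r \<le> vol x (r' / 4)" unfolding rr using r1 by (intro s2)
        then show "vol x r \<le> vol x (r' / 4) / Mv" using Mv by (simp add: field_simps)
      qed (use C(1) T_gt_1 E V4 in auto)
      also have "\<dots> = \<epsilon> / 2 * E"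
        using V4 C(1) T_gt_1 assms(2) by (simp add: Mv_def)
      finally show ?thesis .
    qed
    have "v x \<le> 1 * mexit F x + \<epsilon> / 2 * E"
      by (rule exit_comparison[where u = v]) (use step far r1 in \<open>auto simp: F_def\<close>)
    also have "mexit F x = mean_exit x r'" by (simp add: F_def mean_exit_eq)
    also have "1 * mean_exit x r' + \<epsilon> / 2 * E \<le> \<epsilon> / 2 * E + \<epsilon> / 2 * E"
      using s1(2)[of r' x] r1 s1(1) assms(2) by (simp add: r'_def E_def field_simps)
    finally have "v x \<le> \<epsilon> / 2 * E + \<epsilon> / 2 * E" .
    then have "v x \<le> \<epsilon> * E" by (simp add: algebra_simps)
    then show ?thesis unfolding v_eq by (simp add: A_def B_def E_def r_def green_sym[of "gball x R" x])
  qed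
  then show ?thesis using s(1) by blast
qed

text \<open>The sum of \<open>p\<^sub>k(x, x)\<close> over \<open>m \<le> k \<le> 2m\<close> is at most the Green kernel with pole \<open>x\<close>,
  averaged over the position at time \<open>m\<close>. Far from \<open>x\<close> the Green bound applies; near \<open>x\<close> the
  induction hypothesis bounds the law of that position, and the factor gained is the small occupation time.\<close>

lemma green_bound_imp_diagonal:
  assumes green: green_upper_bound shows local_diagonal_upper_estimate
proof (rule bootstrap)
  obtain C where C: "C > 1" "\<And>x y R. 0 < R \<Longrightarrow> 0 < gdist x y \<Longrightarrow>
      green (gball x R) y x \<le> C * (mean_exit x R / vol x (real (gdist x y)))"
    using green unfolding green_upper_bound_def by blast
  obtain Ch a where Ch: "Ch \<ge> 1" "a \<ge> 0" "\<And>x y z n k L \<rho> K. 0 < n \<Longrightarrow> 0 < k \<Longrightarrow> 1 \<le> L \<Longrightarrow> 0 \<le> K \<Longrightarrow>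
      real (gdist x y) < \<rho> \<Longrightarrow> real (gdist x z) < \<rho> \<Longrightarrow>
      real n \<le> L * real k \<Longrightarrow> mean_exit x \<rho> \<le> L * real k \<Longrightarrow>
      diag UNIV (k div 2) y \<le> K / tvol y k \<Longrightarrow> diag UNIV (k div 2) z \<le> K / tvol z k \<Longrightarrow>
      hk UNIV k y z \<le> K * Ch * L powr a / tvol x n"
    using hk_le_tvol by metis
  obtain Cp where Cp: "Cp \<ge> 1" "\<And>K m t x. diag_bounded K m \<Longrightarrow> 0 \<le> K \<Longrightarrow> 2 \<le> t \<Longrightarrow> t < 2 * m \<Longrightarrow>
     diag UNIV (t div 2) x \<le> Cp * K / tvol x t"
    using diag_bounded_half by metis
  fix \<Lambda> :: nat and \<epsilon> :: real assume \<Lambda>: "1 \<le> \<Lambda>" and \<epsilon>: "0 < \<epsilon>"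
  define L where "L = 2 * inv_exit_const * real \<Lambda>"
  have L: "2 \<le> L" using mult_mono[of 1 inv_exit_const 1 "real \<Lambda>"] inv_exit_const_ge_1 \<Lambda> by (simp add: L_def)
  define G where "G = Cp * Ch * L powr a"
  have G: "0 < G" using Cp(1) Ch(1) L by (simp add: G_def)
  define \<epsilon>1 where "\<epsilon>1 = \<epsilon> / (2 * G * L)"
  have \<epsilon>1: "0 < \<epsilon>1" using \<epsilon> G L by (simp add: \<epsilon>1_def)
  obtain s where s: "s \<ge> 1" "\<And>x R. s \<le> R \<Longrightarrow>
      (\<Sum>z\<in>gball x (R / s). green (gball x R) z x * mu z) \<le> \<epsilon>1 * mean_exit x R"
    using near_occupation_small[OF green \<epsilon>1] by blast
  obtain Cs where Cs: "Cs \<ge> 1" "\<And>x r. 0 < r \<Longrightarrow> vol x (s * r) \<le> Cs * vol x r"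
    using vol_dilate[of s] by blast
  define C' where "C' = max Cs (2 * (C * Cs * L))"
  have "diag (gball x (real (inv_exit x (\<Lambda> * (2 * m))))) m x \<le> (\<epsilon> * K + C') / tvol x (2 * m)"
    if m: "2 \<le> m" and K: "0 \<le> K"
      and hyp: "diag_bounded K m" for x m K
  proof -
    define R where "R = real (inv_exit x (\<Lambda> * (2 * m)))"
    define B where "B = gball x R"
    define E where "E = mean_exit x R"
    have R: "1 \<le> R" and ER': "E \<le> inv_exit_const * (real \<Lambda> * (2 * real m))"
      and VW: "tvol x (2 * m) \<le> vol x R"
      using inv_exit_dilate[OF \<Lambda>, of "2 * m" x] m by (simp_all add: R_def E_def)
    have ER: "E \<le> L * real m" using ER' by (simp add: L_def mult_ac)
    have W: "0 < tvol x (2 * m)" using m by (auto intro!: tvol_pos)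
    have V: "0 < vol x R" using R by (intro vol_pos) simp
    have E0: "0 \<le> E" by (simp add: E_def)
    have xB: "x \<in> B" and fB: "finite B" using R by (auto simp: B_def)
    have "diag B m x \<le> (\<epsilon> * K + C') / tvol x (2 * m)"
    proof (cases "R < s")
      \<comment> \<open>Again a ball of bounded radius, where \<open>1 / \<mu>(x)\<close> is a good enough bound.\<close>
      case True
      have "vol x R \<le> vol x (s * 1)" using True by (intro vol_mono) simp
      also have "\<dots> \<le> Cs * vol x 1" by (rule Cs) simp
      finally have vR: "vol x R \<le> Cs * mu x" by (simp add: vol_unit)
      have "diag B m x \<le> 1 / mu x" unfolding diag_def by (rule hk_le_mu)
      also have "\<dots> \<le> Cs / vol x R" using vR V mu_pos[of x] by (simp add: field_simps)
      also have "\<dots> \<le> Cs / tvol x (2 * m)" using VW V W Cs(1) by (intro divide_left_mono) auto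
      also have "\<dots> \<le> (\<epsilon> * K + C') / tvol x (2 * m)"
        using W \<epsilon> K by (intro divide_right_mono) (auto simp: C'_def intro: add_increasing)
      finally show ?thesis .
    next
      case False
      then have Rs: "s \<le> R" by simp
      define A where "A = gball x (R / s)"
      have AB: "A \<subseteq> B" unfolding A_def B_def using R s(1) by (intro gball_mono) (simp add: field_simps)
      have near: "hk B m x z \<le> K * G / tvol x (2 * m)" if z: "z \<in> B" for z
      proof -
        have dg: "diag UNIV (m div 2) y \<le> (Cp * K) / tvol y m" for y
          using m K by (intro Cp(2)[OF hyp]) auto
        have "hk B m x z \<le> hk UNIV m x z" by (rule hk_set_mono) simp
        also have "\<dots> \<le> (Cp * K) * Ch * L powr a / tvol x (2 * m)"
        proof (rule Ch(3)[where \<rho> = R])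
          show "real (2 * m) \<le> L * real m" using mult_right_mono[OF L, of "real m"] by simp
          show "mean_exit x R \<le> L * real m" using ER by (simp add: E_def)
          show "real (gdist x z) < R" using z by (simp add: B_def gball_def)
        qed (use m L K Cp(1) R dg in auto)
        finally show ?thesis by (simp add: G_def mult_ac)
      qed
      have far: "green B z x \<le> C * Cs * E / vol x R" if z: "z \<notin> A" for z
      proof -
        have d: "R / s \<le> real (gdist x z)" using z by (simp add: A_def gball_def)
        have Rs0: "0 < R / s" using R s(1) by simp
        then have d0: "0 < gdist x z" using d by (cases "gdist x z") auto
        have "green B z x \<le> C * (E / vol x (real (gdist x z)))"
          unfolding B_def E_def using R d0 by (intro C) auto
        also have "\<dots> \<le> C * (E / (vol x R / Cs))"
        proof (intro mult_left_mono divide_left_mono)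
          have "vol x R = vol x (s * (R / s))" using s(1) by simp
          also have "\<dots> \<le> Cs * vol x (R / s)" using Rs0 by (rule Cs)
          also have "\<dots> \<le> Cs * vol x (real (gdist x z))" using d Cs(1) by (intro mult_left_mono vol_mono) auto
          finally show "vol x R / Cs \<le> vol x (real (gdist x z))"
            using Cs(1) by (simp add: divide_le_eq mult.commute)
          show "0 < vol x (real (gdist x z)) * (vol x R / Cs)"
            using V Cs(1) d0 vol_pos[of "real (gdist x z)" x] by (intro mult_pos_pos divide_pos_pos) auto
        qed (use C(1) E0 in auto)
        finally show ?thesis by (simp add: mult_ac)
      qed
      let ?w = "\<lambda>z. hk B m x z * mu z"
      have sum_green: "(\<Sum>i\<le>m. hk B (m + i) x x) \<le> (\<Sum>z\<in>B. ?w z * green B z x)"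
      proof -
        have "hk B (m + i) x x = (\<Sum>z\<in>B. ?w z * hk B i z x)" for i
        proof -
          have "hk B (m + i) x x = kpow B m (\<lambda>z. hk B i z x) x" by (rule hk_add_op)
          also have "\<dots> = (\<Sum>z\<in>B. killed_prob B m x z * hk B i z x)"
            by (rule kpow_kernel) (use fB in \<open>auto simp: hk_outside\<close>)
          finally show ?thesis by (simp add: hk_def)
        qed
        then have "(\<Sum>i\<le>m. hk B (m + i) x x) = (\<Sum>z\<in>B. ?w z * (\<Sum>i\<le>m. hk B i z x))"
          by (simp add: sum_distrib_left) (rule sum.swap)
        also have "\<dots> \<le> (\<Sum>z\<in>B. ?w z * green B z x)"
        proof (intro sum_mono mult_left_mono)
          fix z
          have "(\<Sum>i\<le>m. hk B i z x) \<le> (\<Sum>i. hk B i z x)"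
            unfolding hk_def by (intro sum_le_suminf summable_divide killed_prob_summable fB) auto
          also have "\<dots> = green B z x"
            unfolding green_def hk_def by (simp add: suminf_divide killed_prob_summable fB)
          finally show "(\<Sum>i\<le>m. hk B i z x) \<le> green B z x" .
        qed auto
        finally show ?thesis .
      qed
      have sum_diag: "real m / 2 * diag B m x \<le> (\<Sum>i\<le>m. hk B (m + i) x x)"
      proof -
        \<comment> \<open>The even times \<open>2 j\<close> between \<open>m\<close> and \<open>2 m\<close> are enough, since the diagonal decreases along them.\<close>
        let ?J = "{m - m div 2..m}"
        have "real m \<le> 2 * real (card ?J)"
        proof -
          have "m \<le> 2 * card ?J" by simp
          then have "real m \<le> real (2 * card ?J)" by (rule of_nat_mono)
          then show ?thesis by simp
        qed
        then have "real m / 2 * diag B m x \<le> real (card ?J) * diag B m x"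
          by (intro mult_right_mono) auto
        also have "\<dots> = (\<Sum>j\<in>?J. diag B m x)" by simp
        also have "\<dots> \<le> (\<Sum>j\<in>?J. hk B (m + (2 * j - m)) x x)"
        proof (rule sum_mono)
          fix j assume j: "j \<in> ?J"
          then have "m + (2 * j - m) = 2 * j" by auto
          then show "diag B m x \<le> hk B (m + (2 * j - m)) x x"
            using diag_antimono[of j m B x] j by (simp add: diag_def)
        qed
        also have "\<dots> = (\<Sum>i\<in>(\<lambda>j. 2 * j - m) ` ?J. hk B (m + i) x x)"
        proof (subst sum.reindex)
          show "inj_on (\<lambda>j. 2 * j - m) ?J" by (rule inj_onI) auto
        qed simp
        also have "\<dots> \<le> (\<Sum>i\<le>m. hk B (m + i) x x)" by (rule sum_mono2) auto
        finally show ?thesis .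
      qed
      have split: "(\<Sum>z\<in>B. ?w z * green B z x) = (\<Sum>z\<in>A. ?w z * green B z x) + (\<Sum>z\<in>B - A. ?w z * green B z x)"
        using sum.subset_diff[OF AB fB, of "\<lambda>z. ?w z * green B z x"] by simp
      have near_sum: "(\<Sum>z\<in>A. ?w z * green B z x) \<le> K * G / tvol x (2 * m) * (\<epsilon>1 * E)"
      proof -
        have "(\<Sum>z\<in>A. ?w z * green B z x) \<le> (\<Sum>z\<in>A. (K * G / tvol x (2 * m) * mu z) * green B z x)"
        proof (rule sum_mono)
          fix z assume "z \<in> A"
          then have "?w z \<le> K * G / tvol x (2 * m) * mu z"
            using AB by (intro mult_right_mono[OF near]) auto
          then show "?w z * green B z x \<le> (K * G / tvol x (2 * m) * mu z) * green B z x"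
            by (rule mult_right_mono) (rule green_nonneg[OF fB])
        qed
        also have "\<dots> = K * G / tvol x (2 * m) * (\<Sum>z\<in>A. green B z x * mu z)"
          unfolding sum_distrib_left by (rule sum.cong[OF refl]) (simp only: mult_ac)
        also have "\<dots> \<le> K * G / tvol x (2 * m) * (\<epsilon>1 * E)"
        proof (rule mult_left_mono)
          show "(\<Sum>z\<in>A. green B z x * mu z) \<le> \<epsilon>1 * E"
            unfolding A_def B_def E_def by (rule s(2)[OF Rs])
        qed (use K G W in simp)
        finally show ?thesis .
      qed
      have far_sum: "(\<Sum>z\<in>B - A. ?w z * green B z x) \<le> C * Cs * E / vol x R"
      proof -
        have "(\<Sum>z\<in>B - A. ?w z * green B z x) \<le> (\<Sum>z\<in>B - A. ?w z * (C * Cs * E / vol x R))"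
        proof (rule sum_mono)
          fix z assume "z \<in> B - A"
          then have "green B z x \<le> C * Cs * E / vol x R" by (intro far) simp
          then show "?w z * green B z x \<le> ?w z * (C * Cs * E / vol x R)"
            by (rule mult_left_mono) simp
        qed
        also have "\<dots> \<le> (\<Sum>z\<in>B. ?w z * (C * Cs * E / vol x R))"
          using fB C(1) Cs(1) E0 V by (intro sum_mono2) auto
        also have "\<dots> = surv B m x * (C * Cs * E / vol x R)"
          by (simp only: surv_eq_sum_hk[OF fB] sum_distrib_right)
        also have "\<dots> \<le> 1 * (C * Cs * E / vol x R)"
          using C(1) Cs(1) E0 V by (intro mult_right_mono) auto
        finally show ?thesis by simp
      qed
      have "real m / 2 * diag B m x \<le> K * G / tvol x (2 * m) * (\<epsilon>1 * E) + C * Cs * E / vol x R"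
        using sum_green sum_diag split near_sum far_sum by linarith
      also have "\<dots> \<le> K * G / tvol x (2 * m) * (\<epsilon>1 * (L * real m)) + C * Cs * (L * real m) / tvol x (2 * m)"
        using ER E0 K G W \<epsilon>1 C(1) Cs(1) VW L by (intro add_mono mult_left_mono frac_le) auto
      also have "\<dots> = real m / 2 * ((\<epsilon> * K + 2 * (C * Cs * L)) / tvol x (2 * m))"
        using G L W by (simp add: \<epsilon>1_def field_simps)
      finally have "diag B m x \<le> (\<epsilon> * K + 2 * (C * Cs * L)) / tvol x (2 * m)"
        using m by (subst (asm) mult_le_cancel_left_pos) auto
      also have "\<dots> \<le> (\<epsilon> * K + C') / tvol x (2 * m)"
        using W by (intro divide_right_mono) (auto simp: C'_def)
      finally show ?thesis .
    qed
    then show ?thesis by (simp add: B_def R_def)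
  qed
  then show "\<exists>C. \<forall>x m K. 2 \<le> m \<longrightarrow> 0 \<le> K \<longrightarrow> diag_bounded K m \<longrightarrow>
      diag (gball x (real (inv_exit x (\<Lambda> * (2 * m))))) m x \<le> (\<epsilon> * K + C) / tvol x (2 * m)"
    by blast
qed

end

lemma (in weighted_graph) doubling_graph_exists:
  assumes p0_condition VD TC
  shows "\<exists>p0 D T. doubling_graph adj w p0 D T"
proof -
  obtain p0 where p0: "p0 > 0" "\<And>x y. adj x y \<Longrightarrow> p0 \<le> w x y / mu x"
    using assms(1) unfolding p0_condition_def by blast
  obtain D where D: "\<And>x R. 0 < R \<Longrightarrow> vol x (2 * R) \<le> D * vol x R"
    using assms(2) unfolding VD_def by blast
  obtain T where T: "T > 1"
    "\<And>x y R. 0 < R \<Longrightarrow> y \<in> gball x R \<Longrightarrow> mean_exit x (2 * R) / mean_exit y R \<le> T"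
    using assms(3) unfolding TC_def by blast
  interpret p0_graph adj w p0 by unfold_locales (use p0 in auto)
  have "doubling_graph adj w p0 D T"
  proof unfold_locales
    fix x y and R :: real assume "0 < R" "y \<in> gball x R"
    then show "mean_exit x (2 * R) \<le> T * mean_exit y R"
      using T(2) mean_exit_pos[of R y] by (simp add: divide_le_eq)
  qed (use D T in auto)
  then show ?thesis by blast
qed

theorem theorem3p1:
  fixes adj :: "'a \<Rightarrow> 'a \<Rightarrow> bool" and w :: "'a \<Rightarrow> 'a \<Rightarrow> real" and c1 c2 :: real
  assumes "weighted_graph adj w"
    and "0 \<le> c1" and "c1 < c2"
    and "weighted_graph.p0_condition adj w"
    and "weighted_graph.VD adj w"
    and "weighted_graph.TC adj w"
  shows "(weighted_graph.local_diagonal_upper_estimate adj w \<longleftrightarrow>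
            weighted_graph.upper_estimate adj w) \<and>
         (weighted_graph.upper_estimate adj w \<longleftrightarrow>
            weighted_graph.parabolic_mean_value_inequality adj w c1 c2) \<and>
         (weighted_graph.parabolic_mean_value_inequality adj w c1 c2 \<longleftrightarrow>
            weighted_graph.mean_value_inequality adj w) \<and>
         (weighted_graph.mean_value_inequality adj w \<longleftrightarrow>
            weighted_graph.green_mean_value_property adj w) \<and>
         (weighted_graph.green_mean_value_property adj w \<longleftrightarrow>
            weighted_graph.green_upper_bound adj w)"
proof -
  from weighted_graph.doubling_graph_exists[OF assms(1,4-6)] obtain p0 D T
    where "doubling_graph adj w p0 D T" by blast
  then interpret doubling_graph adj w p0 D T .
  note par = diagonal_imp_parabolic[OF _ assms(2,3)] parabolic_imp_diagonal[OF _ assms(2,3)]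
  show ?thesis
    using upper_imp_diagonal diagonal_imp_upper par upper_imp_green_bound
      mean_value_imp_green_mean_value green_mean_value_imp_green_bound
      green_bound_imp_mean_value green_bound_imp_diagonal
    by blast
qed

end
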